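(* On a complex manifold $M$ of complex dimension $n$, the sequence $$0 \to \underline{\mathbb{C}} \to \Omega_{\mathrm{an}}^0 \xrightarrow{d} \Omega_{\mathrm{an}}^1 \xrightarrow{d} \cdots \to \Omega_{\mathrm{an}}^n \to 0$$ of sheaves is exact.
   Context: $\underline{\mathbb{C}}$ is the sheaf of locally constant $\mathbb{C}$-valued functions on $M$; $\Omega_{\mathrm{an}}^k$ is the sheaf of holomorphic $k$-forms on $M$ (in the complex topology); $d$ is the exterior derivative. *)

theory Defs
  imports "HOL-Analysis.Analysis" "HOL-Library.Function_Algebras"
begin

section \<open>Sheaves of abelian groups on a topological space\<close>

text \<open>
  The sections over every open set are a subgroup of one ambient abelian group \<open>'s\<close>.
  \<open>restr F U V\<close> is the restriction from \<open>U\<close> to \<open>V\<close>; it is only meaningful for \<open>V \<subseteq> U\<close>.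
\<close>

record ('p, 's) presheaf =
  sections :: "'p set \<Rightarrow> 's set"
  restr :: "'p set \<Rightarrow> 'p set \<Rightarrow> 's \<Rightarrow> 's"

definition is_presheaf :: "'p topology \<Rightarrow> ('p, 's::ab_group_add) presheaf \<Rightarrow> bool" where
  "is_presheaf X F \<longleftrightarrow>
    (\<forall>U. openin X U \<longrightarrow>
      0 \<in> sections F U \<and>
      (\<forall>s\<in>sections F U. \<forall>t\<in>sections F U. s + t \<in> sections F U) \<and>
      (\<forall>s\<in>sections F U. - s \<in> sections F U) \<and>
      (\<forall>s\<in>sections F U. restr F U U s = s)) \<and>
    (\<forall>U V. openin X U \<and> openin X V \<and> V \<subseteq> U \<longrightarrow>
      (\<forall>s\<in>sections F U. restr F U V s \<in> sections F V) \<and>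
      (\<forall>s\<in>sections F U. \<forall>t\<in>sections F U.
        restr F U V (s + t) = restr F U V s + restr F U V t)) \<and>
    (\<forall>U V W. openin X U \<and> openin X V \<and> openin X W \<and> W \<subseteq> V \<and> V \<subseteq> U \<longrightarrow>
      (\<forall>s\<in>sections F U. restr F V W (restr F U V s) = restr F U W s))"

definition is_sheaf :: "'p topology \<Rightarrow> ('p, 's::ab_group_add) presheaf \<Rightarrow> bool" where
  "is_sheaf X F \<longleftrightarrow> is_presheaf X F \<and>
    (\<forall>\<U>. (\<forall>U\<in>\<U>. openin X U) \<longrightarrow>
      (\<forall>s\<in>sections F (\<Union>\<U>). \<forall>t\<in>sections F (\<Union>\<U>).
        (\<forall>U\<in>\<U>. restr F (\<Union>\<U>) U s = restr F (\<Union>\<U>) U t) \<longrightarrow> s = t) \<and>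
      (\<forall>\<sigma>. (\<forall>U\<in>\<U>. \<sigma> U \<in> sections F U) \<and>
           (\<forall>U\<in>\<U>. \<forall>V\<in>\<U>. restr F U (U \<inter> V) (\<sigma> U) = restr F V (U \<inter> V) (\<sigma> V)) \<longrightarrow>
        (\<exists>s\<in>sections F (\<Union>\<U>). \<forall>U\<in>\<U>. restr F (\<Union>\<U>) U s = \<sigma> U)))"

definition sheaf_morphism ::
  "'p topology \<Rightarrow> ('p, 's::ab_group_add) presheaf \<Rightarrow> ('p, 't::ab_group_add) presheaf \<Rightarrow>
    ('p set \<Rightarrow> 's \<Rightarrow> 't) \<Rightarrow> bool" where
  "sheaf_morphism X F G f \<longleftrightarrow>
    (\<forall>U. openin X U \<longrightarrow>
      (\<forall>s\<in>sections F U. f U s \<in> sections G U) \<and>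
      (\<forall>s\<in>sections F U. \<forall>t\<in>sections F U. f U (s + t) = f U s + f U t)) \<and>
    (\<forall>U V. openin X U \<and> openin X V \<and> V \<subseteq> U \<longrightarrow>
      (\<forall>s\<in>sections F U. f V (restr F U V s) = restr G U V (f U s)))"

definition kernel_sections ::
  "('p, 's::ab_group_add) presheaf \<Rightarrow> ('p set \<Rightarrow> 's \<Rightarrow> 't::ab_group_add) \<Rightarrow> 'p set \<Rightarrow> 's set" where
  "kernel_sections F f U = {s \<in> sections F U. f U s = 0}"

text \<open>The image sheaf: the sections that lie locally in the image of the morphism.\<close>

definition image_sections ::
  "'p topology \<Rightarrow> ('p, 's) presheaf \<Rightarrow> ('p, 't) presheaf \<Rightarrow>
    ('p set \<Rightarrow> 's \<Rightarrow> 't) \<Rightarrow> 'p set \<Rightarrow> 't set" where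
  "image_sections X F G f U =
    {s \<in> sections G U. \<forall>p\<in>U. \<exists>V. openin X V \<and> p \<in> V \<and> V \<subseteq> U \<and>
      restr G U V s \<in> f V ` sections F V}"

definition exact_at ::
  "'p topology \<Rightarrow>
    ('p, 's::ab_group_add) presheaf \<Rightarrow> ('p set \<Rightarrow> 's \<Rightarrow> 't) \<Rightarrow>
    ('p, 't::ab_group_add) presheaf \<Rightarrow> ('p set \<Rightarrow> 't \<Rightarrow> 'u) \<Rightarrow>
    ('p, 'u::ab_group_add) presheaf \<Rightarrow> bool" where
  "exact_at X F f G g H \<longleftrightarrow>
    is_sheaf X F \<and> is_sheaf X G \<and> is_sheaf X H \<and>
    sheaf_morphism X F G f \<and> sheaf_morphism X G H g \<and>
    (\<forall>U. openin X U \<longrightarrow> image_sections X F G f U = kernel_sections G g U)"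

definition zero_sheaf :: "('p, complex) presheaf" where
  "zero_sheaf = \<lparr>sections = \<lambda>U. {0}, restr = \<lambda>U V s. s\<rparr>"

definition zero_morphism :: "'p set \<Rightarrow> 's \<Rightarrow> 't::ab_group_add" where
  "zero_morphism U s = 0"


section \<open>Holomorphic functions on open subsets of \<open>\<complex>\<^sup>n\<close>\<close>

text \<open>
  As with \<^const>\<open>Euclidean_space\<close>, the space \<open>\<complex>\<^sup>n\<close> consists of the sequences that
  vanish from index \<open>n\<close> on, so that \<open>n\<close> can be any natural number, including \<open>0\<close>.  The
  topology is induced by the product topology on \<^typ>\<open>nat \<Rightarrow> complex\<close>.
\<close>

definition cspace :: "nat \<Rightarrow> (nat \<Rightarrow> complex) set" where
  "cspace n = {z. \<forall>i\<ge>n. z i = 0}"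

text \<open>To be used for \<open>W\<close> open in \<^term>\<open>cspace n\<close>.\<close>

definition holo :: "nat \<Rightarrow> ((nat \<Rightarrow> complex) \<Rightarrow> complex) \<Rightarrow> (nat \<Rightarrow> complex) set \<Rightarrow> bool" where
  "holo n f W \<longleftrightarrow> continuous_on W f \<and>
    (\<forall>z\<in>W. \<forall>i<n. (\<lambda>t. f (z(i := t))) field_differentiable (at (z i)))"

definition cpartial :: "nat \<Rightarrow> ((nat \<Rightarrow> complex) \<Rightarrow> complex) \<Rightarrow> (nat \<Rightarrow> complex) \<Rightarrow> complex" where
  "cpartial i f z = deriv (\<lambda>t. f (z(i := t))) (z i)"


section \<open>Complex manifolds\<close>

type_synonym 'a chart = "'a set \<times> ('a \<Rightarrow> nat \<Rightarrow> complex)"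

abbreviation cdom :: "'a chart \<Rightarrow> 'a set" where
  "cdom c \<equiv> fst c"

abbreviation coord :: "'a chart \<Rightarrow> 'a \<Rightarrow> nat \<Rightarrow> complex" where
  "coord c \<equiv> snd c"

abbreviation chart_inv :: "'a chart \<Rightarrow> (nat \<Rightarrow> complex) \<Rightarrow> 'a" where
  "chart_inv c \<equiv> inv_into (cdom c) (coord c)"

definition is_chart :: "nat \<Rightarrow> 'a topology \<Rightarrow> 'a chart \<Rightarrow> bool" where
  "is_chart n M c \<longleftrightarrow>
    openin M (cdom c) \<and>
    openin (top_of_set (cspace n)) (coord c ` cdom c) \<and>
    homeomorphic_map (subtopology M (cdom c)) (top_of_set (coord c ` cdom c)) (coord c)"

text \<open>The holomorphic atlas is arbitrary; it may or may not be maximal.\<close>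

definition complex_manifold :: "nat \<Rightarrow> 'a topology \<Rightarrow> 'a chart set \<Rightarrow> bool" where
  "complex_manifold n M \<A> \<longleftrightarrow>
    Hausdorff_space M \<and> second_countable M \<and>
    (\<forall>c\<in>\<A>. is_chart n M c) \<and>
    (\<Union>c\<in>\<A>. cdom c) = topspace M \<and>
    (\<forall>c\<in>\<A>. \<forall>c'\<in>\<A>. \<forall>i<n.
      holo n (\<lambda>z. coord c' (chart_inv c z) i) (coord c ` (cdom c \<inter> cdom c')))"

text \<open>The derivative at \<open>p\<close> of the coordinate change from \<open>c\<close> to \<open>c'\<close>.\<close>

definition transition_deriv ::
  "nat \<Rightarrow> 'a chart \<Rightarrow> 'a chart \<Rightarrow> 'a \<Rightarrow> (nat \<Rightarrow> complex) \<Rightarrow> nat \<Rightarrow> complex" where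
  "transition_deriv n c c' p v =
    (\<lambda>i. if i < n
         then \<Sum>j<n. v j * cpartial j (\<lambda>z. coord c' (chart_inv c z) i) (coord c p)
         else 0)"


section \<open>The sheaves in the sequence\<close>

text \<open>The sheaf of locally constant functions; sections over \<open>U\<close> are extended by zero.\<close>

definition constant_sheaf :: "'a topology \<Rightarrow> ('a, 'a \<Rightarrow> complex) presheaf" where
  "constant_sheaf M =
    \<lparr>sections = \<lambda>U. {s. (\<forall>p. p \<notin> U \<longrightarrow> s p = 0) \<and>
        (\<forall>p\<in>U. \<exists>V. openin M V \<and> p \<in> V \<and> V \<subseteq> U \<and> (\<forall>q\<in>V. s q = s p))},
     restr = \<lambda>U V s p. if p \<in> V then s p else 0\<rparr>"

definition tuples :: "nat \<Rightarrow> nat \<Rightarrow> (nat \<Rightarrow> complex) list set" where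
  "tuples n k = {vs. length vs = k \<and> set vs \<subseteq> cspace n}"

text \<open>Alternating complex \<open>k\<close>-linear forms on \<open>\<complex>\<^sup>n\<close>, extended by zero outside the \<open>k\<close>-tuples.\<close>

definition alternating_forms :: "nat \<Rightarrow> nat \<Rightarrow> ((nat \<Rightarrow> complex) list \<Rightarrow> complex) set" where
  "alternating_forms n k = {\<alpha>.
    (\<forall>vs. vs \<notin> tuples n k \<longrightarrow> \<alpha> vs = 0) \<and>
    (\<forall>vs\<in>tuples n k. \<forall>i<k. \<forall>v\<in>cspace n. \<forall>w\<in>cspace n. \<forall>a b.
      \<alpha> (vs[i := \<lambda>j. a * v j + b * w j]) = a * \<alpha> (vs[i := v]) + b * \<alpha> (vs[i := w])) \<and>
    (\<forall>vs\<in>tuples n k. \<forall>i<k. \<forall>j<k. i \<noteq> j \<and> vs ! i = vs ! j \<longrightarrow> \<alpha> vs = 0)}"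

text \<open>
  A form \<open>\<omega>\<close> is given by its local expressions: \<open>\<omega> c p\<close> is the value at \<open>p\<close> of \<open>\<omega>\<close> in the
  coordinates of the chart \<open>c\<close>, an alternating form on \<open>\<complex>\<^sup>n\<close>.  The local expressions must be
  holomorphic and must transform into each other by pullback along the coordinate changes.
  They are extended by zero outside the charts of the atlas and outside \<open>U\<close>.
\<close>

type_synonym 'a form = "'a chart \<Rightarrow> 'a \<Rightarrow> (nat \<Rightarrow> complex) list \<Rightarrow> complex"

definition holo_forms :: "nat \<Rightarrow> 'a chart set \<Rightarrow> nat \<Rightarrow> 'a set \<Rightarrow> 'a form set" where
  "holo_forms n \<A> k U = {\<omega>.
    (\<forall>c p. \<not> (c \<in> \<A> \<and> p \<in> U \<inter> cdom c) \<longrightarrow> \<omega> c p = (\<lambda>vs. 0)) \<and>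
    (\<forall>c\<in>\<A>. \<forall>p\<in>U \<inter> cdom c. \<omega> c p \<in> alternating_forms n k) \<and>
    (\<forall>c\<in>\<A>. \<forall>vs\<in>tuples n k. holo n (\<lambda>z. \<omega> c (chart_inv c z) vs) (coord c ` (U \<inter> cdom c))) \<and>
    (\<forall>c\<in>\<A>. \<forall>c'\<in>\<A>. \<forall>p\<in>U \<inter> cdom c \<inter> cdom c'. \<forall>vs\<in>tuples n k.
      \<omega> c p vs = \<omega> c' p (map (transition_deriv n c c' p) vs))}"

definition Omega_an :: "nat \<Rightarrow> 'a chart set \<Rightarrow> nat \<Rightarrow> ('a, 'a form) presheaf" where
  "Omega_an n \<A> k =
    \<lparr>sections = holo_forms n \<A> k,
     restr = \<lambda>U V \<omega> c p vs. if p \<in> V then \<omega> c p vs else 0\<rparr>"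

text \<open>The inclusion of the locally constant functions into the holomorphic functions (0-forms).\<close>

definition constant_inclusion :: "'a chart set \<Rightarrow> 'a set \<Rightarrow> ('a \<Rightarrow> complex) \<Rightarrow> 'a form" where
  "constant_inclusion \<A> U s =
    (\<lambda>c p vs. if c \<in> \<A> \<and> p \<in> U \<inter> cdom c \<and> vs = [] then s p else 0)"

text \<open>
  In every chart,
  \<open>(d\<omega>)(v\<^sub>0, \<dots>, v\<^sub>k) = \<Sum>\<^sub>i (-1)\<^sup>i D\<omega>(v\<^sub>i)(v\<^sub>0, \<dots>, v\<^sub>i\<^sub>-\<^sub>1, v\<^sub>i\<^sub>+\<^sub>1, \<dots>, v\<^sub>k)\<close>,
  where \<open>D\<omega>(v) = \<Sum>\<^sub>j v\<^sub>j \<partial>\<omega>/\<partial>z\<^sub>j\<close>.  This is \<open>d(f dz\<^sub>I) = \<Sum>\<^sub>j \<partial>f/\<partial>z\<^sub>j dz\<^sub>j \<and> dz\<^sub>I\<close>.  The degree of \<open>\<omega>\<close>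
  need not be specified, since \<open>\<omega>\<close> vanishes on lists of the wrong length.
\<close>

definition ext_deriv :: "nat \<Rightarrow> 'a chart set \<Rightarrow> 'a set \<Rightarrow> 'a form \<Rightarrow> 'a form" where
  "ext_deriv n \<A> U \<omega> =
    (\<lambda>c p vs. if c \<in> \<A> \<and> p \<in> U \<inter> cdom c \<and> set vs \<subseteq> cspace n
      then \<Sum>i<length vs. (-1) ^ i *
        (\<Sum>j<n. (vs ! i) j *
          cpartial j (\<lambda>z. \<omega> c (chart_inv c z) (take i vs @ drop (Suc i) vs)) (coord c p))
      else 0)"

end

theory Submission
  imports Defs "HOL-Complex_Analysis.Cauchy_Integral_Formula"
begin

text \<open>
All sheaves and morphisms of the sequence are described by local data, so exactness reduces to two
statements about a polydisc in a chart: a function whose partial derivatives vanish is constant, and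
a closed holomorphic form of positive degree is exact (the holomorphic Poincare lemma).  Exactness
at the locally constant functions only needs that the charts cover the manifold, and forms of degree
\<open>n\<close> are closed because there are no nonzero alternating forms of degree \<open>n + 1\<close> on \<open>\<complex>\<^sup>n\<close>; this
also settles the degenerate case \<open>n = 0\<close>.

The Poincare lemma is proved with the radial homotopy operator
\<open>K \<omega>(z)(v\<^sub>1, \<dots>, v\<^sub>k) = \<integral>\<^sub>0\<^sup>1 t\<^sup>k \<omega>(a + t(z - a))(z - a, v\<^sub>1, \<dots>, v\<^sub>k) dt\<close> for forms \<open>\<omega>\<close>
of degree \<open>k + 1\<close> on a polydisc with centre \<open>a\<close> (\<open>local_d_homotopy_op\<close>).  If \<open>d\<omega> = 0\<close>, then \<open>d K \<omega>(z)(v)\<close> is the integral of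
\<open>d/dt (t\<^sup>k\<^sup>+\<^sup>1 \<omega>(a + t(z - a))(v))\<close>, that is, \<open>\<omega>(z)(v)\<close>.  A primitive found in one chart is
carried to the other charts by pullback along the coordinate changes.

Differentiating under the integral sign, \<open>d \<circ> d = 0\<close>, and the fact that \<open>d\<close> commutes with coordinate
changes all rest on the calculus of holomorphic functions of several variables.  Holomorphic here
means continuous and holomorphic in each variable separately.  Cauchy's formula in one variable
writes a partial derivative as an integral over a fixed circle, whose integrand depends nicely on all
variables; therefore partial derivatives are again holomorphic (\<open>holo_cpartial\<close>) and commute
(\<open>cpartial_commute\<close>).  Continuity of the partial derivatives gives the chain rule
(\<open>holo_chain_rule\<close>).

Two sign computations remain, \<open>d \<circ> d = 0\<close> and the cancellation of the second derivatives of the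
coordinate change in \<open>d(\<phi>\<^sup>*\<omega>) = \<phi>\<^sup>*(d\<omega>)\<close>.  Both are the same double sum over ordered pairs of
deleted arguments, with a summand symmetric in the two (\<open>sum_antisym_remove_nth_eq_0\<close>).
\<close>

section \<open>Open sets and holomorphic functions in \<open>\<complex>\<^sup>n\<close>\<close>

abbreviation copen :: "nat \<Rightarrow> (nat \<Rightarrow> complex) set \<Rightarrow> bool" where
  "copen n W \<equiv> openin (top_of_set (cspace n)) W"

definition polydisc :: "nat \<Rightarrow> (nat \<Rightarrow> complex) \<Rightarrow> real \<Rightarrow> (nat \<Rightarrow> complex) set" where
  "polydisc n a r = {z \<in> cspace n. \<forall>i<n. dist (z i) (a i) < r}"

lemma copen_subset: "copen n W \<Longrightarrow> z \<in> W \<Longrightarrow> z \<in> cspace n"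
  using openin_imp_subset by blast

lemma cspace_upd: "z \<in> cspace n \<Longrightarrow> i < n \<Longrightarrow> z(i := t) \<in> cspace n"
  by (auto simp: cspace_def)

lemma polydisc_subset_cspace: "polydisc n a r \<subseteq> cspace n"
  by (auto simp: polydisc_def)

lemma center_in_polydisc: "a \<in> cspace n \<Longrightarrow> r > 0 \<Longrightarrow> a \<in> polydisc n a r"
  by (auto simp: polydisc_def)

lemma copen_polydisc: "copen n (polydisc n a r)"
proof -
  have "open (\<Inter>i<n. (\<lambda>z. z i) -` ball (a i) r)"
    by (intro open_INT ballI open_vimage) auto
  moreover have "polydisc n a r = cspace n \<inter> (\<Inter>i<n. (\<lambda>z. z i) -` ball (a i) r)"
    by (auto simp: polydisc_def dist_commute)
  ultimately show ?thesis by (auto intro: openin_open_Int)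
qed

text \<open>
A basic open set of the product topology restricts only finitely many coordinates, and on
\<^term>\<open>cspace n\<close> only the first \<open>n\<close> of them can vary.
\<close>

lemma ex_polydisc_subset:
  assumes "copen n W" "a \<in> W"
  shows "\<exists>r>0. polydisc n a r \<subseteq> W"
proof -
  obtain T where T: "open T" "W = cspace n \<inter> T"
    using assms(1) by (auto simp: openin_open)
  then obtain X where X: "a \<in> (\<Pi>\<^sub>E i\<in>UNIV. X i)" "\<And>i. open (X i)" "(\<Pi>\<^sub>E i\<in>UNIV. X i) \<subseteq> T"
    using product_topology_open_contains_basis[of "\<lambda>_. euclidean" UNIV T a] assms(2)
    by (auto simp: open_fun_def)
  have "\<exists>e>0. \<forall>y. dist y (a i) < e \<longrightarrow> y \<in> X i" for i
    using X(1,2) open_dist by blast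
  then obtain e where e: "\<And>i. e i > 0" "\<And>i y. dist y (a i) < e i \<Longrightarrow> y \<in> X i"
    by metis
  define r where "r = Min (insert 1 (e ` {..<n}))"
  have "r > 0" using e(1) by (auto simp: r_def)
  moreover have "polydisc n a r \<subseteq> W"
  proof
    fix z assume z: "z \<in> polydisc n a r"
    have "z i \<in> X i" for i
    proof (cases "i < n")
      case True
      then have "r \<le> e i" by (simp add: r_def)
      with z True show ?thesis by (intro e(2)) (auto simp: polydisc_def intro: less_le_trans)
    next
      case False
      with z copen_subset[OF assms] have "z i = a i" by (auto simp: polydisc_def cspace_def)
      with X(1) show ?thesis by auto
    qed
    with X(3) T(2) z show "z \<in> W" by (auto simp: polydisc_def)
  qed
  ultimately show ?thesis by blast
qed

lemma continuous_on_upd [continuous_intros]: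
  fixes f :: "'x::topological_space \<Rightarrow> nat \<Rightarrow> complex"
  assumes "continuous_on S f" "continuous_on S g"
  shows "continuous_on S (\<lambda>x. (f x)(i := g x))"
proof (rule continuous_on_coordinatewise_then_product)
  fix j show "continuous_on S (\<lambda>x. ((f x)(i := g x)) j)"
    using assms continuous_on_product_then_coordinatewise[OF assms(1), of j] by (cases "j = i") auto
qed

lemma open_slice:
  assumes "copen n W" "i < n" "z \<in> cspace n"
  shows "open {t. z(i := t) \<in> W}"
proof -
  obtain T where T: "open T" "W = cspace n \<inter> T"
    using assms(1) by (auto simp: openin_open)
  have "{t. z(i := t) \<in> W} = (\<lambda>t. z(i := t)) -` T"
    using T cspace_upd[OF assms(3,2)] by auto
  moreover have "open ((\<lambda>t. z(i := t)) -` T)"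
    using T(1) by (intro open_vimage continuous_on_upd continuous_on_const continuous_on_id)
  ultimately show ?thesis by simp
qed

lemma eventually_slice:
  assumes "copen n W" "i < n" "z \<in> W"
  shows "\<forall>\<^sub>F t in nhds (z i). z(i := t) \<in> W"
  using eventually_nhds_in_open[OF open_slice[OF assms(1,2) copen_subset[OF assms(1,3)]], of "z i"] assms(3)
  by simp

lemma holo_subset: "holo n f W \<Longrightarrow> V \<subseteq> W \<Longrightarrow> holo n f V"
  by (auto simp: holo_def intro: continuous_on_subset)

lemma holo_cong:
  assumes "copen n W" "\<And>z. z \<in> W \<Longrightarrow> f z = g z" "holo n f W"
  shows "holo n g W"
  unfolding holo_def
proof (intro conjI ballI allI impI)
  show "continuous_on W g"
    using assms(2,3) by (auto simp: holo_def cong: continuous_on_cong)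
next
  fix z i assume z: "z \<in> W" "i < n"
  have "(\<lambda>t. f (z(i := t))) field_differentiable (at (z i))"
    using assms(3) z by (auto simp: holo_def)
  then obtain D where "((\<lambda>t. f (z(i := t))) has_field_derivative D) (at (z i))"
    by (auto simp: field_differentiable_def)
  moreover have "\<forall>\<^sub>F t in nhds (z i). f (z(i := t)) = g (z(i := t))"
    using eventually_slice[OF assms(1) z(2,1)] by eventually_elim (rule assms(2))
  ultimately show "(\<lambda>t. g (z(i := t))) field_differentiable (at (z i))"
    using DERIV_cong_ev[of "z i" "z i"] by (auto simp: field_differentiable_def)
qed

text \<open>
The open sets here are only relatively open in the sequence space, so continuity is compared
point by point: near \<open>a\<close> the sets \<open>V\<close> and \<open>W\<close> have the same trace on a genuine neighbourhood.
\<close>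

lemma continuous_on_copen_local:
  assumes "\<And>a. a \<in> W \<Longrightarrow> \<exists>V. copen n V \<and> a \<in> V \<and> continuous_on V f"
  shows "continuous_on W f"
  unfolding continuous_on_eq_continuous_within
proof
  fix a assume "a \<in> W"
  then obtain V where V: "copen n V" "a \<in> V" "continuous_on V f" using assms by blast
  obtain T where T: "open T" "V = cspace n \<inter> T" using V(1) by (auto simp: openin_open)
  have "continuous (at a within V \<inter> W) f"
    using V by (auto simp: continuous_on_eq_continuous_within intro: continuous_within_subset)
  moreover have "W \<subseteq> cspace n"
    using assms copen_subset by blast
  then have "at a within V \<inter> W = at a within W"
    using T V(2) by (intro at_within_nhd[where S = T]) auto
  ultimately show "continuous (at a within W) f"
    by simp
qed

lemma holo_local:
  assumes "\<And>a. a \<in> W \<Longrightarrow> \<exists>V. copen n V \<and> a \<in> V \<and> holo n f V"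
  shows "holo n f W"
  unfolding holo_def
proof (intro conjI ballI allI impI)
  show "continuous_on W f"
    using assms by (intro continuous_on_copen_local[of W n]) (metis holo_def)
next
  fix z i assume "z \<in> W" "i < n"
  with assms[of z] show "(\<lambda>t. f (z(i := t))) field_differentiable (at (z i))"
    by (auto simp: holo_def)
qed

lemma holo_has_cpartial:
  assumes "holo n f W" "z \<in> W" "i < n"
  shows "((\<lambda>t. f (z(i := t))) has_field_derivative cpartial i f z) (at (z i))"
  using assms by (auto simp: holo_def cpartial_def DERIV_deriv_iff_field_differentiable)

lemma holo_has_cpartial_slice:
  assumes "holo n f W" "z(i := t) \<in> W" "i < n"
  shows "((\<lambda>t. f (z(i := t))) has_field_derivative cpartial i f (z(i := t))) (at t)"
  using holo_has_cpartial[OF assms] by simp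

lemma cpartialI:
  "((\<lambda>t. f (z(i := t))) has_field_derivative D) (at (z i)) \<Longrightarrow> cpartial i f z = D"
  by (simp add: cpartial_def DERIV_imp_deriv)

lemma cpartial_cong:
  assumes "copen n W" "\<And>z. z \<in> W \<Longrightarrow> f z = g z" "z \<in> W" "i < n"
  shows "cpartial i f z = cpartial i g z"
  unfolding cpartial_def
proof (rule deriv_cong_ev)
  show "\<forall>\<^sub>F t in nhds (z i). f (z(i := t)) = g (z(i := t))"
    using eventually_slice[OF assms(1,4,3)] by eventually_elim (rule assms(2))
qed simp

lemma holo_const: "holo n (\<lambda>z. c) W"
  by (auto simp: holo_def)

lemma holo_coord: "holo n (\<lambda>z. z j) W"
proof -
  have "continuous_on W (\<lambda>z::nat \<Rightarrow> complex. z j)"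
    by (rule continuous_on_subset[OF continuous_on_product_coordinates]) simp
  moreover have "(\<lambda>t. (z(i := t)) j) field_differentiable at (z i)" for z :: "nat \<Rightarrow> complex" and i
    by (cases "j = i") simp_all
  ultimately show ?thesis by (auto simp: holo_def)
qed

lemma holo_add: "holo n f W \<Longrightarrow> holo n g W \<Longrightarrow> holo n (\<lambda>z. f z + g z) W"
  by (auto simp: holo_def intro!: continuous_on_add field_differentiable_add)

lemma holo_mult: "holo n f W \<Longrightarrow> holo n g W \<Longrightarrow> holo n (\<lambda>z. f z * g z) W"
  by (auto simp: holo_def intro!: continuous_on_mult field_differentiable_mult)

lemma holo_sum: "(\<And>i. i \<in> I \<Longrightarrow> holo n (f i) W) \<Longrightarrow> holo n (\<lambda>z. \<Sum>i\<in>I. f i z) W"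
  by (auto simp: holo_def intro!: continuous_on_sum field_differentiable_sum)

lemma cpartial_const [simp]: "cpartial i (\<lambda>z. c) z = 0"
  by (simp add: cpartial_def)

lemma cpartial_coord: "cpartial i (\<lambda>z. z j) z = (if i = j then 1 else 0)"
  by (cases "i = j") (simp_all add: cpartial_def)

lemma cpartial_add:
  assumes "holo n f W" "holo n g W" "z \<in> W" "i < n"
  shows "cpartial i (\<lambda>z. f z + g z) z = cpartial i f z + cpartial i g z"
  by (intro cpartialI DERIV_add holo_has_cpartial[OF _ assms(3,4)] assms)

lemma cpartial_mult:
  assumes "holo n f W" "holo n g W" "z \<in> W" "i < n"
  shows "cpartial i (\<lambda>z. f z * g z) z = cpartial i f z * g z + f z * cpartial i g z"
  using DERIV_mult[OF holo_has_cpartial[OF assms(1,3,4)] holo_has_cpartial[OF assms(2,3,4)]]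
  by (intro cpartialI) (simp add: mult.commute add.commute)

lemma cpartial_sum:
  assumes "\<And>l. l \<in> I \<Longrightarrow> holo n (f l) W" "z \<in> W" "i < n"
  shows "cpartial i (\<lambda>z. \<Sum>l\<in>I. f l z) z = (\<Sum>l\<in>I. cpartial i (f l) z)"
  by (intro cpartialI DERIV_sum holo_has_cpartial[OF _ assms(2,3)] assms)

section \<open>Cauchy integrals and higher partial derivatives\<close>

text \<open>
The Leibniz rule in a single coordinate direction.  A disc around \<open>z i\<close> on which the slice stays
in \<open>W\<close> supplies the convex domain that differentiation under the integral sign requires.
\<close>

lemma has_field_derivative_integral_slice:
  fixes h h' :: "(nat \<Rightarrow> complex) \<Rightarrow> real \<Rightarrow> complex"
  assumes W: "copen n W" "i < n" "z \<in> W"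
    and deriv: "\<And>w t. w \<in> W \<Longrightarrow> t \<in> {0..1} \<Longrightarrow>
      ((\<lambda>s. h (w(i := s)) t) has_field_derivative h' w t) (at (w i))"
    and cont: "continuous_on (W \<times> {0..1}) (\<lambda>(w, t). h w t)"
      "continuous_on (W \<times> {0..1}) (\<lambda>(w, t). h' w t)"
  shows "((\<lambda>s. integral {0..1} (h (z(i := s)))) has_field_derivative integral {0..1} (h' z)) (at (z i))"
proof -
  have "z \<in> cspace n" using W copen_subset by blast
  then have "open {s. z(i := s) \<in> W}" using open_slice W by blast
  moreover have "z i \<in> {s. z(i := s) \<in> W}" using W by simp
  ultimately obtain e where e: "e > 0" "ball (z i) e \<subseteq> {s. z(i := s) \<in> W}"
    using open_contains_ball by blast
  have "((\<lambda>s. integral (cbox 0 1) (h (z(i := s)))) has_field_derivative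
      integral (cbox 0 1) (h' (z(i := z i)))) (at (z i) within ball (z i) e)"
  proof (rule leibniz_rule_field_derivative)
    fix s :: complex and x :: real assume s: "s \<in> ball (z i) e" and x: "x \<in> cbox 0 1"
    then have "z(i := s) \<in> W" "x \<in> {0..1}" using e by auto
    from deriv[OF this] show "((\<lambda>s. h (z(i := s)) x) has_field_derivative h' (z(i := s)) x) (at s within ball (z i) e)"
      by (auto intro: has_field_derivative_at_within)
  next
    fix s assume s: "s \<in> ball (z i) e"
    have "continuous_on {0..1} (\<lambda>t. h (z(i := s)) t)"
      using s e by (intro continuous_on_compose2[OF cont(1), of _ "\<lambda>t. (z(i := s), t)", simplified split_conv])
        (auto intro!: continuous_on_Pair continuous_on_const continuous_on_id)
    then show "h (z(i := s)) integrable_on cbox 0 1"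
      using integrable_continuous_real by (simp add: cbox_interval)
  next
    have "continuous_on (ball (z i) e \<times> {0..1}) (\<lambda>p. case (z(i := fst p), snd p) of (w, t) \<Rightarrow> h' w t)"
      using e by (intro continuous_on_compose2[OF cont(2)] continuous_on_Pair continuous_on_upd
          continuous_on_const continuous_on_fst continuous_on_snd continuous_on_id) auto
    then show "continuous_on (ball (z i) e \<times> cbox 0 1) (\<lambda>(s, t). h' (z(i := s)) t)"
      by (simp add: case_prod_beta cbox_interval)
  qed (use e in auto)
  then show ?thesis
    using e by (simp add: at_within_open[of "z i" "ball (z i) e"] cbox_interval)
qed

text \<open>
The factor that multiplies \<open>f\<close> in Cauchy's formula for \<open>f'(w)\<close> once the circle of radius \<open>\<rho>\<close> around
\<open>c\<close> is parametrised by \<open>x \<in> [0, 1]\<close>: the speed \<open>2\<pi>\<i>\<rho> exp(2\<pi>\<i>x)\<close> cancels the constant \<open>1/(2\<pi>\<i>)\<close>.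
\<close>

definition cauchy_kernel :: "complex \<Rightarrow> real \<Rightarrow> complex \<Rightarrow> real \<Rightarrow> complex" where
  "cauchy_kernel c \<rho> w x =
    of_real \<rho> * exp (2 * of_real pi * \<i> * of_real x) / (circlepath c \<rho> x - w)\<^sup>2"

lemma circlepath_ne:
  assumes "r > 0" "dist w c < r"
  shows "circlepath c (2 * r) x \<noteq> w"
proof
  assume "circlepath c (2 * r) x = w"
  then have "w - c = 2 * of_real r * exp (\<i> * of_real (2 * pi * x))"
    by (auto simp: circlepath mult_ac)
  then have "norm (w - c) = 2 * r"
    using assms(1) by (simp add: norm_mult)
  with assms show False by (simp add: dist_norm)
qed

lemma dist_circlepath:
  assumes "r > 0"
  shows "dist (circlepath c (2 * r) x) c = 2 * r"
proof -
  have "circlepath c (2 * r) x - c = 2 * of_real r * exp (\<i> * of_real (2 * pi * x))"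
    by (auto simp: circlepath mult_ac)
  then show ?thesis
    using assms(1) by (simp add: norm_mult dist_norm)
qed

lemma polydisc_upd_circlepath:
  assumes "r > 0" "z \<in> polydisc n a r" "i < n"
  shows "z(i := circlepath (a i) (2 * r) x) \<in> polydisc n a (3 * r)"
  using assms cspace_upd[of z n i] dist_circlepath[OF assms(1)]
  by (auto simp: polydisc_def intro: less_trans)

text \<open>
The circle has radius \<open>2 r\<close> around \<open>a i\<close> and not around \<open>z i\<close>: it is the same for all \<open>z\<close> in the
polydisc of radius \<open>r\<close>, from which it keeps a positive distance, and it lies in the polydisc of
radius \<open>3 r\<close>.  So \<open>z\<close> enters the integrand only through \<open>f\<close> and the kernel, and both can be
differentiated.
\<close>

lemma cpartial_cauchy:
  assumes f: "holo n f W" and r: "r > 0" "polydisc n a (3 * r) \<subseteq> W" and z: "z \<in> polydisc n a r" "i < n"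
  shows "cpartial i f z = integral {0..1} (\<lambda>x. f (z(i := circlepath (a i) (2 * r) x)) *
           cauchy_kernel (a i) (2 * r) (z i) x)"
proof -
  define g where "g t = f (z(i := t))" for t
  have W: "z(i := t) \<in> W" if "t \<in> ball (a i) (3 * r)" for t
    using that z r cspace_upd[of z n i]
    by (intro subsetD[OF r(2)]) (auto simp: polydisc_def dist_commute intro: less_trans)
  have g: "(g has_field_derivative cpartial i f (z(i := t))) (at t)" if "t \<in> ball (a i) (3 * r)" for t
    unfolding g_def using holo_has_cpartial_slice[OF f W[OF that] z(2)] .
  have "g holomorphic_on ball (a i) (3 * r)"
    using g holomorphic_on_open[OF open_ball] by blast
  then have hol: "g holomorphic_on cball (a i) (2 * r)" "g holomorphic_on ball (a i) (2 * r)"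
    using r(1) by (auto elim!: holomorphic_on_subset)
  have zi: "z i \<in> ball (a i) (2 * r)"
    using z r(1) by (auto simp: polydisc_def dist_commute intro: less_trans)
  have "(g has_field_derivative (1 / (2 * of_real pi * \<i>) *
      contour_integral (circlepath (a i) (2 * r)) (\<lambda>u. g u / (u - z i)^2))) (at (z i))"
    by (rule Cauchy_derivative_integral_circlepath(2)[OF holomorphic_on_imp_continuous_on[OF hol(1)] hol(2) zi])
  moreover have "(g has_field_derivative cpartial i f z) (at (z i))"
    using g[of "z i"] zi r(1) by simp
  ultimately have "cpartial i f z = 1 / (2 * of_real pi * \<i>) *
      contour_integral (circlepath (a i) (2 * r)) (\<lambda>u. g u / (u - z i)^2)"
    using DERIV_unique by blast
  also have "\<dots> = integral {0..1} (\<lambda>x. 1 / (2 * of_real pi * \<i>) *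
      (g (circlepath (a i) (2 * r) x) / (circlepath (a i) (2 * r) x - z i)^2 *
        vector_derivative (circlepath (a i) (2 * r)) (at x)))"
    by (simp only: contour_integral_integral integral_mult_right)
  also have "\<dots> = integral {0..1} (\<lambda>x. g (circlepath (a i) (2 * r) x) * cauchy_kernel (a i) (2 * r) (z i) x)"
    by (rule integral_cong) (simp add: cauchy_kernel_def vector_derivative_circlepath)
  finally show ?thesis by (simp add: g_def)
qed

lemma continuous_on_cauchy_integrand:
  assumes f: "continuous_on W f" and r: "r > 0" "polydisc n a (3 * r) \<subseteq> W" and i: "i < n"
  shows "continuous_on (polydisc n a r \<times> {0..1})
    (\<lambda>(z, x). f (z(i := circlepath (a i) (2 * r) x)) * cauchy_kernel (a i) (2 * r) (z i) x)"
proof -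
  have c: "continuous_on X (\<lambda>p::(nat \<Rightarrow> complex) \<times> real. circlepath (a i) (2 * r) (snd p))" for X
    unfolding circlepath by (intro continuous_intros)
  have z: "continuous_on X (\<lambda>p::(nat \<Rightarrow> complex) \<times> real. fst p i)" for X
    by (rule continuous_on_product_then_coordinatewise[OF continuous_on_fst[OF continuous_on_id]])
  have 1: "continuous_on (polydisc n a r \<times> {0..1}) (\<lambda>p. f ((fst p)(i := circlepath (a i) (2 * r) (snd p))))"
  proof (rule continuous_on_compose2[OF f])
    show "continuous_on (polydisc n a r \<times> {0..1}) (\<lambda>p. (fst p)(i := circlepath (a i) (2 * r) (snd p)))"
      by (rule continuous_on_upd[OF continuous_on_fst[OF continuous_on_id] c])
    show "(\<lambda>p. (fst p)(i := circlepath (a i) (2 * r) (snd p))) ` (polydisc n a r \<times> {0..1}) \<subseteq> W"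
      using polydisc_upd_circlepath[OF r(1) _ i] r(2) by auto
  qed
  have 2: "continuous_on (polydisc n a r \<times> {0..1}) (\<lambda>p. cauchy_kernel (a i) (2 * r) (fst p i) (snd p))"
    unfolding cauchy_kernel_def
    using circlepath_ne[OF r(1)] i
    by (intro continuous_on_divide continuous_on_mult continuous_on_const continuous_on_power
         continuous_on_diff c z continuous_on_exp continuous_on_of_real continuous_on_snd continuous_on_id)
       (auto simp: polydisc_def)
  show ?thesis
    using continuous_on_mult[OF 1 2] by (simp add: case_prod_beta)
qed

lemma continuous_on_cpartial:
  assumes "copen n W" "holo n f W" "i < n"
  shows "continuous_on W (cpartial i f)"
proof (rule continuous_on_copen_local)
  fix a assume a: "a \<in> W"
  obtain R where R: "R > 0" "polydisc n a R \<subseteq> W" using ex_polydisc_subset[OF assms(1) a] by blast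
  define r where "r = R / 3"
  have r: "r > 0" "polydisc n a (3 * r) \<subseteq> W" using R by (auto simp: r_def)
  have "continuous_on (polydisc n a r) (\<lambda>z. integral (cbox 0 1)
      (\<lambda>x. f (z(i := circlepath (a i) (2 * r) x)) * cauchy_kernel (a i) (2 * r) (z i) x))"
    using continuous_on_cauchy_integrand[of W f r n a i] assms r
    by (intro integral_continuous_on_param) (auto simp: holo_def cbox_interval)
  then have "continuous_on (polydisc n a r) (cpartial i f)"
    by (rule continuous_on_eq) (simp add: cpartial_cauchy[OF assms(2) r _ assms(3)] cbox_interval)
  then show "\<exists>V. copen n V \<and> a \<in> V \<and> continuous_on V (cpartial i f)"
    using copen_polydisc center_in_polydisc[of a n r] copen_subset[OF assms(1) a] r by blast
qed

text \<open>
In a direction \<open>j \<noteq> i\<close> the kernel is constant, so differentiating the Cauchy integral only replaces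
\<open>f\<close> by its partial derivative \<open>\<partial>\<^sub>j f\<close>.  The value is stated as an integral since it is not yet known
that \<open>\<partial>\<^sub>j f\<close> is holomorphic; once it is, the integral is Cauchy's formula for \<open>\<partial>\<^sub>i \<partial>\<^sub>j f\<close>.
\<close>

lemma cpartial_has_cpartial:
  assumes W: "copen n W" and f: "holo n f W" and r: "r > 0" "polydisc n a (3 * r) \<subseteq> W"
    and z: "z \<in> polydisc n a r" and ij: "i < n" "j < n" "j \<noteq> i"
  shows "((\<lambda>s. cpartial i f (z(j := s))) has_field_derivative
     integral {0..1} (\<lambda>x. cpartial j f (z(i := circlepath (a i) (2 * r) x)) *
           cauchy_kernel (a i) (2 * r) (z i) x)) (at (z j))"
proof -
  let ?c = "circlepath (a i) (2 * r)" and ?K = "cauchy_kernel (a i) (2 * r)"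
  have A: "((\<lambda>s. integral {0..1} (\<lambda>x. f ((z(j := s))(i := ?c x)) * ?K ((z(j := s)) i) x))
     has_field_derivative
     integral {0..1} (\<lambda>x. cpartial j f (z(i := ?c x)) * ?K (z i) x)) (at (z j))"
  proof (rule has_field_derivative_integral_slice[OF copen_polydisc ij(2) z])
    fix w and x :: real assume w: "w \<in> polydisc n a r"
    have "w(i := ?c x) \<in> W" using polydisc_upd_circlepath[OF r(1) w ij(1)] r(2) by blast
    from holo_has_cpartial[OF f this ij(2)]
    have "((\<lambda>s. f (w(i := ?c x, j := s))) has_field_derivative cpartial j f (w(i := ?c x))) (at (w j))"
      using ij by simp
    then show "((\<lambda>s. f (w(j := s, i := ?c x)) * ?K ((w(j := s)) i) x) has_field_derivative
        cpartial j f (w(i := ?c x)) * ?K (w i) x) (at (w j))"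
      using ij DERIV_cmult_right by (simp add: fun_upd_twist)
  next
    show "continuous_on (polydisc n a r \<times> {0..1}) (\<lambda>(w, x). f (w(i := ?c x)) * ?K (w i) x)"
      using f by (intro continuous_on_cauchy_integrand[of W] r ij) (auto simp: holo_def)
    show "continuous_on (polydisc n a r \<times> {0..1}) (\<lambda>(w, x). cpartial j f (w(i := ?c x)) * ?K (w i) x)"
      by (rule continuous_on_cauchy_integrand[OF continuous_on_cpartial[OF W f ij(2)] r ij(1)])
  qed
  have E: "\<forall>\<^sub>F s in nhds (z j). cpartial i f (z(j := s)) =
      integral {0..1} (\<lambda>x. f ((z(j := s))(i := ?c x)) * ?K ((z(j := s)) i) x)"
    using eventually_slice[OF copen_polydisc ij(2) z]
    by eventually_elim (rule cpartial_cauchy[OF f r _ ij(1)])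
  show ?thesis
    by (rule iffD2[OF DERIV_cong_ev[OF refl E refl] A])
qed

lemma polydisc_around:
  assumes "copen n W" "z \<in> W"
  obtains r where "r > 0" "polydisc n z (3 * r) \<subseteq> W" "z \<in> polydisc n z r"
proof -
  obtain R where R: "R > 0" "polydisc n z R \<subseteq> W" using ex_polydisc_subset[OF assms] by blast
  show ?thesis
    using that[of "R / 3"] R center_in_polydisc[of z n "R / 3"] copen_subset[OF assms] by auto
qed

text \<open>
In direction \<open>i\<close> itself this is the theorem that the derivative of a holomorphic function of one
variable is holomorphic; the other directions are differentiated under the Cauchy integral.
\<close>

lemma holo_cpartial:
  assumes W: "copen n W" and f: "holo n f W" and i: "i < n"
  shows "holo n (cpartial i f) W"
  unfolding holo_def
proof (intro conjI ballI allI impI continuous_on_cpartial[OF assms])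
  fix z j assume z: "z \<in> W" and j: "j < n"
  show "(\<lambda>t. cpartial i f (z(j := t))) field_differentiable at (z j)"
  proof (cases "j = i")
    case True
    define S where "S = {t. z(i := t) \<in> W}"
    have S: "open S" "z i \<in> S"
      using open_slice[OF W i] copen_subset[OF W z] z by (auto simp: S_def)
    have "(\<lambda>t. f (z(i := t))) holomorphic_on S"
      using holo_has_cpartial_slice[OF f _ i] holomorphic_on_open[OF S(1)] unfolding S_def by blast
    then have "deriv (\<lambda>t. f (z(i := t))) holomorphic_on S"
      using S by (intro holomorphic_deriv)
    moreover have "deriv (\<lambda>t. f (z(i := t))) = (\<lambda>t. cpartial i f (z(i := t)))"
      by (simp add: fun_eq_iff cpartial_def)
    ultimately show ?thesis
      using S True by (simp add: holomorphic_on_imp_differentiable_at)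
  next
    case False
    obtain r where r: "r > 0" "polydisc n z (3 * r) \<subseteq> W" "z \<in> polydisc n z r"
      using polydisc_around[OF W z] .
    show ?thesis
      using cpartial_has_cpartial[OF W f r i j False] by (auto simp: field_differentiable_def)
  qed
qed

lemma cpartial_commute:
  assumes W: "copen n W" and f: "holo n f W" and i: "i < n" and j: "j < n" and z: "z \<in> W"
  shows "cpartial j (cpartial i f) z = cpartial i (cpartial j f) z"
proof (cases "j = i")
  case False
  obtain r where r: "r > 0" "polydisc n z (3 * r) \<subseteq> W" "z \<in> polydisc n z r"
    using polydisc_around[OF W z] .
  show ?thesis
    using cpartialI[OF cpartial_has_cpartial[OF W f r i j False]]
      cpartial_cauchy[OF holo_cpartial[OF W f j] r i] by simp
qed simp

section \<open>The chain rule and directional derivatives\<close>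

text \<open>
Total differentiability.  The point \<open>p\<close> is changed into \<open>w\<close> one coordinate at a time, and in each
step the mean value inequality is applied to \<open>f\<close> minus its linear approximation, whose derivative is
small because the partial derivatives are continuous.
\<close>

lemma holo_increment:
  assumes W: "copen n W" and f: "holo n f W" and p: "p \<in> W" and \<epsilon>: "\<epsilon> > 0"
  obtains \<delta> where "\<delta> > 0" "\<And>w. w \<in> polydisc n p \<delta> \<Longrightarrow>
    norm (f w - f p - (\<Sum>j<n. cpartial j f p * (w j - p j))) \<le> \<epsilon> * (\<Sum>j<n. norm (w j - p j))"
proof -
  \<comment> \<open>Near \<open>p\<close> all partial derivatives are within \<open>\<epsilon>\<close> of their values at \<open>p\<close>.\<close>
  define V where "V = W \<inter> (\<Inter>j<n. W \<inter> cpartial j f -` ball (cpartial j f p) \<epsilon>)"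
  have "openin (top_of_set W) (W \<inter> cpartial j f -` ball (cpartial j f p) \<epsilon>)" if "j < n" for j
    using continuous_on_cpartial[OF W f that] by (rule continuous_openin_preimage_gen) simp
  then have o: "copen n (W \<inter> cpartial j f -` ball (cpartial j f p) \<epsilon>)" if "j < n" for j
    using W that openin_trans by blast
  have "copen n V"
  proof (cases "n = 0")
    case False
    have "copen n (\<Inter>j\<in>{..<n}. W \<inter> cpartial j f -` ball (cpartial j f p) \<epsilon>)"
      using False o by (intro openin_INT2) (simp_all add: lessThan_empty_iff)
    then show ?thesis unfolding V_def using W by (rule openin_Int[rotated])
  qed (use W in \<open>simp add: V_def\<close>)
  moreover have "p \<in> V" using p \<epsilon> by (auto simp: V_def)
  ultimately obtain \<delta> where \<delta>: "\<delta> > 0" "polydisc n p \<delta> \<subseteq> V"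
    using ex_polydisc_subset by blast
  show thesis
  proof (rule that[OF \<delta>(1)])
    fix w assume w: "w \<in> polydisc n p \<delta>"
    \<comment> \<open>In \<open>h m\<close> the first \<open>m\<close> coordinates have been moved from \<open>p\<close> to \<open>w\<close>.\<close>
    define h where "h m = (\<lambda>i. if i < m then w i else p i)" for m :: nat
    have pc: "p \<in> cspace n" using copen_subset[OF W p] .
    have hP: "(h m)(m := t) \<in> polydisc n p \<delta>" if "dist t (p m) < \<delta>" "m < n" for t m
      using that w \<delta>(1) pc by (auto simp: polydisc_def h_def cspace_def)
    have "norm (f (h m) - f p - (\<Sum>j<m. cpartial j f p * (w j - p j))) \<le> \<epsilon> * (\<Sum>j<m. norm (w j - p j))"
      if "m \<le> n" for m
      using that
    proof (induction m)
      case 0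
      then show ?case by (simp add: h_def)
    next
      case (Suc m)
      then have m: "m < n" by simp
      define g where "g t = f ((h m)(m := t)) - cpartial m f p * t" for t
      have "norm (g (w m) - g (p m)) \<le> \<epsilon> * norm (w m - p m)"
      proof (rule field_differentiable_bound[of "ball (p m) \<delta>" g "\<lambda>t. cpartial m f ((h m)(m := t)) - cpartial m f p"])
        fix t assume "t \<in> ball (p m) \<delta>"
        then have V: "(h m)(m := t) \<in> V"
          using hP[of t m] m \<delta>(2) by (auto simp: dist_commute)
        then have "((\<lambda>t. f ((h m)(m := t))) has_field_derivative cpartial m f ((h m)(m := t))) (at t)"
          by (intro holo_has_cpartial_slice[OF f _ m]) (auto simp: V_def)
        then have "(g has_field_derivative cpartial m f ((h m)(m := t)) - cpartial m f p) (at t)"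
          unfolding g_def by (auto intro!: derivative_eq_intros)
        then show "(g has_field_derivative cpartial m f ((h m)(m := t)) - cpartial m f p) (at t within ball (p m) \<delta>)"
          by (rule has_field_derivative_at_within)
        show "norm (cpartial m f ((h m)(m := t)) - cpartial m f p) \<le> \<epsilon>"
        proof -
          have "cpartial m f ((h m)(m := t)) \<in> ball (cpartial m f p) \<epsilon>"
            using V m unfolding V_def by blast
          then show ?thesis by (simp add: dist_norm norm_minus_commute)
        qed
      qed (use w m \<delta>(1) in \<open>auto simp: polydisc_def dist_commute\<close>)
      moreover have "(h m)(m := w m) = h (Suc m)" "(h m)(m := p m) = h m"
        by (auto simp: h_def)
      ultimately have "norm (f (h (Suc m)) - f (h m) - cpartial m f p * (w m - p m)) \<le> \<epsilon> * norm (w m - p m)"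
        by (simp add: g_def algebra_simps)
      then have "norm ((f (h m) - f p - (\<Sum>j<m. cpartial j f p * (w j - p j))) +
          (f (h (Suc m)) - f (h m) - cpartial m f p * (w m - p m)))
          \<le> \<epsilon> * (\<Sum>j<m. norm (w j - p j)) + \<epsilon> * norm (w m - p m)"
        using Suc.IH m by (intro norm_triangle_mono) auto
      then show ?case by (simp add: algebra_simps)
    qed
    from this[of n] have "norm (f (h n) - f p - (\<Sum>j<n. cpartial j f p * (w j - p j))) \<le> \<epsilon> * (\<Sum>j<n. norm (w j - p j))"
      by simp
    moreover have "h n = w"
      using pc w by (auto simp: h_def polydisc_def cspace_def)
    ultimately show "norm (f w - f p - (\<Sum>j<n. cpartial j f p * (w j - p j))) \<le> \<epsilon> * (\<Sum>j<n. norm (w j - p j))"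
      by simp
  qed
qed

text \<open>
The remainder of the linear approximation at \<open>\<gamma> s\<close> is at most \<open>\<epsilon>\<close> times the sum of the increments
of the coordinates, and the difference quotients of the coordinates stay bounded near \<open>s\<close>.
\<close>

lemma holo_chain_rule:
  fixes \<gamma> :: "complex \<Rightarrow> nat \<Rightarrow> complex"
  assumes W: "copen n W" and f: "holo n f W" and p: "\<gamma> s \<in> W"
    and c: "\<forall>\<^sub>F t in nhds s. \<gamma> t \<in> cspace n"
    and \<gamma>: "\<And>j. j < n \<Longrightarrow> ((\<lambda>t. \<gamma> t j) has_field_derivative \<gamma>' j) (at s)"
  shows "((\<lambda>t. f (\<gamma> t)) has_field_derivative (\<Sum>j<n. \<gamma>' j * cpartial j f (\<gamma> s))) (at s)"
proof -
  define D where "D j = cpartial j f (\<gamma> s)" for j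
  define R where "R t = f (\<gamma> t) - f (\<gamma> s) - (\<Sum>j<n. D j * (\<gamma> t j - \<gamma> s j))" for t
  \<comment> \<open>A bound for the sum of the difference quotients near \<open>s\<close>; the summand 1 keeps it positive.\<close>
  define B where "B = (\<Sum>j<n. norm (\<gamma>' j)) + 1"
  have B: "B > 0" by (auto simp: B_def intro!: add_nonneg_pos sum_nonneg)
  have q: "((\<lambda>t. (\<gamma> t j - \<gamma> s j) / (t - s)) \<longlongrightarrow> \<gamma>' j) (at s)" if "j < n" for j
    using \<gamma>[OF that] by (simp add: has_field_derivative_iff)
  have "((\<lambda>t. \<Sum>j<n. norm ((\<gamma> t j - \<gamma> s j) / (t - s))) \<longlongrightarrow> (\<Sum>j<n. norm (\<gamma>' j))) (at s)"
    by (intro tendsto_sum tendsto_norm q) auto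
  then have evB: "\<forall>\<^sub>F t in at s. (\<Sum>j<n. norm ((\<gamma> t j - \<gamma> s j) / (t - s))) < B"
    by (rule order_tendstoD) (simp add: B_def)
  have "((\<lambda>t. R t / (t - s)) \<longlongrightarrow> 0) (at s)"
  proof (rule tendstoI)
    fix e :: real assume e: "e > 0"
    define \<epsilon> where "\<epsilon> = e / B"
    have "\<epsilon> > 0" using e B by (simp add: \<epsilon>_def)
    then obtain \<delta> where \<delta>: "\<delta> > 0" "\<And>w. w \<in> polydisc n (\<gamma> s) \<delta> \<Longrightarrow>
        norm (f w - f (\<gamma> s) - (\<Sum>j<n. D j * (w j - \<gamma> s j))) \<le> \<epsilon> * (\<Sum>j<n. norm (w j - \<gamma> s j))"
      using holo_increment[OF W f p] unfolding D_def by blast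
    have "\<forall>\<^sub>F t in at s. \<forall>j\<in>{..<n}. dist (\<gamma> t j) (\<gamma> s j) < \<delta>"
    proof (rule eventually_ball_finite)
      show "\<forall>j\<in>{..<n}. \<forall>\<^sub>F t in at s. dist (\<gamma> t j) (\<gamma> s j) < \<delta>"
        using DERIV_isCont[OF \<gamma>] \<delta>(1) by (auto simp: isCont_def tendsto_iff)
    qed simp
    moreover have "\<forall>\<^sub>F t in at s. \<gamma> t \<in> cspace n"
      using c by (auto simp: eventually_at_filter elim: eventually_mono)
    moreover have "\<forall>\<^sub>F t in at s. t \<noteq> s" by (simp add: eventually_at_filter)
    ultimately show "\<forall>\<^sub>F t in at s. dist (R t / (t - s)) 0 < e"
      using evB
    proof eventually_elim
      case (elim t)
      then have "\<gamma> t \<in> polydisc n (\<gamma> s) \<delta>" by (auto simp: polydisc_def)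
      then have "norm (R t) \<le> \<epsilon> * (\<Sum>j<n. norm (\<gamma> t j - \<gamma> s j))"
        using \<delta>(2) by (simp add: R_def)
      then have "norm (R t) / norm (t - s) \<le> (\<epsilon> * (\<Sum>j<n. norm (\<gamma> t j - \<gamma> s j))) / norm (t - s)"
        by (intro divide_right_mono) auto
      also have "\<dots> = \<epsilon> * (\<Sum>j<n. norm ((\<gamma> t j - \<gamma> s j) / (t - s)))"
        by (simp add: norm_divide flip: sum_divide_distrib)
      also have "\<dots> < \<epsilon> * B"
        using elim \<open>\<epsilon> > 0\<close> by (intro mult_strict_left_mono)
      also have "\<dots> = e" using B by (simp add: \<epsilon>_def)
      finally show ?case by (simp add: norm_divide)
    qed
  qed
  then have R: "(R has_field_derivative 0) (at s)"
    by (simp add: has_field_derivative_iff R_def)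
  have "((\<lambda>t. R t + f (\<gamma> s) + (\<Sum>j<n. D j * (\<gamma> t j - \<gamma> s j))) has_field_derivative
      0 + 0 + (\<Sum>j<n. D j * (\<gamma>' j - 0))) (at s)"
    by (intro DERIV_add R DERIV_const DERIV_sum DERIV_cmult DERIV_diff \<gamma>) auto
  then show ?thesis
    by (simp add: R_def D_def mult.commute)
qed

definition dir_deriv :: "nat \<Rightarrow> ((nat \<Rightarrow> complex) \<Rightarrow> complex) \<Rightarrow> (nat \<Rightarrow> complex) \<Rightarrow> (nat \<Rightarrow> complex) \<Rightarrow> complex" where
  "dir_deriv n f z v = (\<Sum>j<n. v j * cpartial j f z)"

lemma dir_deriv_const [simp]: "dir_deriv n (\<lambda>z. c) z v = 0"
  by (simp add: dir_deriv_def)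

lemma dir_deriv_coord: "l < n \<Longrightarrow> dir_deriv n (\<lambda>z. z l) z v = v l"
  by (simp add: dir_deriv_def cpartial_coord if_distrib cong: if_cong)

lemma dir_deriv_cong:
  "copen n W \<Longrightarrow> (\<And>z. z \<in> W \<Longrightarrow> f z = g z) \<Longrightarrow> z \<in> W \<Longrightarrow> dir_deriv n f z v = dir_deriv n g z v"
  unfolding dir_deriv_def by (intro sum.cong refl arg_cong2[where f = "(*)"] cpartial_cong[of n W]) auto

lemma dir_deriv_add:
  assumes "holo n f W" "holo n g W" "z \<in> W"
  shows "dir_deriv n (\<lambda>z. f z + g z) z v = dir_deriv n f z v + dir_deriv n g z v"
proof -
  have "dir_deriv n (\<lambda>z. f z + g z) z v = (\<Sum>j<n. v j * (cpartial j f z + cpartial j g z))"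
    unfolding dir_deriv_def by (intro sum.cong refl) (simp add: cpartial_add[OF assms])
  then show ?thesis by (simp add: dir_deriv_def ring_distribs sum.distrib)
qed

lemma dir_deriv_mult:
  assumes "holo n f W" "holo n g W" "z \<in> W"
  shows "dir_deriv n (\<lambda>z. f z * g z) z v = dir_deriv n f z v * g z + f z * dir_deriv n g z v"
proof -
  have "dir_deriv n (\<lambda>z. f z * g z) z v = (\<Sum>j<n. v j * (cpartial j f z * g z + f z * cpartial j g z))"
    unfolding dir_deriv_def by (intro sum.cong refl) (simp add: cpartial_mult[OF assms])
  then show ?thesis
    by (simp add: dir_deriv_def ring_distribs sum.distrib sum_distrib_left sum_distrib_right mult_ac)
qed

lemma dir_deriv_cmult:
  "holo n f W \<Longrightarrow> z \<in> W \<Longrightarrow> dir_deriv n (\<lambda>z. c * f z) z v = c * dir_deriv n f z v"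
  using dir_deriv_mult[OF holo_const, of n f W z c v] by simp

lemma dir_deriv_sum:
  assumes "\<And>l. l \<in> I \<Longrightarrow> holo n (f l) W" "z \<in> W"
  shows "dir_deriv n (\<lambda>z. \<Sum>l\<in>I. f l z) z v = (\<Sum>l\<in>I. dir_deriv n (f l) z v)"
proof -
  have "dir_deriv n (\<lambda>z. \<Sum>l\<in>I. f l z) z v = (\<Sum>j<n. v j * (\<Sum>l\<in>I. cpartial j (f l) z))"
    unfolding dir_deriv_def by (intro sum.cong refl) (simp add: cpartial_sum[OF assms])
  also have "\<dots> = (\<Sum>j<n. \<Sum>l\<in>I. v j * cpartial j (f l) z)" by (simp add: sum_distrib_left)
  finally show ?thesis by (subst (asm) sum.swap) (simp add: dir_deriv_def)
qed

lemma dir_deriv_lin: "dir_deriv n f z (\<lambda>j. a * v j + b * w j) = a * dir_deriv n f z v + b * dir_deriv n f z w"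
  by (simp add: dir_deriv_def ring_distribs sum.distrib sum_distrib_left mult_ac)

lemma holo_dir_deriv:
  assumes "copen n W" "holo n f W"
  shows "holo n (\<lambda>z. dir_deriv n f z v) W"
  unfolding dir_deriv_def by (intro holo_sum holo_mult holo_const holo_cpartial assms) auto

lemma dir_deriv_dir_deriv:
  assumes "copen n W" "holo n f W" "z \<in> W"
  shows "dir_deriv n (\<lambda>z. dir_deriv n f z v) z w = (\<Sum>i<n. \<Sum>j<n. v j * w i * cpartial i (cpartial j f) z)"
proof -
  have h: "holo n (cpartial j f) W" if "j < n" for j
    using holo_cpartial[OF assms(1,2) that] .
  have "dir_deriv n (\<lambda>z. dir_deriv n f z v) z w = (\<Sum>j<n. dir_deriv n (\<lambda>z. v j * cpartial j f z) z w)"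
    unfolding dir_deriv_def[of n f] by (rule dir_deriv_sum[where W = W]) (auto intro!: holo_mult holo_const h assms)
  also have "\<dots> = (\<Sum>j<n. v j * dir_deriv n (cpartial j f) z w)"
    by (intro sum.cong refl) (auto intro!: dir_deriv_cmult[where W = W] h assms)
  also have "\<dots> = (\<Sum>j<n. \<Sum>i<n. v j * w i * cpartial i (cpartial j f) z)"
    by (simp add: dir_deriv_def sum_distrib_left mult_ac)
  finally show ?thesis by (subst (asm) sum.swap)
qed

lemma dir_deriv_commute:
  assumes "copen n W" "holo n f W" "z \<in> W"
  shows "dir_deriv n (\<lambda>z. dir_deriv n f z v) z w = dir_deriv n (\<lambda>z. dir_deriv n f z w) z v"
proof -
  have "(\<Sum>i<n. \<Sum>j<n. v j * w i * cpartial i (cpartial j f) z) =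
        (\<Sum>i<n. \<Sum>j<n. v j * w i * cpartial j (cpartial i f) z)"
    by (intro sum.cong refl) (simp add: cpartial_commute[OF assms(1,2) _ _ assms(3)])
  then show ?thesis
    unfolding dir_deriv_dir_deriv[OF assms] by (subst sum.swap) (simp add: mult.commute)
qed

text \<open>
The derivative of \<open>\<phi>\<close> at \<open>z\<close>, applied to \<open>v\<close>.  The components from \<open>n\<close> on are set to zero so that
the value is a vector of \<^term>\<open>cspace n\<close> for every \<open>\<phi>\<close>.
\<close>

definition jacobian :: "nat \<Rightarrow> ((nat \<Rightarrow> complex) \<Rightarrow> nat \<Rightarrow> complex) \<Rightarrow> (nat \<Rightarrow> complex) \<Rightarrow>
    (nat \<Rightarrow> complex) \<Rightarrow> nat \<Rightarrow> complex" where
  "jacobian n \<phi> z v = (\<lambda>i. if i < n then dir_deriv n (\<lambda>z. \<phi> z i) z v else 0)"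

lemma jacobian_in_cspace [simp]: "jacobian n \<phi> z v \<in> cspace n"
  by (simp add: jacobian_def cspace_def)

lemma jacobian_lin: "jacobian n \<phi> z (\<lambda>j. a * v j + b * w j) = (\<lambda>j. a * jacobian n \<phi> z v j + b * jacobian n \<phi> z w j)"
  by (auto simp: jacobian_def dir_deriv_lin)

definition holo_map :: "nat \<Rightarrow> ((nat \<Rightarrow> complex) \<Rightarrow> nat \<Rightarrow> complex) \<Rightarrow> (nat \<Rightarrow> complex) set \<Rightarrow> (nat \<Rightarrow> complex) set \<Rightarrow> bool" where
  "holo_map n \<phi> W W' \<longleftrightarrow> \<phi> ` W \<subseteq> W' \<and> (\<forall>i<n. holo n (\<lambda>z. \<phi> z i) W)"

lemma holo_map_chain_rule:
  assumes W: "copen n W" "copen n W'" and \<phi>: "holo_map n \<phi> W W'" and f: "holo n f W'" and z: "z \<in> W" and i: "i < n"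
  shows "((\<lambda>t. f (\<phi> (z(i := t)))) has_field_derivative
     (\<Sum>j<n. cpartial i (\<lambda>z. \<phi> z j) z * cpartial j f (\<phi> z))) (at (z i))"
proof -
  have "((\<lambda>t. f (\<phi> (z(i := t)))) has_field_derivative
     (\<Sum>j<n. cpartial i (\<lambda>z. \<phi> z j) z * cpartial j f (\<phi> (z(i := z i))))) (at (z i))"
  proof (rule holo_chain_rule[OF W(2) f])
    show "\<phi> (z(i := z i)) \<in> W'" using \<phi> z by (auto simp: holo_map_def)
    have "\<forall>\<^sub>F t in nhds (z i). z(i := t) \<in> W" by (rule eventually_slice[OF W(1) i z])
    then show "\<forall>\<^sub>F t in nhds (z i). \<phi> (z(i := t)) \<in> cspace n"
      by eventually_elim (use \<phi> copen_subset[OF W(2)] in \<open>auto simp: holo_map_def\<close>)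
    fix j assume "j < n"
    then show "((\<lambda>t. \<phi> (z(i := t)) j) has_field_derivative cpartial i (\<lambda>z. \<phi> z j) z) (at (z i))"
      using \<phi> by (intro holo_has_cpartial[OF _ z i]) (auto simp: holo_map_def)
  qed
  then show ?thesis by simp
qed

lemma holo_compose:
  assumes W: "copen n W" "copen n W'" and \<phi>: "holo_map n \<phi> W W'" and f: "holo n f W'"
  shows "holo n (\<lambda>z. f (\<phi> z)) W"
  unfolding holo_def
proof (intro conjI ballI allI impI)
  have "continuous_on W \<phi>"
  proof (rule continuous_on_coordinatewise_then_product)
    fix i
    show "continuous_on W (\<lambda>z. \<phi> z i)"
    proof (cases "i < n")
      case True
      then show ?thesis using \<phi> by (auto simp: holo_map_def holo_def)
    next
      case False
      have "\<phi> z i = 0" if "z \<in> W" for z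
        using that False \<phi> copen_subset[OF W(2), of "\<phi> z"] by (auto simp: holo_map_def cspace_def)
      then show ?thesis using continuous_on_const[of W 0] by (simp cong: continuous_on_cong)
    qed
  qed
  moreover have "continuous_on W' f" "\<phi> ` W \<subseteq> W'"
    using f \<phi> by (simp_all add: holo_def holo_map_def)
  ultimately show "continuous_on W (\<lambda>z. f (\<phi> z))"
    using continuous_on_compose2 by blast
next
  fix z i assume "z \<in> W" "i < n"
  then show "(\<lambda>t. f (\<phi> (z(i := t)))) field_differentiable at (z i)"
    using holo_map_chain_rule[OF assms] unfolding field_differentiable_def by blast
qed

lemma dir_deriv_compose:
  assumes W: "copen n W" "copen n W'" and \<phi>: "holo_map n \<phi> W W'" and f: "holo n f W'" and z: "z \<in> W"
  shows "dir_deriv n (\<lambda>z. f (\<phi> z)) z v = dir_deriv n f (\<phi> z) (jacobian n \<phi> z v)"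
proof -
  have "dir_deriv n (\<lambda>z. f (\<phi> z)) z v = (\<Sum>i<n. v i * (\<Sum>j<n. cpartial i (\<lambda>z. \<phi> z j) z * cpartial j f (\<phi> z)))"
    unfolding dir_deriv_def
    by (intro sum.cong refl) (simp add: cpartialI[OF holo_map_chain_rule[OF assms]])
  also have "\<dots> = (\<Sum>i<n. \<Sum>j<n. v i * cpartial i (\<lambda>z. \<phi> z j) z * cpartial j f (\<phi> z))"
    by (simp add: sum_distrib_left mult_ac)
  also have "\<dots> = (\<Sum>j<n. \<Sum>i<n. v i * cpartial i (\<lambda>z. \<phi> z j) z * cpartial j f (\<phi> z))"
    by (rule sum.swap)
  also have "\<dots> = (\<Sum>j<n. dir_deriv n (\<lambda>z. \<phi> z j) z v * cpartial j f (\<phi> z))"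
    by (simp add: dir_deriv_def sum_distrib_right)
  also have "\<dots> = dir_deriv n f (\<phi> z) (jacobian n \<phi> z v)"
    unfolding dir_deriv_def[of n f] by (intro sum.cong) (auto simp: jacobian_def)
  finally show ?thesis .
qed

lemma jacobian_compose:
  assumes W: "copen n W" "copen n W'" and \<phi>: "holo_map n \<phi> W W'" and \<psi>: "holo_map n \<psi> W' W''" and z: "z \<in> W"
  shows "jacobian n (\<lambda>z. \<psi> (\<phi> z)) z v = jacobian n \<psi> (\<phi> z) (jacobian n \<phi> z v)"
  using dir_deriv_compose[OF W \<phi> _ z, of "\<lambda>z. \<psi> z i" for i] \<psi>
  by (auto simp: jacobian_def[of n "\<lambda>z. \<psi> (\<phi> z)"] jacobian_def[of n \<psi>] holo_map_def)

lemma holo_jacobian: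
  assumes "copen n W" "holo_map n \<phi> W W'"
  shows "holo n (\<lambda>z. jacobian n \<phi> z v i) W"
  using holo_dir_deriv[OF assms(1)] assms(2) by (cases "i < n") (auto simp: jacobian_def holo_map_def holo_const)

definition radial_path :: "(nat \<Rightarrow> complex) \<Rightarrow> complex \<Rightarrow> (nat \<Rightarrow> complex) \<Rightarrow> nat \<Rightarrow> complex" where
  "radial_path a t z = (\<lambda>i. a i + t * (z i - a i))"

lemma radial_path_in_polydisc:
  assumes "z \<in> polydisc n a r" "a \<in> cspace n" "t \<in> {0..1}"
  shows "radial_path a (of_real t) z \<in> polydisc n a r"
proof -
  have "dist (radial_path a (of_real t) z i) (a i) < r" if "i < n" for i
  proof -
    have "norm (of_real t * (z i - a i)) \<le> norm (z i - a i)"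
      using assms(3) by (simp add: norm_mult mult_left_le_one_le)
    also have "\<dots> < r" using assms(1) that by (auto simp: polydisc_def dist_norm)
    finally show ?thesis by (simp add: radial_path_def dist_norm)
  qed
  then show ?thesis using assms by (auto simp: polydisc_def radial_path_def cspace_def)
qed

lemma radial_path_has_vector_derivative:
  assumes W: "copen n W" and f: "holo n f W" and "a \<in> cspace n" "z \<in> cspace n" and s: "radial_path a (of_real s) z \<in> W"
  shows "((\<lambda>t. f (radial_path a (of_real t) z)) has_vector_derivative
     dir_deriv n f (radial_path a (of_real s) z) (\<lambda>j. z j - a j)) (at s within S)"
proof -
  have "((\<lambda>t. f (radial_path a t z)) has_field_derivative
     (\<Sum>j<n. (z j - a j) * cpartial j f (radial_path a (of_real s) z))) (at (of_real s))"
  proof (rule holo_chain_rule[OF W f, of "\<lambda>t. radial_path a t z", OF s])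
    show "\<forall>\<^sub>F t in nhds (of_real s). radial_path a t z \<in> cspace n"
      using assms by (auto simp: radial_path_def cspace_def)
  qed (auto simp: radial_path_def intro!: derivative_eq_intros)
  from has_vector_derivative_real_field[OF this, of S] show ?thesis
    by (simp add: dir_deriv_def)
qed

text \<open>
The restriction of \<open>f\<close> to the segment from \<open>a\<close> to \<open>z\<close>, which stays in the polydisc, has derivative
zero.
\<close>

lemma constant_if_dir_deriv_0:
  assumes f: "holo n f (polydisc n a r)" and a: "a \<in> cspace n" and z: "z \<in> polydisc n a r"
    and 0: "\<And>w v. w \<in> polydisc n a r \<Longrightarrow> v \<in> cspace n \<Longrightarrow> dir_deriv n f w v = 0"
  shows "f z = f a"
proof -
  have zc: "z \<in> cspace n" using z polydisc_subset_cspace by blast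
  then have v: "(\<lambda>j. z j - a j) \<in> cspace n" using a by (auto simp: cspace_def)
  have "((\<lambda>t. f (radial_path a (of_real t) z)) has_vector_derivative 0) (at t within {0..1})" if "t \<in> {0..1}" for t
    using radial_path_has_vector_derivative[OF copen_polydisc f a zc, of t "{0..1}"]
      radial_path_in_polydisc[OF z a that] 0[OF _ v] by simp
  then obtain c where "\<And>t. t \<in> {0..1} \<Longrightarrow> f (radial_path a (of_real t) z) = c"
    using has_vector_derivative_zero_constant[of "{0..1}" "\<lambda>t. f (radial_path a (of_real t) z)"] by auto
  from this[of 0] this[of 1] show ?thesis by (simp add: radial_path_def)
qed

section \<open>Alternating forms\<close>

definition remove_nth :: "nat \<Rightarrow> 'b list \<Rightarrow> 'b list" where
  "remove_nth i vs = take i vs @ drop (Suc i) vs"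

lemma length_remove_nth: "i < length vs \<Longrightarrow> length (remove_nth i vs) = length vs - 1"
  by (auto simp: remove_nth_def)

lemma set_remove_nth_subset: "set (remove_nth i vs) \<subseteq> set vs"
  using set_take_subset[of i vs] set_drop_subset[of "Suc i" vs] by (auto simp: remove_nth_def)

lemma map_remove_nth: "map f (remove_nth i vs) = remove_nth i (map f vs)"
  by (simp add: remove_nth_def take_map drop_map)

lemma nth_remove_nth: "j < length vs - 1 \<Longrightarrow> remove_nth i vs ! j = (if j < i then vs ! j else vs ! Suc j)"
  by (auto simp: remove_nth_def nth_append min_def)

lemma remove_nth_append_left: "i < length xs \<Longrightarrow> remove_nth i (xs @ ys) = remove_nth i xs @ ys"
  by (simp add: remove_nth_def)

lemma remove_nth_append_right: "remove_nth (length xs + i) (xs @ ys) = xs @ remove_nth i ys"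
  by (simp add: remove_nth_def)

lemma remove_nth_Cons_0 [simp]: "remove_nth 0 (x # xs) = xs"
  by (simp add: remove_nth_def)

lemma remove_nth_Cons_Suc [simp]: "remove_nth (Suc i) (x # xs) = x # remove_nth i xs"
  by (simp add: remove_nth_def)

lemma remove_nth_remove_nth:
  assumes "j < i" "i < length vs"
  shows "remove_nth (i - 1) (remove_nth j vs) = remove_nth j (remove_nth i vs)"
  using assms by (intro nth_equalityI) (auto simp: nth_remove_nth length_remove_nth)

text \<open>
Deleting first position \<open>i\<close> and then position \<open>j < i\<close> removes the same two entries as deleting
first \<open>j\<close> and then \<open>i - 1\<close>.  The two summands have opposite signs and cancel, because \<open>S\<close> is
symmetric.  This is the combinatorial reason for \<open>d \<circ> d = 0\<close>.
\<close>

lemma sum_antisym_remove_nth_eq_0: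
  fixes S :: "'b \<Rightarrow> 'b \<Rightarrow> 'b list \<Rightarrow> complex"
  assumes sym: "\<And>i j. i < length vs \<Longrightarrow> j < length vs \<Longrightarrow> S (vs ! i) (vs ! j) = S (vs ! j) (vs ! i)"
  shows "(\<Sum>i<length vs. (- 1) ^ i * (\<Sum>j<length (remove_nth i vs).
    (- 1) ^ j * S (vs ! i) (remove_nth i vs ! j) (remove_nth j (remove_nth i vs)))) = 0"
proof -
  define m where "m = length vs"
  define F where "F i j = (- 1) ^ i * ((- 1) ^ j * S (vs ! i) (remove_nth i vs ! j) (remove_nth j (remove_nth i vs)))" for i j
  have "(\<Sum>i<m. (- 1) ^ i * (\<Sum>j<length (remove_nth i vs).
      (- 1) ^ j * S (vs ! i) (remove_nth i vs ! j) (remove_nth j (remove_nth i vs)))) = (\<Sum>i<m. \<Sum>j<m - 1. F i j)"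
    by (intro sum.cong refl) (simp add: F_def sum_distrib_left m_def length_remove_nth)
  also have "\<dots> = (\<Sum>(i, j)\<in>{..<m} \<times> {..<m - 1}. F i j)"
    by (simp add: sum.cartesian_product)
  also have "{..<m} \<times> {..<m - 1} = {(i, j). j < i \<and> i < m} \<union> {(i, j). i \<le> j \<and> j < m - 1}"
    by auto
  also have "(\<Sum>(i, j)\<in>\<dots>. F i j) =
      (\<Sum>(i, j)\<in>{(i, j). j < i \<and> i < m}. F i j) + (\<Sum>(i, j)\<in>{(i, j). i \<le> j \<and> j < m - 1}. F i j)"
  proof (rule sum.union_disjoint)
    show "finite {(i, j). j < i \<and> i < m}"
      by (rule finite_subset[of _ "{..<m} \<times> {..<m}"]) auto
    show "finite {(i, j). i \<le> j \<and> j < m - 1}"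
      by (rule finite_subset[of _ "{..<m} \<times> {..<m}"]) auto
  qed auto
  \<comment> \<open>Deleting \<open>i\<close> and then \<open>j \<ge> i\<close> removes the original positions \<open>i\<close> and \<open>Suc j\<close>.\<close>
  also have "(\<Sum>(i, j)\<in>{(i, j). i \<le> j \<and> j < m - 1}. F i j) = (\<Sum>(i, j)\<in>{(i, j). j < i \<and> i < m}. F j (i - 1))"
    by (rule sum.reindex_bij_witness[of _ "\<lambda>(i, j). (j, i - 1)" "\<lambda>(i, j). (Suc j, i)"]) auto
  also have "\<dots> = (\<Sum>(i, j)\<in>{(i, j). j < i \<and> i < m}. - F i j)"
  proof (intro sum.cong refl)
    fix p assume "p \<in> {(i, j). j < i \<and> i < m}"
    then obtain i j where p: "p = (i, j)" and ij: "j < i" "i < m" by auto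
    have "F j (i - 1) = (- 1) ^ j * ((- 1) ^ (i - 1) * S (vs ! j) (vs ! i) (remove_nth j (remove_nth i vs)))"
    proof -
      have "i - 1 < length vs - 1" "\<not> i - 1 < j" "Suc (i - 1) = i" using ij by (auto simp: m_def)
      then have "remove_nth j vs ! (i - 1) = vs ! i" by (simp only: nth_remove_nth if_False)
      then show ?thesis using ij remove_nth_remove_nth[of j i vs] by (simp add: F_def m_def)
    qed
    also have "\<dots> = - ((- 1) ^ i * ((- 1) ^ j * S (vs ! i) (vs ! j) (remove_nth j (remove_nth i vs))))"
      using ij sym[of i j] by (cases i) (simp_all add: m_def)
    also have "\<dots> = - F i j"
      using ij by (simp add: F_def nth_remove_nth m_def)
    finally show "(case p of (i, j) \<Rightarrow> F j (i - 1)) = (case p of (i, j) \<Rightarrow> - F i j)"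
      by (simp add: p)
  qed
  also have "\<dots> = - (\<Sum>(i, j)\<in>{(i, j). j < i \<and> i < m}. F i j)"
    by (simp add: case_prod_unfold sum_negf)
  finally show ?thesis
    by (simp add: m_def)
qed

lemma alt_outside: "\<alpha> \<in> alternating_forms n k \<Longrightarrow> vs \<notin> tuples n k \<Longrightarrow> \<alpha> vs = 0"
  by (simp add: alternating_forms_def)

lemma cspace_lin: "v \<in> cspace n \<Longrightarrow> w \<in> cspace n \<Longrightarrow> (\<lambda>j. a * v j + b * w j) \<in> cspace n"
  by (simp add: cspace_def)

text \<open>
If the list is not a \<open>k\<close>-tuple of vectors, all three values are zero; so the rule holds for all
\<open>xs\<close> and \<open>ys\<close> and can be applied without checking lengths.
\<close>

lemma alt_lin:
  assumes \<alpha>: "\<alpha> \<in> alternating_forms n k" and v: "v \<in> cspace n" and w: "w \<in> cspace n"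
  shows "\<alpha> (xs @ (\<lambda>j. a * v j + b * w j) # ys) = a * \<alpha> (xs @ v # ys) + b * \<alpha> (xs @ w # ys)"
proof (cases "xs @ v # ys \<in> tuples n k")
  case True
  then have "length xs < k" by (auto simp: tuples_def)
  with \<alpha> True v w
  have "\<alpha> ((xs @ v # ys)[length xs := \<lambda>j. a * v j + b * w j]) =
      a * \<alpha> ((xs @ v # ys)[length xs := v]) + b * \<alpha> ((xs @ v # ys)[length xs := w])"
    unfolding alternating_forms_def by blast
  then show ?thesis by simp
next
  case False
  then have "xs @ u # ys \<notin> tuples n k" if "u \<in> cspace n" for u
    using v that by (auto simp: tuples_def)
  then show ?thesis
    using v w cspace_lin[OF v w] alt_outside[OF \<alpha>] by simp
qed

lemma alt_sum:
  assumes \<alpha>: "\<alpha> \<in> alternating_forms n k" and "finite S" and "\<And>l. l \<in> S \<Longrightarrow> v l \<in> cspace n"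
  shows "\<alpha> (xs @ (\<lambda>j. \<Sum>l\<in>S. c l * v l j) # ys) = (\<Sum>l\<in>S. c l * \<alpha> (xs @ v l # ys))"
  using assms(2,3)
proof (induction S)
  case empty
  have "(\<lambda>j. 0) \<in> cspace n" by (simp add: cspace_def)
  from alt_lin[OF \<alpha> this this, of xs 0 0 ys] show ?case by simp
next
  case (insert l S)
  have "(\<lambda>j. \<Sum>l\<in>S. c l * v l j) \<in> cspace n"
    using insert.prems by (simp add: cspace_def)
  from alt_lin[OF \<alpha> _ this, of "v l" xs "c l" 1 ys] insert show ?case by simp
qed

definition basis_vec :: "nat \<Rightarrow> nat \<Rightarrow> complex" where
  "basis_vec l = (\<lambda>j. if j = l then 1 else 0)"

lemma basis_vec_in_cspace: "l < n \<Longrightarrow> basis_vec l \<in> cspace n"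
  by (simp add: basis_vec_def cspace_def)

lemma basis_expansion: "v \<in> cspace n \<Longrightarrow> v = (\<lambda>j. \<Sum>l<n. v l * basis_vec l j)"
  by (auto simp: basis_vec_def cspace_def if_distrib cong: if_cong)

lemma alt_expand:
  assumes "\<alpha> \<in> alternating_forms n k" "v \<in> cspace n"
  shows "\<alpha> (xs @ v # ys) = (\<Sum>l<n. v l * \<alpha> (xs @ basis_vec l # ys))"
  using alt_sum[OF assms(1), of "{..<n}" basis_vec xs v ys] basis_vec_in_cspace
    basis_expansion[OF assms(2)] by simp

text \<open>
Expand the value zero of the form at the repeated vector \<open>v + w\<close>.
\<close>

lemma swap_from_adjacent:
  assumes lin: "\<And>xs ys v w a b. v \<in> cspace n \<Longrightarrow> w \<in> cspace n \<Longrightarrow>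
      \<alpha> (xs @ (\<lambda>j. a * v j + b * w j) # ys) = a * \<alpha> (xs @ v # ys) + b * \<alpha> (xs @ w # ys)"
    and adj: "\<And>xs v ys. v \<in> cspace n \<Longrightarrow> \<alpha> (xs @ v # v # ys) = (0::complex)"
    and "v \<in> cspace n" "w \<in> cspace n"
  shows "\<alpha> (xs @ v # w # ys) = - \<alpha> (xs @ w # v # ys)"
proof -
  define u where "u = (\<lambda>j. 1 * v j + 1 * w j)"
  have u: "u \<in> cspace n" unfolding u_def by (intro cspace_lin assms)
  have "0 = \<alpha> (xs @ u # u # ys)" using adj[OF u] by simp
  also have "\<dots> = \<alpha> (xs @ v # u # ys) + \<alpha> (xs @ w # u # ys)"
    using lin[OF assms(3,4), of xs 1 1 "u # ys"] by (simp add: u_def)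
  also have "\<alpha> (xs @ v # u # ys) = \<alpha> (xs @ v # v # ys) + \<alpha> (xs @ v # w # ys)"
    using lin[OF assms(3,4), of "xs @ [v]" 1 1 ys] by (simp add: u_def)
  also have "\<alpha> (xs @ w # u # ys) = \<alpha> (xs @ w # v # ys) + \<alpha> (xs @ w # w # ys)"
    using lin[OF assms(3,4), of "xs @ [w]" 1 1 ys] by (simp add: u_def)
  finally show ?thesis
    using adj assms(3,4) by (simp add: add_eq_0_iff)
qed

lemma move_from_swap:
  assumes swap: "\<And>xs v w ys. v \<in> cspace n \<Longrightarrow> w \<in> cspace n \<Longrightarrow>
      \<alpha> (xs @ v # w # ys) = - (\<alpha> (xs @ w # v # ys) :: complex)"
    and "x \<in> cspace n" "set ys \<subseteq> cspace n"
  shows "\<alpha> (xs @ ys @ x # zs) = (- 1) ^ length ys * \<alpha> (xs @ x # ys @ zs)"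
  using assms(3)
proof (induction ys arbitrary: xs)
  case (Cons y ys)
  have "\<alpha> (xs @ (y # ys) @ x # zs) = (- 1) ^ length ys * \<alpha> (xs @ y # x # ys @ zs)"
    using Cons.IH[of "xs @ [y]"] Cons.prems by simp
  also have "\<alpha> (xs @ y # x # ys @ zs) = - \<alpha> (xs @ x # y # ys @ zs)"
    using Cons.prems assms(2) by (intro swap) auto
  finally show ?case by simp
qed simp

text \<open>
It suffices to look at adjacent equal arguments: multilinearity then gives a sign for swapping
neighbours, hence for moving an argument next to any other.
\<close>

lemma alternating_formsI:
  assumes off: "\<And>vs. vs \<notin> tuples n k \<Longrightarrow> \<alpha> vs = 0"
    and lin: "\<And>xs ys v w a b. v \<in> cspace n \<Longrightarrow> w \<in> cspace n \<Longrightarrow>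
      \<alpha> (xs @ (\<lambda>j. a * v j + b * w j) # ys) = a * \<alpha> (xs @ v # ys) + b * \<alpha> (xs @ w # ys)"
    and adj: "\<And>xs v ys. v \<in> cspace n \<Longrightarrow> \<alpha> (xs @ v # v # ys) = 0"
  shows "\<alpha> \<in> alternating_forms n k"
  unfolding alternating_forms_def
proof (intro CollectI conjI allI ballI impI)
  show "\<alpha> vs = 0" if "vs \<notin> tuples n k" for vs
    using off that .
next
  fix vs i v w a b
  assume "vs \<in> tuples n k" "i < k" "v \<in> cspace n" "w \<in> cspace n"
  then show "\<alpha> (vs[i := \<lambda>j. a * v j + b * w j]) = a * \<alpha> (vs[i := v]) + b * \<alpha> (vs[i := w])"
    using lin[of v w "take i vs" a b "drop (Suc i) vs"] by (simp add: tuples_def upd_conv_take_nth_drop)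
next
  have eq0: "\<alpha> vs = 0" if vs: "vs \<in> tuples n k" and ij: "i < j" "j < k" and e: "vs ! i = vs ! j" for vs i j
  proof -
    \<comment> \<open>The two equal entries are the last entry of \<open>xs\<close> and the one between \<open>ys\<close> and \<open>zs\<close>.\<close>
    define xs ys zs where "xs = take (Suc i) vs" "ys = drop (Suc i) (take j vs)" "zs = drop (Suc j) vs"
    have s: "set vs \<subseteq> cspace n" "length vs = k" using vs by (auto simp: tuples_def)
    have x: "vs ! j \<in> cspace n" using s ij by auto
    have "set ys \<subseteq> cspace n" using s(1)
      by (auto simp: xs_ys_zs_def dest!: in_set_dropD in_set_takeD)
    have t: "take j vs = xs @ ys"
      using append_take_drop_id[of "Suc i" "take j vs"] ij by (simp add: xs_ys_zs_def min_absorb1)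
    have "vs = take j vs @ (vs ! j) # zs"
      using id_take_nth_drop[of j vs] ij s by (simp add: xs_ys_zs_def)
    then have "vs = xs @ ys @ (vs ! j) # zs"
      unfolding t by simp
    moreover have "xs = take i vs @ [vs ! j]"
      using ij s e by (simp add: xs_ys_zs_def take_Suc_conv_app_nth)
    moreover have "\<alpha> (xs @ ys @ (vs ! j) # zs) = (- 1) ^ length ys * \<alpha> (xs @ (vs ! j) # ys @ zs)"
      by (intro move_from_swap[of n] swap_from_adjacent[of n \<alpha>] lin adj x \<open>set ys \<subseteq> cspace n\<close>)
    ultimately show ?thesis
      using adj[OF x, of "take i vs" "ys @ zs"] by simp
  qed
  fix vs i j
  assume "vs \<in> tuples n k" "i < k" "j < k" "i \<noteq> j \<and> vs ! i = vs ! j"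
  then show "\<alpha> vs = 0"
    using eq0[of vs i j] eq0[of vs j i] by (cases "i < j") auto
qed

lemma alt_repeated:
  assumes "\<alpha> \<in> alternating_forms n k" "vs \<in> tuples n k" "i < k" "j < k" "i \<noteq> j" "vs ! i = vs ! j"
  shows "\<alpha> vs = 0"
  using assms by (simp add: alternating_forms_def)

lemma alt_adjacent:
  assumes "\<alpha> \<in> alternating_forms n k"
  shows "\<alpha> (xs @ v # v # ys) = 0"
proof (cases "xs @ v # v # ys \<in> tuples n k")
  case True
  then have "length xs < k" "Suc (length xs) < k" by (auto simp: tuples_def)
  moreover have "(xs @ v # v # ys) ! length xs = (xs @ v # v # ys) ! Suc (length xs)"
    by (simp add: nth_append)
  ultimately show ?thesis
    using alt_repeated[OF assms True] by (metis n_not_Suc_n)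
qed (rule alt_outside[OF assms])

lemma alt_front:
  assumes \<alpha>: "\<alpha> \<in> alternating_forms n k" and j: "j < length us" and "x \<in> cspace n" "set us \<subseteq> cspace n"
  shows "\<alpha> (us[j := x]) = (- 1) ^ j * \<alpha> (x # remove_nth j us)"
proof -
  have "set (take j us) \<subseteq> cspace n" using assms(4) by (auto dest: in_set_takeD)
  then have "\<alpha> ([] @ take j us @ x # drop (Suc j) us) =
      (- 1) ^ length (take j us) * \<alpha> ([] @ x # take j us @ drop (Suc j) us)"
    by (intro move_from_swap[of n] swap_from_adjacent[of n \<alpha>] alt_lin[OF \<alpha>] alt_adjacent[OF \<alpha>] assms)
  then show ?thesis
    using j by (simp add: upd_conv_take_nth_drop remove_nth_def min_def)
qed

text \<open>
Multilinearity reduces to lists of basis vectors, and a list of more than \<open>n\<close> of the \<open>n\<close> basis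
vectors has a repetition.
\<close>

lemma alternating_forms_above_dim:
  assumes \<alpha>: "\<alpha> \<in> alternating_forms n k" and "n < k"
  shows "\<alpha> vs = 0"
proof -
  have "\<alpha> (map basis_vec ls @ ys) = 0" if "set ls \<subseteq> {..<n}" for ls ys
    using that
  proof (induction ys arbitrary: ls)
    case Nil
    show ?case
    proof (cases "map basis_vec ls \<in> tuples n k")
      case True
      then have len: "length ls = k" by (simp add: tuples_def)
      have "card (set ls) \<le> n" using card_mono[OF _ Nil] by simp
      then have "\<not> distinct ls" using len \<open>n < k\<close> distinct_card[of ls] by auto
      then obtain i j where "i < k" "j < k" "i \<noteq> j" "ls ! i = ls ! j"
        using len by (auto simp: distinct_conv_nth)
      then show ?thesis
        using alt_repeated[OF \<alpha> True, of i j] len by simp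
    qed (simp add: alt_outside[OF \<alpha>])
  next
    case (Cons y ys)
    show ?case
    proof (cases "y \<in> cspace n")
      case True
      have "\<alpha> (map basis_vec ls @ basis_vec l # ys) = 0" if "l < n" for l
        using Cons.IH[of "ls @ [l]"] Cons.prems that by simp
      then show ?thesis by (simp add: alt_expand[OF \<alpha> True])
    qed (auto simp: tuples_def intro!: alt_outside[OF \<alpha>])
  qed
  from this[of "[]" vs] show ?thesis by simp
qed

lemma alternating_forms_pullback:
  assumes \<alpha>: "\<alpha> \<in> alternating_forms n k"
    and T: "\<And>v. T v \<in> cspace n"
    and lin: "\<And>v w a b. T (\<lambda>j. a * v j + b * w j) = (\<lambda>j. a * T v j + b * T w j)"
  shows "(\<lambda>vs. if vs \<in> tuples n k then \<alpha> (map T vs) else 0) \<in> alternating_forms n k" (is "?\<beta> \<in> _")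
proof (rule alternating_formsI)
  fix xs ys v w and a b :: complex assume v: "v \<in> cspace n" "w \<in> cspace n"
  have "xs @ u # ys \<in> tuples n k \<longleftrightarrow> length xs + length ys + 1 = k \<and> set xs \<subseteq> cspace n \<and> set ys \<subseteq> cspace n"
    if "u \<in> cspace n" for u
    using that by (auto simp: tuples_def)
  then show "?\<beta> (xs @ (\<lambda>j. a * v j + b * w j) # ys) = a * ?\<beta> (xs @ v # ys) + b * ?\<beta> (xs @ w # ys)"
    using v cspace_lin[OF v] alt_lin[OF \<alpha> T T] by (simp add: lin)
qed (auto simp: alt_adjacent[OF \<alpha>])

text \<open>
For equal neighbours at positions \<open>m\<close> and \<open>m + 1\<close>, every summand still contains both of them except
those with \<open>i = m\<close> and \<open>i = m + 1\<close>, which are equal up to opposite signs.  With the directional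
derivative of a form as \<open>\<beta>\<close>, this makes the exterior derivative an alternating form.
\<close>

lemma alternating_forms_antisymmetrize:
  assumes \<beta>: "\<And>v. v \<in> cspace n \<Longrightarrow> \<beta> v \<in> alternating_forms n k"
    and lin: "\<And>v w a b vs. v \<in> cspace n \<Longrightarrow> w \<in> cspace n \<Longrightarrow>
      \<beta> (\<lambda>j. a * v j + b * w j) vs = a * \<beta> v vs + b * \<beta> w vs"
  shows "(\<lambda>vs. if set vs \<subseteq> cspace n then \<Sum>i<length vs. (- 1) ^ i * \<beta> (vs ! i) (remove_nth i vs) else 0)
    \<in> alternating_forms n (Suc k)" (is "?\<alpha> \<in> _")
proof (rule alternating_formsI)
  fix vs assume vs: "vs \<notin> tuples n (Suc k)"
  show "?\<alpha> vs = 0"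
  proof (cases "set vs \<subseteq> cspace n")
    case True
    have "\<beta> (vs ! i) (remove_nth i vs) = 0" if "i < length vs" for i
    proof (rule alt_outside[OF \<beta>])
      show "vs ! i \<in> cspace n" using True nth_mem[OF that] by blast
      have "length vs \<noteq> Suc k" using vs True by (simp add: tuples_def)
      then show "remove_nth i vs \<notin> tuples n k" using length_remove_nth[OF that] that by (auto simp: tuples_def)
    qed
    then show ?thesis by simp
  qed simp
next
  fix xs ys v w and a b :: complex assume v: "v \<in> cspace n" "w \<in> cspace n"
  let ?u = "\<lambda>j. a * v j + b * w j"
  show "?\<alpha> (xs @ ?u # ys) = a * ?\<alpha> (xs @ v # ys) + b * ?\<alpha> (xs @ w # ys)"
  proof (cases "set xs \<subseteq> cspace n \<and> set ys \<subseteq> cspace n")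
    case True
    have "\<beta> ((xs @ ?u # ys) ! i) (remove_nth i (xs @ ?u # ys)) =
        a * \<beta> ((xs @ v # ys) ! i) (remove_nth i (xs @ v # ys)) + b * \<beta> ((xs @ w # ys) ! i) (remove_nth i (xs @ w # ys))"
      if i: "i < length xs + Suc (length ys)" for i
    proof -
      consider "i < length xs" | "i = length xs + 0" | l where "i = length xs + Suc l" "l < length ys"
        proof (cases "i \<le> length xs")
        case False
        then show ?thesis using i that(3)[of "i - length xs - 1"] by simp
      qed (use that in linarith)
      then show ?thesis
      proof cases
        case 1
        then have "xs ! i \<in> cspace n" using True by auto
        then show ?thesis using 1 v
          by (simp add: nth_append remove_nth_append_left alt_lin[OF \<beta>])
      next
        case 2
        then show ?thesis using lin[OF v] by (simp add: nth_append remove_nth_append_right[of xs 0, simplified])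
      next
        case 3
        then have y: "ys ! l \<in> cspace n" using True by auto
        show ?thesis using 3 v
          by (simp only: remove_nth_append_right nth_append_length_plus nth_Cons_Suc remove_nth_Cons_Suc alt_lin[OF \<beta>[OF y]])
      qed
    qed
    then show ?thesis
      using True v cspace_lin[OF v]
      by (simp add: sum_distrib_left ring_distribs flip: sum.distrib) (simp add: mult_ac)
  qed auto
next
  fix xs v ys assume v: "v \<in> cspace n"
  let ?vs = "xs @ v # v # ys" and ?m = "length xs"
  show "?\<alpha> ?vs = 0"
  proof (cases "set xs \<subseteq> cspace n \<and> set ys \<subseteq> cspace n")
    case True
    have "(\<Sum>i<length ?vs. (- 1) ^ i * \<beta> (?vs ! i) (remove_nth i ?vs)) =
        (\<Sum>i\<in>{?m, Suc ?m}. (- 1) ^ i * \<beta> (?vs ! i) (remove_nth i ?vs))"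
    proof (rule sum.mono_neutral_right; (intro ballI)?)
      fix i assume "i \<in> {..<length ?vs} - {?m, Suc ?m}"
      then have i: "i < length ?vs" "i \<noteq> ?m" "i \<noteq> Suc ?m" by auto
      have "?vs ! i \<in> cspace n"
        using True v nth_mem[OF i(1)] by auto
      then have b: "\<beta> (?vs ! i) \<in> alternating_forms n k" by (rule \<beta>)
      have "\<exists>as bs. remove_nth i ?vs = as @ v # v # bs"
      proof (cases "i < ?m")
        case True
        then show ?thesis by (auto simp: remove_nth_append_left)
      next
        case False
        define l where "l = i - ?m - 2"
        have "i = ?m + Suc (Suc l)" using False i by (simp add: l_def)
        then have "remove_nth i ?vs = xs @ v # v # remove_nth l ys"
          by (simp only: remove_nth_append_right remove_nth_Cons_Suc)
        then show ?thesis by blast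
      qed
      then show "(- 1) ^ i * \<beta> (?vs ! i) (remove_nth i ?vs) = 0"
        using alt_adjacent[OF b] by auto
    qed auto
    moreover have "remove_nth ?m ?vs = xs @ v # ys" "remove_nth (Suc ?m) ?vs = xs @ v # ys"
      using remove_nth_append_right[of xs 0 "v # v # ys"] remove_nth_append_right[of xs 1 "v # v # ys"] by simp_all
    moreover have "?vs ! ?m = v" "?vs ! Suc ?m = v" by (simp_all add: nth_append)
    ultimately show ?thesis by simp
  qed auto
qed

section \<open>The exterior derivative and pullback in \<open>\<complex>\<^sup>n\<close>\<close>

definition local_form :: "nat \<Rightarrow> nat \<Rightarrow> (nat \<Rightarrow> complex) set \<Rightarrow>
    ((nat \<Rightarrow> complex) \<Rightarrow> (nat \<Rightarrow> complex) list \<Rightarrow> complex) \<Rightarrow> bool" where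
  "local_form n k W \<omega> \<longleftrightarrow>
    (\<forall>z\<in>W. \<omega> z \<in> alternating_forms n k) \<and> (\<forall>vs\<in>tuples n k. holo n (\<lambda>z. \<omega> z vs) W)"

text \<open>
The exterior derivative in coordinates.  The choice of value zero on lists with entries outside
\<^term>\<open>cspace n\<close> agrees with \<^const>\<open>ext_deriv\<close>.
\<close>

definition local_d :: "nat \<Rightarrow> ((nat \<Rightarrow> complex) \<Rightarrow> (nat \<Rightarrow> complex) list \<Rightarrow> complex) \<Rightarrow>
    (nat \<Rightarrow> complex) \<Rightarrow> (nat \<Rightarrow> complex) list \<Rightarrow> complex" where
  "local_d n \<omega> z vs = (if set vs \<subseteq> cspace n
     then \<Sum>i<length vs. (- 1) ^ i * dir_deriv n (\<lambda>z. \<omega> z (remove_nth i vs)) z (vs ! i) else 0)"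

lemma local_form_alt: "local_form n k W \<omega> \<Longrightarrow> z \<in> W \<Longrightarrow> \<omega> z \<in> alternating_forms n k"
  by (simp add: local_form_def)

lemma local_form_holo:
  assumes "copen n W" "local_form n k W \<omega>"
  shows "holo n (\<lambda>z. \<omega> z vs) W"
proof (cases "vs \<in> tuples n k")
  case False
  then have "\<omega> z vs = 0" if "z \<in> W" for z
    using assms(2) that alt_outside by (auto simp: local_form_def)
  then show ?thesis using holo_cong[OF assms(1) _ holo_const[of n 0 W]] by simp
qed (use assms in \<open>simp add: local_form_def\<close>)

text \<open>
Being alternating is a system of linear equations between values of the form, and these are
preserved when the values are differentiated.
\<close>

lemma alternating_dir_deriv:
  assumes W: "copen n W" and \<omega>: "local_form n k W \<omega>" and z: "z \<in> W"
  shows "(\<lambda>vs. dir_deriv n (\<lambda>y. \<omega> y vs) z v) \<in> alternating_forms n k"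
proof (rule alternating_formsI)
  note alt = local_form_alt[OF \<omega>]
  show "dir_deriv n (\<lambda>y. \<omega> y vs) z v = 0" if "vs \<notin> tuples n k" for vs
    using dir_deriv_cong[OF W _ z, of "\<lambda>y. \<omega> y vs" "\<lambda>y. 0"] alt_outside[OF alt that] by simp
  show "dir_deriv n (\<lambda>y. \<omega> y (xs @ v' # v' # ys)) z v = 0" for xs v' ys
    using dir_deriv_cong[OF W _ z, of "\<lambda>y. \<omega> y (xs @ v' # v' # ys)" "\<lambda>y. 0"] alt_adjacent[OF alt] by simp
  fix xs ys v' w and a b :: complex assume v': "v' \<in> cspace n" "w \<in> cspace n"
  note h = local_form_holo[OF W \<omega>]
  have "dir_deriv n (\<lambda>y. \<omega> y (xs @ (\<lambda>j. a * v' j + b * w j) # ys)) z v =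
      dir_deriv n (\<lambda>y. a * \<omega> y (xs @ v' # ys) + b * \<omega> y (xs @ w # ys)) z v"
    by (rule dir_deriv_cong[OF W _ z]) (rule alt_lin[OF alt v'])
  also have "\<dots> = dir_deriv n (\<lambda>y. a * \<omega> y (xs @ v' # ys)) z v + dir_deriv n (\<lambda>y. b * \<omega> y (xs @ w # ys)) z v"
    by (intro dir_deriv_add[where W = W] holo_mult holo_const h z)
  also have "\<dots> = a * dir_deriv n (\<lambda>y. \<omega> y (xs @ v' # ys)) z v + b * dir_deriv n (\<lambda>y. \<omega> y (xs @ w # ys)) z v"
    by (simp add: dir_deriv_cmult[OF h z])
  finally show "dir_deriv n (\<lambda>y. \<omega> y (xs @ (\<lambda>j. a * v' j + b * w j) # ys)) z v =
    a * dir_deriv n (\<lambda>y. \<omega> y (xs @ v' # ys)) z v + b * dir_deriv n (\<lambda>y. \<omega> y (xs @ w # ys)) z v" .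
qed

lemma local_d_cong:
  assumes "copen n W" "\<And>z vs. z \<in> W \<Longrightarrow> \<omega> z vs = \<omega>' z vs" "z \<in> W"
  shows "local_d n \<omega> z vs = local_d n \<omega>' z vs"
  unfolding local_d_def
  by (intro if_cong sum.cong refl arg_cong2[where f = "(*)"] dir_deriv_cong[OF assms(1) _ assms(3)] assms(2))

lemma local_form_subset: "local_form n k W \<omega> \<Longrightarrow> V \<subseteq> W \<Longrightarrow> local_form n k V \<omega>"
  using holo_subset[of n _ W V] by (auto simp: local_form_def)

lemma local_form_local_d:
  assumes W: "copen n W" and \<omega>: "local_form n k W \<omega>"
  shows "local_form n (Suc k) W (local_d n \<omega>)"
  unfolding local_form_def
proof (intro conjI ballI)
  fix z assume z: "z \<in> W"
  show "local_d n \<omega> z \<in> alternating_forms n (Suc k)"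
    unfolding local_d_def[abs_def]
    by (rule alternating_forms_antisymmetrize[where \<beta> = "\<lambda>v vs. dir_deriv n (\<lambda>y. \<omega> y vs) z v"])
      (simp_all add: dir_deriv_lin alternating_dir_deriv[OF W \<omega> z])
next
  fix vs
  show "holo n (\<lambda>z. local_d n \<omega> z vs) W"
    unfolding local_d_def
    by (cases "set vs \<subseteq> cspace n")
      (auto intro!: holo_sum holo_mult holo_const holo_dir_deriv[OF W] local_form_holo[OF W \<omega>])
qed

text \<open>
The terms are second derivatives of values of \<open>\<omega>\<close> in the two directions whose arguments were
deleted, and second derivatives commute.
\<close>

lemma local_d_local_d:
  assumes W: "copen n W" and \<omega>: "local_form n k W \<omega>" and z: "z \<in> W"
  shows "local_d n (local_d n \<omega>) z vs = 0"
proof (cases "set vs \<subseteq> cspace n")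
  case True
  note h = local_form_holo[OF W \<omega>]
  define S where "S x y ws = dir_deriv n (\<lambda>z. dir_deriv n (\<lambda>y. \<omega> y ws) z y) z x" for x y ws
  have S: "dir_deriv n (\<lambda>z. local_d n \<omega> z (remove_nth i vs)) z (vs ! i) =
      (\<Sum>j<length (remove_nth i vs). (- 1) ^ j * S (vs ! i) (remove_nth i vs ! j) (remove_nth j (remove_nth i vs)))" for i
  proof -
    have "dir_deriv n (\<lambda>z. local_d n \<omega> z (remove_nth i vs)) z (vs ! i) =
        dir_deriv n (\<lambda>z. \<Sum>j<length (remove_nth i vs). (- 1) ^ j * dir_deriv n (\<lambda>z. \<omega> z (remove_nth j (remove_nth i vs))) z (remove_nth i vs ! j)) z (vs ! i)"
      using subset_trans[OF set_remove_nth_subset True] by (simp add: local_d_def)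
    also have "\<dots> = (\<Sum>j<length (remove_nth i vs). dir_deriv n (\<lambda>z. (- 1) ^ j * dir_deriv n (\<lambda>z. \<omega> z (remove_nth j (remove_nth i vs))) z (remove_nth i vs ! j)) z (vs ! i))"
      by (intro dir_deriv_sum[where W = W] holo_mult holo_const holo_dir_deriv W h z)
    also have "\<dots> = (\<Sum>j<length (remove_nth i vs). (- 1) ^ j * S (vs ! i) (remove_nth i vs ! j) (remove_nth j (remove_nth i vs)))"
      unfolding S_def by (intro sum.cong refl dir_deriv_cmult[where W = W] holo_dir_deriv W h z)
    finally show ?thesis .
  qed
  have "local_d n (local_d n \<omega>) z vs = (\<Sum>i<length vs. (- 1) ^ i *
      (\<Sum>j<length (remove_nth i vs). (- 1) ^ j * S (vs ! i) (remove_nth i vs ! j) (remove_nth j (remove_nth i vs))))"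
    unfolding local_d_def[of n "local_d n \<omega>"] using True by (simp only: S if_True)
  also have "\<dots> = 0"
    by (rule sum_antisym_remove_nth_eq_0) (simp add: S_def fun_eq_iff dir_deriv_commute[OF W h z])
  finally show ?thesis .
qed (simp add: local_d_def)

text \<open>
The product rule for inserting variable vectors \<open>u z\<close> into a variable form \<open>A z\<close>.  Each variable
argument is expanded in the standard basis, which reduces the claim to products of functions and
one variable argument less; the constant arguments \<open>xs\<close> collect the basis vectors of the expansion.
\<close>

lemma form_product_rule:
  assumes W: "copen n W" and A: "local_form n k W A"
    and us: "\<And>u i. u \<in> set us \<Longrightarrow> i < n \<Longrightarrow> holo n (\<lambda>z. u z i) W"
      "\<And>u z. u \<in> set us \<Longrightarrow> z \<in> W \<Longrightarrow> u z \<in> cspace n"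
  shows "holo n (\<lambda>z. A z (xs @ map (\<lambda>u. u z) us)) W"
    and "z \<in> W \<Longrightarrow> dir_deriv n (\<lambda>z. A z (xs @ map (\<lambda>u. u z) us)) z v =
      dir_deriv n (\<lambda>y. A y (xs @ map (\<lambda>u. u z) us)) z v +
      (\<Sum>j<length us. A z (xs @ (map (\<lambda>u. u z) us)[j := jacobian n (us ! j) z v]))"
proof -
  note alt = local_form_alt[OF A]
  have "holo n (\<lambda>z. A z (xs @ map (\<lambda>u. u z) us)) W \<and>
    (\<forall>z\<in>W. dir_deriv n (\<lambda>z. A z (xs @ map (\<lambda>u. u z) us)) z v =
      dir_deriv n (\<lambda>y. A y (xs @ map (\<lambda>u. u z) us)) z v +
      (\<Sum>j<length us. A z (xs @ (map (\<lambda>u. u z) us)[j := jacobian n (us ! j) z v])))"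
    using us
  proof (induction us arbitrary: xs)
    case Nil
    show ?case by (simp add: local_form_holo[OF W A])
  next
    case (Cons u us)
    define G where "G l z = A z (xs @ basis_vec l # map (\<lambda>u. u z) us)" for l z
    have IH: "holo n (G l) W"
      "z \<in> W \<Longrightarrow> dir_deriv n (G l) z v = dir_deriv n (\<lambda>y. A y (xs @ basis_vec l # map (\<lambda>u. u z) us)) z v +
        (\<Sum>j<length us. A z (xs @ basis_vec l # (map (\<lambda>u. u z) us)[j := jacobian n (us ! j) z v]))" for l z
      using Cons.IH[of "xs @ [basis_vec l]"] Cons.prems unfolding G_def by simp_all
    have u: "\<And>i. i < n \<Longrightarrow> holo n (\<lambda>z. u z i) W" "\<And>z. z \<in> W \<Longrightarrow> u z \<in> cspace n"
      using Cons.prems by simp_all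
    have eq: "A z (xs @ map (\<lambda>u. u z) (u # us)) = (\<Sum>l<n. u z l * G l z)" if "z \<in> W" for z
      using alt_expand[OF alt[OF that] u(2)[OF that]] by (simp add: G_def)
    have "holo n (\<lambda>z. A z (xs @ map (\<lambda>u. u z) (u # us))) W"
      by (rule holo_cong[OF W eq[symmetric]]) (auto intro!: holo_sum holo_mult u IH)
    moreover have "dir_deriv n (\<lambda>z. A z (xs @ map (\<lambda>u. u z) (u # us))) z v =
        dir_deriv n (\<lambda>y. A y (xs @ map (\<lambda>u. u z) (u # us))) z v +
        (\<Sum>j<length (u # us). A z (xs @ (map (\<lambda>u. u z) (u # us))[j := jacobian n ((u # us) ! j) z v]))"
      if z: "z \<in> W" for z
    proof -
      have "dir_deriv n (\<lambda>z. A z (xs @ map (\<lambda>u. u z) (u # us))) z v = dir_deriv n (\<lambda>z. \<Sum>l<n. u z l * G l z) z v"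
        by (rule dir_deriv_cong[OF W eq z])
      also have "\<dots> = (\<Sum>l<n. dir_deriv n (\<lambda>z. u z l * G l z) z v)"
        by (rule dir_deriv_sum[where W = W]) (auto intro!: holo_mult u IH z)
      also have "\<dots> = (\<Sum>l<n. jacobian n u z v l * G l z + u z l * dir_deriv n (G l) z v)"
        by (intro sum.cong refl) (simp add: jacobian_def dir_deriv_mult[OF u(1) IH(1) z])
      also have "\<dots> = (\<Sum>l<n. jacobian n u z v l * A z (xs @ basis_vec l # map (\<lambda>u. u z) us)) +
          (\<Sum>l<n. u z l * dir_deriv n (\<lambda>y. A y (xs @ basis_vec l # map (\<lambda>u. u z) us)) z v) +
          (\<Sum>j<length us. \<Sum>l<n. u z l * A z (xs @ basis_vec l # (map (\<lambda>u. u z) us)[j := jacobian n (us ! j) z v]))"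
        by (subst sum.swap[of _ "{..<n}" "{..<length us}"])
          (simp add: IH(2)[OF z] G_def sum.distrib ring_distribs sum_distrib_left)
      also have "(\<Sum>l<n. jacobian n u z v l * A z (xs @ basis_vec l # map (\<lambda>u. u z) us)) =
          A z (xs @ jacobian n u z v # map (\<lambda>u. u z) us)"
        by (rule alt_expand[OF alt[OF z] jacobian_in_cspace, symmetric])
      also have "(\<Sum>l<n. u z l * dir_deriv n (\<lambda>y. A y (xs @ basis_vec l # map (\<lambda>u. u z) us)) z v) =
          dir_deriv n (\<lambda>y. A y (xs @ u z # map (\<lambda>u. u z) us)) z v"
        by (rule alt_expand[OF alternating_dir_deriv[OF W A z] u(2)[OF z], symmetric])
      also have "(\<Sum>j<length us. \<Sum>l<n. u z l * A z (xs @ basis_vec l # (map (\<lambda>u. u z) us)[j := jacobian n (us ! j) z v])) =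
          (\<Sum>j<length us. A z (xs @ u z # (map (\<lambda>u. u z) us)[j := jacobian n (us ! j) z v]))"
        by (intro sum.cong refl alt_expand[OF alt[OF z] u(2)[OF z], symmetric])
      finally show ?thesis
        by (simp add: sum.lessThan_Suc_shift del: sum.lessThan_Suc)
    qed
    ultimately show ?case by blast
  qed
  then show "holo n (\<lambda>z. A z (xs @ map (\<lambda>u. u z) us)) W"
    and "z \<in> W \<Longrightarrow> dir_deriv n (\<lambda>z. A z (xs @ map (\<lambda>u. u z) us)) z v =
      dir_deriv n (\<lambda>y. A y (xs @ map (\<lambda>u. u z) us)) z v +
      (\<Sum>j<length us. A z (xs @ (map (\<lambda>u. u z) us)[j := jacobian n (us ! j) z v]))"
    by blast+
qed

definition pullback :: "nat \<Rightarrow> nat \<Rightarrow> ((nat \<Rightarrow> complex) \<Rightarrow> nat \<Rightarrow> complex) \<Rightarrow>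
    ((nat \<Rightarrow> complex) \<Rightarrow> (nat \<Rightarrow> complex) list \<Rightarrow> complex) \<Rightarrow>
    (nat \<Rightarrow> complex) \<Rightarrow> (nat \<Rightarrow> complex) list \<Rightarrow> complex" where
  "pullback n k \<phi> \<omega> z vs = (if vs \<in> tuples n k then \<omega> (\<phi> z) (map (jacobian n \<phi> z) vs) else 0)"

context
  fixes n k W W' \<phi> \<omega>
  assumes W: "copen n W" "copen n W'" and \<phi>: "holo_map n \<phi> W W'" and \<omega>: "local_form n k W' \<omega>"
begin

lemma local_form_compose: "local_form n k W (\<lambda>z. \<omega> (\<phi> z))"
  unfolding local_form_def
proof (intro conjI ballI)
  show "\<omega> (\<phi> z) \<in> alternating_forms n k" if "z \<in> W" for z
    using that \<phi> local_form_alt[OF \<omega>] by (auto simp: holo_map_def)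
  show "holo n (\<lambda>z. \<omega> (\<phi> z) vs) W" for vs
    by (rule holo_compose[OF W \<phi> local_form_holo[OF W(2) \<omega>]])
qed

lemma local_form_pullback: "local_form n k W (pullback n k \<phi> \<omega>)"
  unfolding local_form_def
proof (intro conjI ballI)
  fix z assume "z \<in> W"
  then have "\<omega> (\<phi> z) \<in> alternating_forms n k" using local_form_compose by (simp add: local_form_def)
  then show "pullback n k \<phi> \<omega> z \<in> alternating_forms n k"
    unfolding pullback_def[abs_def] by (rule alternating_forms_pullback) (simp_all add: jacobian_lin)
next
  fix vs assume vs: "vs \<in> tuples n k"
  have "holo n (\<lambda>z. \<omega> (\<phi> z) ([] @ map (\<lambda>u. u z) (map (\<lambda>v z. jacobian n \<phi> z v) vs))) W"
    by (rule form_product_rule(1)[OF W(1) local_form_compose]) (auto intro!: holo_jacobian[OF W(1) \<phi>])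
  then show "holo n (\<lambda>z. pullback n k \<phi> \<omega> z vs) W"
    using vs by (simp add: pullback_def comp_def)
qed

text \<open>
The derivative in direction \<open>v\<close> of the vector field \<open>z \<mapsto> D\<phi>(z) w\<close> is the second derivative
\<open>D\<^sup>2\<phi>(z)(v, w)\<close>.
\<close>

lemma hessian_symmetric:
  assumes "z \<in> W"
  shows "jacobian n (\<lambda>z. jacobian n \<phi> z w) z v = jacobian n (\<lambda>z. jacobian n \<phi> z v) z w"
proof
  fix i show "jacobian n (\<lambda>z. jacobian n \<phi> z w) z v i = jacobian n (\<lambda>z. jacobian n \<phi> z v) z w i"
    using dir_deriv_commute[OF W(1) _ assms, of "\<lambda>z. \<phi> z i" w v] \<phi> by (simp add: jacobian_def holo_map_def)
qed

text \<open>
Differentiating \<open>\<omega>(\<phi>(z))(D\<phi>(z) v\<^sub>1, \<dots>, D\<phi>(z) v\<^sub>k)\<close> by the product rule gives the terms of \<open>d\<omega>\<close> at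
\<open>\<phi>(z)\<close> and further terms in which one argument is replaced by a second derivative of \<open>\<phi>\<close>.  After this
argument is moved to the front, the further terms cancel in pairs, since the second derivative is
symmetric.
\<close>

lemma local_d_pullback:
  assumes z: "z \<in> W" and vs: "vs \<in> tuples n (Suc k)"
  shows "local_d n (pullback n k \<phi> \<omega>) z vs = local_d n \<omega> (\<phi> z) (map (jacobian n \<phi> z) vs)"
proof -
  define J where "J = jacobian n \<phi> z"
  define H where "H v w = jacobian n (\<lambda>z. jacobian n \<phi> z w) z v" for v w
  have J: "set (map J us) \<subseteq> cspace n" for us by (auto simp: J_def)
  have vs': "set vs \<subseteq> cspace n" "length vs = Suc k" using vs by (auto simp: tuples_def)
  have alt: "\<omega> (\<phi> z) \<in> alternating_forms n k"
    using local_form_compose z by (simp add: local_form_def)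
  define S where "S v w us = \<omega> (\<phi> z) (H v w # map J us)" for v w us
  have "dir_deriv n (\<lambda>z. pullback n k \<phi> \<omega> z (remove_nth i vs)) z (vs ! i) =
      dir_deriv n (\<lambda>y. \<omega> y (remove_nth i (map J vs))) (\<phi> z) (map J vs ! i) +
      (\<Sum>j<length (remove_nth i vs). (- 1) ^ j * S (vs ! i) (remove_nth i vs ! j) (remove_nth j (remove_nth i vs)))"
    if i: "i < length vs" for i
  proof -
    \<comment> \<open>The vectors \<open>D\<phi>(z) v\<close> for \<open>v\<close> in \<open>ds\<close> are the variable arguments of the product rule.\<close>
    define ds where "ds = remove_nth i vs"
    have ds: "ds \<in> tuples n k"
      using vs' i set_remove_nth_subset[of i vs] by (auto simp: ds_def tuples_def length_remove_nth)
    let ?us = "map (\<lambda>v z. jacobian n \<phi> z v) ds"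
    have us: "map (\<lambda>u. u y) ?us = map (jacobian n \<phi> y) ds" for y by simp
    have "dir_deriv n (\<lambda>z. pullback n k \<phi> \<omega> z ds) z (vs ! i) =
        dir_deriv n (\<lambda>z. \<omega> (\<phi> z) ([] @ map (\<lambda>u. u z) ?us)) z (vs ! i)"
      using ds by (simp add: pullback_def comp_def)
    also have "\<dots> = dir_deriv n (\<lambda>y. \<omega> (\<phi> y) ([] @ map (\<lambda>u. u z) ?us)) z (vs ! i) +
        (\<Sum>j<length ?us. \<omega> (\<phi> z) ([] @ (map (\<lambda>u. u z) ?us)[j := jacobian n (?us ! j) z (vs ! i)]))"
      by (rule form_product_rule(2)[OF W(1) local_form_compose])
        (auto intro!: holo_jacobian[OF W(1) \<phi>] z)
    also have "\<dots> = dir_deriv n (\<lambda>y. \<omega> (\<phi> y) (map J ds)) z (vs ! i) +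
        (\<Sum>j<length ds. \<omega> (\<phi> z) ((map J ds)[j := H (vs ! i) (ds ! j)]))"
      unfolding us by (simp add: J_def H_def)
    also have "dir_deriv n (\<lambda>y. \<omega> (\<phi> y) (map J ds)) z (vs ! i) = dir_deriv n (\<lambda>y. \<omega> y (map J ds)) (\<phi> z) (J (vs ! i))"
      unfolding J_def by (rule dir_deriv_compose[OF W \<phi> local_form_holo[OF W(2) \<omega>] z])
    also have "(\<Sum>j<length ds. \<omega> (\<phi> z) ((map J ds)[j := H (vs ! i) (ds ! j)])) =
        (\<Sum>j<length ds. (- 1) ^ j * S (vs ! i) (ds ! j) (remove_nth j ds))"
      using J by (intro sum.cong refl) (simp add: alt_front[OF alt] H_def S_def map_remove_nth)
    finally show ?thesis using i by (simp add: ds_def map_remove_nth)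
  qed
  then have "local_d n (pullback n k \<phi> \<omega>) z vs =
      (\<Sum>i<length vs. (- 1) ^ i * dir_deriv n (\<lambda>y. \<omega> y (remove_nth i (map J vs))) (\<phi> z) (map J vs ! i)) +
      (\<Sum>i<length vs. (- 1) ^ i * (\<Sum>j<length (remove_nth i vs). (- 1) ^ j * S (vs ! i) (remove_nth i vs ! j) (remove_nth j (remove_nth i vs))))"
    using vs' by (simp add: local_d_def ring_distribs sum.distrib)
  also have "(\<Sum>i<length vs. (- 1) ^ i * (\<Sum>j<length (remove_nth i vs). (- 1) ^ j * S (vs ! i) (remove_nth i vs ! j) (remove_nth j (remove_nth i vs)))) = 0"
    by (rule sum_antisym_remove_nth_eq_0) (auto simp: S_def H_def fun_eq_iff hessian_symmetric[OF z])
  finally show ?thesis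
    using J[of vs] by (simp add: local_d_def J_def)
qed

end

section \<open>The homotopy operator on a polydisc\<close>

text \<open>
A parameter integral may be differentiated under the integral sign in every coordinate direction,
hence in every direction.
\<close>

lemma holo_integral:
  fixes h :: "(nat \<Rightarrow> complex) \<Rightarrow> real \<Rightarrow> complex"
  assumes W: "copen n W" and h: "\<And>t. t \<in> {0..1} \<Longrightarrow> holo n (\<lambda>z. h z t) W"
    and cont: "continuous_on (W \<times> {0..1}) (\<lambda>(z, t). h z t)"
    and cont': "\<And>i. i < n \<Longrightarrow> continuous_on (W \<times> {0..1}) (\<lambda>(z, t). cpartial i (\<lambda>z. h z t) z)"
  shows "holo n (\<lambda>z. integral {0..1} (h z)) W"
    and "z \<in> W \<Longrightarrow> ((\<lambda>t. dir_deriv n (\<lambda>z. h z t) z v) has_integral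
      dir_deriv n (\<lambda>z. integral {0..1} (h z)) z v) {0..1}"
proof -
  have D: "((\<lambda>s. integral {0..1} (h (z(i := s)))) has_field_derivative
      integral {0..1} (\<lambda>t. cpartial i (\<lambda>z. h z t) z)) (at (z i))" if "z \<in> W" "i < n" for z i
    using that
    by (intro has_field_derivative_integral_slice[OF W _ _ _ cont cont'] holo_has_cpartial[OF h]) auto
  have "continuous_on W (\<lambda>z. integral (cbox 0 1) (h z))"
    using cont by (intro integral_continuous_on_param) (simp add: cbox_interval)
  then show "holo n (\<lambda>z. integral {0..1} (h z)) W"
    using D by (auto simp: holo_def field_differentiable_def cbox_interval)
  assume z: "z \<in> W"
  have "((\<lambda>t. cpartial i (\<lambda>z. h z t) z) has_integral cpartial i (\<lambda>z. integral {0..1} (h z)) z) {0..1}"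
    if i: "i < n" for i
  proof -
    have "continuous_on {0..1} (\<lambda>t. cpartial i (\<lambda>z. h z t) z)"
      using z by (intro continuous_on_compose2[OF cont'[OF i], of _ "\<lambda>t. (z, t)", simplified split_conv])
        (auto intro!: continuous_on_Pair continuous_on_const continuous_on_id)
    then show ?thesis
      unfolding cpartialI[OF D[OF z i]] by (intro integrable_integral integrable_continuous_real)
  qed
  then show "((\<lambda>t. dir_deriv n (\<lambda>z. h z t) z v) has_integral dir_deriv n (\<lambda>z. integral {0..1} (h z)) z v) {0..1}"
    unfolding dir_deriv_def by (intro has_integral_sum has_integral_mult_right) auto
qed

lemma dir_deriv_basis_vec: "i < n \<Longrightarrow> dir_deriv n f z (basis_vec i) = cpartial i f z"
  by (simp add: dir_deriv_def basis_vec_def if_distrib if_distribR cong: if_cong)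

text \<open>
Pullback along the contraction of the polydisc to its centre \<open>a\<close>, with the radial vector \<open>z - a\<close> in
the first slot; the power \<open>t\<^sup>k\<close> accounts for the remaining \<open>k\<close> arguments, each of which is scaled by \<open>t\<close>.
\<close>

definition radial_integrand :: "nat \<Rightarrow> (nat \<Rightarrow> complex) \<Rightarrow>
    ((nat \<Rightarrow> complex) \<Rightarrow> (nat \<Rightarrow> complex) list \<Rightarrow> complex) \<Rightarrow>
    (nat \<Rightarrow> complex) list \<Rightarrow> (nat \<Rightarrow> complex) \<Rightarrow> real \<Rightarrow> complex" where
  "radial_integrand k a \<omega> vs z t = of_real t ^ k * \<omega> (radial_path a (of_real t) z) ((\<lambda>j. z j - a j) # vs)"

definition homotopy_op :: "nat \<Rightarrow> (nat \<Rightarrow> complex) \<Rightarrow>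
    ((nat \<Rightarrow> complex) \<Rightarrow> (nat \<Rightarrow> complex) list \<Rightarrow> complex) \<Rightarrow>
    (nat \<Rightarrow> complex) \<Rightarrow> (nat \<Rightarrow> complex) list \<Rightarrow> complex" where
  "homotopy_op k a \<omega> z vs = integral {0..1} (radial_integrand k a \<omega> vs z)"

context
  fixes n k a r \<omega> P
  defines "P \<equiv> polydisc n a r"
  assumes a: "a \<in> cspace n" and \<omega>: "local_form n (Suc k) P \<omega>"
begin

lemma P_open: "copen n P"
  unfolding P_def by (rule copen_polydisc)

lemma P_cspace: "z \<in> P \<Longrightarrow> z \<in> cspace n"
  unfolding P_def using polydisc_subset_cspace by blast

lemma radial_in_cspace: "z \<in> P \<Longrightarrow> (\<lambda>j. z j - a j) \<in> cspace n"
  using P_cspace a by (auto simp: cspace_def)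

lemma radial_path_in_P: "z \<in> P \<Longrightarrow> t \<in> {0..1} \<Longrightarrow> radial_path a (of_real t) z \<in> P"
  unfolding P_def using radial_path_in_polydisc a by blast

lemma holo_form: "holo n (\<lambda>z. \<omega> z vs) P"
  by (rule local_form_holo[OF P_open \<omega>])

lemma dir_deriv_radial:
  assumes "l < n" shows "dir_deriv n (\<lambda>z. c * (z l - a l)) z v = c * v l"
proof -
  have "dir_deriv n (\<lambda>z. c * (z l + - a l)) z v = c * dir_deriv n (\<lambda>z. z l + - a l) z v"
    by (rule dir_deriv_cmult[where W = UNIV]) (intro holo_add holo_coord holo_const UNIV_I)+
  also have "\<dots> = c * (dir_deriv n (\<lambda>z. z l) z v + dir_deriv n (\<lambda>z. - a l) z v)"
    by (simp only: dir_deriv_add[OF holo_coord holo_const UNIV_I])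
  finally show ?thesis using assms by (simp add: dir_deriv_coord)
qed

lemma radial_path_holo_map: "t \<in> {0..1} \<Longrightarrow> holo_map n (radial_path a (of_real t)) P P"
proof -
  have "holo n (\<lambda>z. a i + of_real t * (z i + - a i)) P" for i
    by (intro holo_add holo_mult holo_const holo_coord)
  then show "t \<in> {0..1} \<Longrightarrow> holo_map n (radial_path a (of_real t)) P P"
    using radial_path_in_P by (auto simp: holo_map_def radial_path_def)
qed

lemma jacobian_radial_path:
  assumes "v \<in> cspace n" shows "jacobian n (radial_path a c) z v = (\<lambda>j. c * v j)"
proof
  fix i
  have "dir_deriv n (\<lambda>z. a i + c * (z i - a i)) z v = c * v i" if "i < n"
  proof -
    have "holo n (\<lambda>z. c * (z i + - a i)) UNIV"
      by (intro holo_add holo_mult holo_const holo_coord)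
    then have "dir_deriv n (\<lambda>z. a i + c * (z i - a i)) z v = dir_deriv n (\<lambda>z. a i) z v + dir_deriv n (\<lambda>z. c * (z i - a i)) z v"
      by (intro dir_deriv_add[where W = UNIV] holo_const) auto
    then show ?thesis using dir_deriv_radial[OF that] by simp
  qed
  then show "jacobian n (radial_path a c) z v i = c * v i"
    using assms by (simp add: jacobian_def radial_path_def cspace_def)
qed

abbreviation (input) "integrand \<equiv> radial_integrand k a \<omega>"

text \<open>
Expanding the radial vector in the basis separates the two ways in which \<open>z\<close> enters, and leaves
products of functions whose derivatives are known.
\<close>

lemma integrand_expand:
  assumes "z \<in> P" "t \<in> {0..1}"
  shows "integrand vs z t = of_real t ^ k *
    (\<Sum>l<n. (z l - a l) * \<omega> (radial_path a (of_real t) z) (basis_vec l # vs))"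
  using alt_expand[OF local_form_alt[OF \<omega> radial_path_in_P[OF assms]] radial_in_cspace[OF assms(1)], of "[]" vs]
  by (simp add: radial_integrand_def)

lemma
  assumes t: "t \<in> {0..1}"
  shows holo_integrand: "holo n (\<lambda>z. integrand vs z t) P"
    and dir_deriv_integrand_sum: "z \<in> P \<Longrightarrow> v \<in> cspace n \<Longrightarrow> dir_deriv n (\<lambda>z. integrand vs z t) z v =
      of_real t ^ k * (\<Sum>l<n. v l * \<omega> (radial_path a (of_real t) z) (basis_vec l # vs) +
        (z l - a l) * (of_real t * dir_deriv n (\<lambda>y. \<omega> y (basis_vec l # vs)) (radial_path a (of_real t) z) v))"
proof -
  let ?g = "\<lambda>l z. \<omega> (radial_path a (of_real t) z) (basis_vec l # vs)"
  have g: "holo n (?g l) P" for l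
    by (rule holo_compose[OF P_open P_open radial_path_holo_map[OF t] holo_form])
  have x: "holo n (\<lambda>z. z l - a l) P" for l
    using holo_add[OF holo_coord holo_const[of n "- a l"]] by simp
  have s: "holo n (\<lambda>z. \<Sum>l<n. (z l - a l) * ?g l z) P"
    by (intro holo_sum holo_mult g x)
  show "holo n (\<lambda>z. integrand vs z t) P"
    by (rule holo_cong[OF P_open integrand_expand[OF _ t, symmetric]])
      (auto intro: holo_mult[OF holo_const s])
  assume z: "z \<in> P" and v: "v \<in> cspace n"
  have d: "dir_deriv n (?g l) z v = of_real t * dir_deriv n (\<lambda>y. \<omega> y (basis_vec l # vs)) (radial_path a (of_real t) z) v" for l
    using dir_deriv_compose[OF P_open P_open radial_path_holo_map[OF t] holo_form z, of "basis_vec l # vs" v]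
      dir_deriv_lin[of n _ _ "of_real t" v 0 v] by (simp add: jacobian_radial_path[OF v])
  have "dir_deriv n (\<lambda>z. integrand vs z t) z v = dir_deriv n (\<lambda>z. of_real t ^ k * (\<Sum>l<n. (z l - a l) * ?g l z)) z v"
    by (rule dir_deriv_cong[OF P_open integrand_expand[OF _ t] z])
  also have "\<dots> = of_real t ^ k * (\<Sum>l<n. dir_deriv n (\<lambda>z. (z l - a l) * ?g l z) z v)"
    by (subst dir_deriv_cmult[OF s z], subst dir_deriv_sum[where W = P]) (auto intro!: holo_mult g x z)
  also have "\<dots> = of_real t ^ k * (\<Sum>l<n. v l * ?g l z + (z l - a l) * dir_deriv n (?g l) z v)"
    using dir_deriv_radial[of _ 1 z v] by (simp add: dir_deriv_mult[OF x g z])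
  also have "\<dots> = of_real t ^ k * (\<Sum>l<n. v l * ?g l z +
      (z l - a l) * (of_real t * dir_deriv n (\<lambda>y. \<omega> y (basis_vec l # vs)) (radial_path a (of_real t) z) v))"
    by (simp only: d)
  finally show "dir_deriv n (\<lambda>z. integrand vs z t) z v =
      of_real t ^ k * (\<Sum>l<n. v l * \<omega> (radial_path a (of_real t) z) (basis_vec l # vs) +
        (z l - a l) * (of_real t * dir_deriv n (\<lambda>y. \<omega> y (basis_vec l # vs)) (radial_path a (of_real t) z) v))" .
qed

text \<open>
The first summand comes from differentiating the radial vector \<open>z - a\<close>, the second from
differentiating the form along the contracted path, where the chain rule contributes the factor \<open>t\<close>.
\<close>

lemma dir_deriv_integrand:
  assumes t: "t \<in> {0..1}" and z: "z \<in> P" and v: "v \<in> cspace n"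
  shows "dir_deriv n (\<lambda>z. integrand vs z t) z v = of_real t ^ k * (\<omega> (radial_path a (of_real t) z) (v # vs) +
    of_real t * dir_deriv n (\<lambda>y. \<omega> y ((\<lambda>j. z j - a j) # vs)) (radial_path a (of_real t) z) v)"
proof -
  note s = radial_path_in_P[OF z t]
  have "\<omega> (radial_path a (of_real t) z) (v # vs) = (\<Sum>l<n. v l * \<omega> (radial_path a (of_real t) z) (basis_vec l # vs))"
    using alt_expand[OF local_form_alt[OF \<omega> s] v, of "[]"] by simp
  moreover have "dir_deriv n (\<lambda>y. \<omega> y ((\<lambda>j. z j - a j) # vs)) (radial_path a (of_real t) z) v =
      (\<Sum>l<n. (z l - a l) * dir_deriv n (\<lambda>y. \<omega> y (basis_vec l # vs)) (radial_path a (of_real t) z) v)"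
    using alt_expand[OF alternating_dir_deriv[OF P_open \<omega> s] radial_in_cspace[OF z], of "[]"] by simp
  ultimately show ?thesis
    by (simp add: dir_deriv_integrand_sum[OF t z v] sum.distrib sum_distrib_left mult_ac)
qed

lemma continuous_on_radial_path:
  assumes "continuous_on P f"
  shows "continuous_on (P \<times> {0..1}) (\<lambda>p. f (radial_path a (of_real (snd p)) (fst p)))"
proof (rule continuous_on_compose2[OF assms])
  have "continuous_on (P \<times> {0..1}) (\<lambda>p. fst p i)" for i
    by (rule continuous_on_product_then_coordinatewise[OF continuous_on_fst[OF continuous_on_id]])
  then show "continuous_on (P \<times> {0..1}) (\<lambda>p. radial_path a (of_real (snd p)) (fst p))"
    unfolding radial_path_def
    by (intro continuous_on_coordinatewise_then_product continuous_on_add continuous_on_mult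
        continuous_on_diff continuous_on_const continuous_on_of_real continuous_on_snd continuous_on_id)
  show "(\<lambda>p. radial_path a (of_real (snd p)) (fst p)) ` (P \<times> {0..1}) \<subseteq> P"
    using radial_path_in_P by auto
qed

lemma continuous_on_integrand:
  "continuous_on (P \<times> {0..1}) (\<lambda>(z, t). integrand vs z t)"
  "i < n \<Longrightarrow> continuous_on (P \<times> {0..1}) (\<lambda>(z, t). cpartial i (\<lambda>z. integrand vs z t) z)"
proof -
  have x: "continuous_on (P \<times> {0..1}) (\<lambda>p. fst p l - a l)" for l
    by (intro continuous_on_diff continuous_on_const
        continuous_on_product_then_coordinatewise[OF continuous_on_fst[OF continuous_on_id]])
  have t: "continuous_on (P \<times> {0..1}) (\<lambda>p. complex_of_real (snd p))"
    by (intro continuous_on_of_real continuous_on_snd continuous_on_id)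
  have g: "continuous_on (P \<times> {0..1}) (\<lambda>p. \<omega> (radial_path a (of_real (snd p)) (fst p)) us)" for us
    using holo_form[of us] by (intro continuous_on_radial_path) (simp add: holo_def)
  have g': "continuous_on (P \<times> {0..1}) (\<lambda>p. cpartial i (\<lambda>y. \<omega> y us) (radial_path a (of_real (snd p)) (fst p)))"
    if "i < n" for us i
    by (intro continuous_on_radial_path continuous_on_cpartial[OF P_open holo_form that])
  have "continuous_on (P \<times> {0..1}) (\<lambda>p. of_real (snd p) ^ k *
      (\<Sum>l<n. (fst p l - a l) * \<omega> (radial_path a (of_real (snd p)) (fst p)) (basis_vec l # vs)))"
    by (intro continuous_on_mult continuous_on_power continuous_on_sum x t g)
  then show "continuous_on (P \<times> {0..1}) (\<lambda>(z, t). integrand vs z t)"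
    by (rule continuous_on_eq) (auto simp: integrand_expand)
  assume i: "i < n"
  have "continuous_on (P \<times> {0..1}) (\<lambda>p. of_real (snd p) ^ k *
      (\<Sum>l<n. basis_vec i l * \<omega> (radial_path a (of_real (snd p)) (fst p)) (basis_vec l # vs) +
        (fst p l - a l) * (of_real (snd p) *
          cpartial i (\<lambda>y. \<omega> y (basis_vec l # vs)) (radial_path a (of_real (snd p)) (fst p)))))"
    by (intro continuous_on_mult continuous_on_add continuous_on_power continuous_on_const
        continuous_on_sum x t g g' i)
  then show "continuous_on (P \<times> {0..1}) (\<lambda>(z, t). cpartial i (\<lambda>z. integrand vs z t) z)"
  proof (rule continuous_on_eq)
    fix p assume "p \<in> P \<times> {0..1::real}"
    then obtain z t where p: "p = (z, t)" "z \<in> P" "t \<in> {0..1}" by auto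
    show "of_real (snd p) ^ k *
      (\<Sum>l<n. basis_vec i l * \<omega> (radial_path a (of_real (snd p)) (fst p)) (basis_vec l # vs) +
        (fst p l - a l) * (of_real (snd p) *
          cpartial i (\<lambda>y. \<omega> y (basis_vec l # vs)) (radial_path a (of_real (snd p)) (fst p)))) =
      (case p of (z, t) \<Rightarrow> cpartial i (\<lambda>z. integrand vs z t) z)"
      using dir_deriv_integrand_sum[OF p(3,2) basis_vec_in_cspace[OF i], of vs]
      by (simp add: p(1) dir_deriv_basis_vec[OF i])
  qed
qed

lemma holo_homotopy_op: "holo n (\<lambda>z. homotopy_op k a \<omega> z vs) P"
  unfolding homotopy_op_def
  by (rule holo_integral(1)[OF P_open holo_integrand continuous_on_integrand])

lemma dir_deriv_homotopy_op:
  assumes "z \<in> P"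
  shows "((\<lambda>t. dir_deriv n (\<lambda>z. integrand vs z t) z v) has_integral
    dir_deriv n (\<lambda>z. homotopy_op k a \<omega> z vs) z v) {0..1}"
  unfolding homotopy_op_def
  by (rule holo_integral(2)[OF P_open holo_integrand continuous_on_integrand assms])

lemma integrand_integrable:
  assumes "z \<in> P"
  shows "integrand vs z integrable_on {0..1}"
proof -
  have "continuous_on {0..1} (\<lambda>t. integrand vs z t)"
    using assms by (intro continuous_on_compose2[OF continuous_on_integrand(1), of _ "\<lambda>t. (z, t)", simplified split_conv])
      (auto intro!: continuous_on_Pair continuous_on_const continuous_on_id)
  then show ?thesis by (simp add: integrable_continuous_real)
qed

lemma local_form_homotopy_op: "local_form n k P (homotopy_op k a \<omega>)"
  unfolding local_form_def
proof (intro conjI ballI holo_homotopy_op)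
  fix z assume z: "z \<in> P"
  note alt = local_form_alt[OF \<omega> radial_path_in_P[OF z]]
  let ?x = "\<lambda>j. z j - a j"
  show "homotopy_op k a \<omega> z \<in> alternating_forms n k"
  proof (rule alternating_formsI)
    fix vs assume "vs \<notin> tuples n k"
    then have "?x # vs \<notin> tuples n (Suc k)" by (auto simp: tuples_def)
    then have "integrand vs z t = 0" if "t \<in> {0..1}" for t
      using alt_outside[OF alt[OF that]] by (simp add: radial_integrand_def)
    then show "homotopy_op k a \<omega> z vs = 0"
      unfolding homotopy_op_def by (subst integral_cong[of _ _ "\<lambda>_. 0"]) auto
  next
    fix xs v ys
    have "integrand (xs @ v # v # ys) z t = 0" if "t \<in> {0..1}" for t
      using alt_adjacent[OF alt[OF that], of "?x # xs"] by (simp add: radial_integrand_def)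
    then show "homotopy_op k a \<omega> z (xs @ v # v # ys) = 0"
      unfolding homotopy_op_def by (subst integral_cong[of _ _ "\<lambda>_. 0"]) auto
  next
    fix xs ys v w and b c :: complex assume v: "v \<in> cspace n" "w \<in> cspace n"
    have "integral {0..1} (integrand (xs @ (\<lambda>j. b * v j + c * w j) # ys) z) =
        integral {0..1} (\<lambda>t. b * integrand (xs @ v # ys) z t + c * integrand (xs @ w # ys) z t)"
      using alt_lin[OF alt v, of _ "?x # xs"]
      by (intro integral_cong) (simp add: radial_integrand_def ring_distribs mult_ac)
    then show "homotopy_op k a \<omega> z (xs @ (\<lambda>j. b * v j + c * w j) # ys) =
        b * homotopy_op k a \<omega> z (xs @ v # ys) + c * homotopy_op k a \<omega> z (xs @ w # ys)"
      unfolding homotopy_op_def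
      by (subst (asm) integral_add) (auto intro!: integrable_on_mult_right integrand_integrable z)
  qed
qed

text \<open>
Alternation turns the first summands of \<open>dir_deriv_integrand\<close> into \<open>k + 1\<close> copies of \<open>\<omega>(v)\<close>.  The second
summands are, because \<open>d\<omega> = 0\<close>, the derivative of \<open>\<omega>(v)\<close> in the radial direction.  Together
they are the derivative of \<open>t\<^sup>k\<^sup>+\<^sup>1 \<omega>(a + t(z - a))(v)\<close>, and the fundamental theorem of calculus applies.
\<close>

lemma local_d_homotopy_op:
  assumes closed: "\<And>z us. z \<in> P \<Longrightarrow> local_d n \<omega> z us = 0" and z: "z \<in> P" and vs: "vs \<in> tuples n (Suc k)"
  shows "local_d n (homotopy_op k a \<omega>) z vs = \<omega> z vs"
proof -
  define x where "x = (\<lambda>j. z j - a j)"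
  have x: "x \<in> cspace n" unfolding x_def by (rule radial_in_cspace[OF z])
  have vs': "set vs \<subseteq> cspace n" "length vs = Suc k" using vs by (auto simp: tuples_def)
  have "((\<lambda>t. \<Sum>i<length vs. (- 1) ^ i * dir_deriv n (\<lambda>z. integrand (remove_nth i vs) z t) z (vs ! i)) has_integral
      local_d n (homotopy_op k a \<omega>) z vs) {0..1}"
    using vs' unfolding local_d_def
    by (simp only: if_True) (intro has_integral_sum has_integral_mult_right dir_deriv_homotopy_op z finite_lessThan)
  moreover have "(\<Sum>i<length vs. (- 1) ^ i * dir_deriv n (\<lambda>z. integrand (remove_nth i vs) z t) z (vs ! i)) =
      of_nat (Suc k) * of_real t ^ k * \<omega> (radial_path a (of_real t) z) vs +
      of_real t ^ Suc k * dir_deriv n (\<lambda>y. \<omega> y vs) (radial_path a (of_real t) z) x"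
    if t: "t \<in> {0..1}" for t
  proof -
    define s where "s = radial_path a (of_real t) z"
    have s: "s \<in> P" unfolding s_def by (rule radial_path_in_P[OF z t])
    have "(- 1) ^ i * \<omega> s (vs ! i # remove_nth i vs) = \<omega> s vs" if "i < length vs" for i
    proof -
      have "vs ! i \<in> cspace n" using that vs' nth_mem by blast
      from alt_front[OF local_form_alt[OF \<omega> s] that this vs'(1)]
      have "\<omega> s vs = (- 1) ^ i * \<omega> s (vs ! i # remove_nth i vs)" by simp
      then show ?thesis by simp
    qed
    then have 1: "(\<Sum>i<length vs. (- 1) ^ i * \<omega> s (vs ! i # remove_nth i vs)) = of_nat (Suc k) * \<omega> s vs"
      using vs' by simp
    \<comment> \<open>Closedness is used for the radial vector followed by \<open>vs\<close>.\<close>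
    have "0 = local_d n \<omega> s (x # vs)" using closed[OF s] by simp
    also have "\<dots> = dir_deriv n (\<lambda>y. \<omega> y vs) s x -
        (\<Sum>i<length vs. (- 1) ^ i * dir_deriv n (\<lambda>y. \<omega> y (x # remove_nth i vs)) s (vs ! i))"
      using x vs' by (simp add: local_d_def sum.lessThan_Suc_shift sum_negf del: sum.lessThan_Suc)
    finally have 2: "(\<Sum>i<length vs. (- 1) ^ i * dir_deriv n (\<lambda>y. \<omega> y (x # remove_nth i vs)) s (vs ! i)) =
        dir_deriv n (\<lambda>y. \<omega> y vs) s x" by simp
    have "(\<Sum>i<length vs. (- 1) ^ i * dir_deriv n (\<lambda>z. integrand (remove_nth i vs) z t) z (vs ! i)) =
        (\<Sum>i<length vs. (- 1) ^ i * (of_real t ^ k * (\<omega> s (vs ! i # remove_nth i vs) +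
          of_real t * dir_deriv n (\<lambda>y. \<omega> y (x # remove_nth i vs)) s (vs ! i))))"
    proof (intro sum.cong refl)
      fix i assume "i \<in> {..<length vs}"
      then have "vs ! i \<in> cspace n" using vs' nth_mem by blast
      from dir_deriv_integrand[OF t z this]
      show "(- 1) ^ i * dir_deriv n (\<lambda>z. integrand (remove_nth i vs) z t) z (vs ! i) =
        (- 1) ^ i * (of_real t ^ k * (\<omega> s (vs ! i # remove_nth i vs) +
          of_real t * dir_deriv n (\<lambda>y. \<omega> y (x # remove_nth i vs)) s (vs ! i)))"
        by (simp add: s_def x_def)
    qed
    also have "\<dots> = of_real t ^ k * (\<Sum>i<length vs. (- 1) ^ i * \<omega> s (vs ! i # remove_nth i vs)) +
        of_real t ^ Suc k * (\<Sum>i<length vs. (- 1) ^ i * dir_deriv n (\<lambda>y. \<omega> y (x # remove_nth i vs)) s (vs ! i))"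
      by (simp add: sum_distrib_left sum.distrib ring_distribs mult_ac)
    finally show ?thesis unfolding 1 2 by (simp add: s_def mult_ac)
  qed
  ultimately have "((\<lambda>t. of_nat (Suc k) * of_real t ^ k * \<omega> (radial_path a (of_real t) z) vs +
      of_real t ^ Suc k * dir_deriv n (\<lambda>y. \<omega> y vs) (radial_path a (of_real t) z) x) has_integral
      local_d n (homotopy_op k a \<omega>) z vs) {0..1}"
    using has_integral_eq by (metis (no_types, lifting))
  \<comment> \<open>The integrand is the derivative of a function that vanishes at \<open>t = 0\<close> because of the power of \<open>t\<close>.\<close>
  moreover have "((\<lambda>t. of_nat (Suc k) * of_real t ^ k * \<omega> (radial_path a (of_real t) z) vs +
      of_real t ^ Suc k * dir_deriv n (\<lambda>y. \<omega> y vs) (radial_path a (of_real t) z) x) has_integral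
      of_real 1 ^ Suc k * \<omega> (radial_path a (of_real 1) z) vs - of_real 0 ^ Suc k * \<omega> (radial_path a (of_real 0) z) vs) {0..1}"
  proof (rule fundamental_theorem_of_calculus)
    fix t :: real assume t: "t \<in> {0..1}"
    have "((\<lambda>t. of_real t ^ Suc k) has_vector_derivative of_nat (Suc k) * complex_of_real t ^ k) (at t within {0..1})"
    proof -
      have "((\<lambda>t::complex. t ^ Suc k) has_field_derivative of_nat (Suc k) * of_real t ^ k) (at (of_real t))"
        using DERIV_power_Suc[OF DERIV_ident, where n = k] by simp
      from has_vector_derivative_real_field[OF this] show ?thesis .
    qed
    from has_vector_derivative_mult[OF this
        radial_path_has_vector_derivative[OF P_open holo_form a P_cspace[OF z] radial_path_in_P[OF z t]]]
    show "((\<lambda>t. of_real t ^ Suc k * \<omega> (radial_path a (of_real t) z) vs) has_vector_derivative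
      of_nat (Suc k) * of_real t ^ k * \<omega> (radial_path a (of_real t) z) vs +
      of_real t ^ Suc k * dir_deriv n (\<lambda>y. \<omega> y vs) (radial_path a (of_real t) z) x) (at t within {0..1})"
      by (simp add: x_def add.commute)
  qed simp
  ultimately have "local_d n (homotopy_op k a \<omega>) z vs =
      of_real 1 ^ Suc k * \<omega> (radial_path a (of_real 1) z) vs - of_real 0 ^ Suc k * \<omega> (radial_path a (of_real 0) z) vs"
    by (rule has_integral_unique)
  then show ?thesis by (simp add: radial_path_def)
qed

end

section \<open>Exactness criteria and sheaves of functions\<close>

lemma sheaf_separated:
  assumes "is_sheaf X F" "\<forall>U\<in>\<U>. openin X U" "s \<in> sections F (\<Union>\<U>)" "t \<in> sections F (\<Union>\<U>)"
    and "\<And>U. U \<in> \<U> \<Longrightarrow> restr F (\<Union>\<U>) U s = restr F (\<Union>\<U>) U t"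
  shows "s = t"
  using assms by (simp add: is_sheaf_def)

lemma sheaf_restr_0:
  assumes "is_sheaf X F" "openin X U" "openin X V" "V \<subseteq> U"
  shows "restr F U V 0 = 0"
proof -
  have "\<forall>s\<in>sections F U. \<forall>t\<in>sections F U. restr F U V (s + t) = restr F U V s + restr F U V t"
    and "0 \<in> sections F U"
    using assms by (simp_all add: is_sheaf_def is_presheaf_def)
  then have "restr F U V (0 + 0) = restr F U V 0 + restr F U V 0" by blast
  then show ?thesis by simp
qed

text \<open>
That the image sheaf lies in the kernel follows from \<open>g \<circ> f = 0\<close> because \<open>H\<close> is separated: the section
\<open>g U s\<close> vanishes on an open cover.
\<close>

lemma exact_atI:
  assumes sh: "is_sheaf X F" "is_sheaf X G" "is_sheaf X H"
    and f: "sheaf_morphism X F G f" and g: "sheaf_morphism X G H g"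
    and comp: "\<And>V t. openin X V \<Longrightarrow> t \<in> sections F V \<Longrightarrow> g V (f V t) = 0"
    and lift: "\<And>U s p. openin X U \<Longrightarrow> s \<in> sections G U \<Longrightarrow> g U s = 0 \<Longrightarrow> p \<in> U \<Longrightarrow>
      \<exists>V. openin X V \<and> p \<in> V \<and> V \<subseteq> U \<and> restr G U V s \<in> f V ` sections F V"
  shows "exact_at X F f G g H"
  unfolding exact_at_def
proof (intro conjI sh f g allI impI equalityI subsetI)
  fix U s assume U: "openin X U"
  {
    assume s: "s \<in> image_sections X F G f U"
    then have sG: "s \<in> sections G U" by (simp add: image_sections_def)
    \<comment> \<open>The open sets over which \<open>s\<close> comes from \<open>F\<close> cover \<open>U\<close>.\<close>
    define \<U> where "\<U> = {V. openin X V \<and> V \<subseteq> U \<and> restr G U V s \<in> f V ` sections F V}"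
    have "\<exists>V\<in>\<U>. p \<in> V" if p: "p \<in> U" for p
    proof -
      have "\<exists>V. openin X V \<and> p \<in> V \<and> V \<subseteq> U \<and> restr G U V s \<in> f V ` sections F V"
        using s p by (simp add: image_sections_def)
      then show ?thesis unfolding \<U>_def by blast
    qed
    moreover have "\<Union>\<U> \<subseteq> U" unfolding \<U>_def by blast
    ultimately have cover: "\<Union>\<U> = U" by blast
    have V_open: "\<forall>V\<in>\<U>. openin X V" unfolding \<U>_def by blast
    have gs: "g U s \<in> sections H U" and z: "0 \<in> sections H U"
      using g sh(3) U sG by (simp_all add: sheaf_morphism_def is_sheaf_def is_presheaf_def)
    have "restr H U V (g U s) = restr H U V 0" if VU: "V \<in> \<U>" for V
    proof -
      have V: "openin X V" "V \<subseteq> U" using that by (auto simp: \<U>_def)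
      obtain t where t: "t \<in> sections F V" "restr G U V s = f V t"
        using VU unfolding \<U>_def by blast
      have "restr H U V (g U s) = g V (restr G U V s)"
        using g U V sG by (auto simp: sheaf_morphism_def)
      also have "\<dots> = 0" using comp[OF V(1) t(1)] t(2) by simp
      finally have "restr H U V (g U s) = 0" .
      then show ?thesis using sheaf_restr_0[OF sh(3) U V] by simp
    qed
    note eq = this
    have "g U s = 0"
      by (rule sheaf_separated[OF sh(3) V_open]) (simp_all add: cover gs z eq)
    then show "s \<in> kernel_sections G g U" using sG by (simp add: kernel_sections_def)
  }
  assume "s \<in> kernel_sections G g U"
  then show "s \<in> image_sections X F G f U"
    using lift[OF U] by (simp add: kernel_sections_def image_sections_def)
qed

text \<open>
Locally constant functions and forms are functions on the manifold (forms take the point as second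
argument), restricted by cutting off outside the smaller open set.  The map \<open>ev\<close> reads a section
as such a function, and \<open>mk\<close> is its inverse.  Sections can be glued as functions, so only a local
description of the sections is needed.
\<close>

lemma is_sheaf_of_functions:
  fixes F :: "('p, 's::ab_group_add) presheaf" and ev :: "'s \<Rightarrow> 'p \<Rightarrow> 'v::ab_group_add"
  assumes ev_mk: "\<And>f. ev (mk f) = f" and mk_ev: "\<And>s. mk (ev s) = s"
    and ev_add: "\<And>s t p. ev (s + t) p = ev s p + ev t p"
    and restr: "\<And>U V s. restr F U V s = mk (\<lambda>p. if p \<in> V then ev s p else 0)"
    and zero: "\<And>U. openin X U \<Longrightarrow> 0 \<in> sections F U"
    and add: "\<And>U s t. openin X U \<Longrightarrow> s \<in> sections F U \<Longrightarrow> t \<in> sections F U \<Longrightarrow> s + t \<in> sections F U"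
    and uminus: "\<And>U s. openin X U \<Longrightarrow> s \<in> sections F U \<Longrightarrow> - s \<in> sections F U"
    and supp: "\<And>U s p. s \<in> sections F U \<Longrightarrow> p \<notin> U \<Longrightarrow> ev s p = 0"
    and sub: "\<And>U V s. openin X U \<Longrightarrow> openin X V \<Longrightarrow> V \<subseteq> U \<Longrightarrow> s \<in> sections F U \<Longrightarrow> restr F U V s \<in> sections F V"
    and loc: "\<And>U s. openin X U \<Longrightarrow> (\<And>p. p \<notin> U \<Longrightarrow> ev s p = 0) \<Longrightarrow>
      (\<And>p. p \<in> U \<Longrightarrow> \<exists>V. openin X V \<and> p \<in> V \<and> V \<subseteq> U \<and> restr F U V s \<in> sections F V) \<Longrightarrow> s \<in> sections F U"
  shows "is_sheaf X F"
proof -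
  have eqI: "s = t" if "\<And>p. ev s p = ev t p" for s t
    using that mk_ev[of s] mk_ev[of t] by (metis ext)
  have ev_restr: "ev (restr F U V s) p = (if p \<in> V then ev s p else 0)" for U V s p
    by (simp add: restr ev_mk)
  show ?thesis
    unfolding is_sheaf_def
  proof (intro conjI allI impI ballI)
    show "is_presheaf X F"
      unfolding is_presheaf_def
      by (intro conjI allI impI ballI; (elim conjE)?)
        (auto intro!: zero add uminus sub eqI simp: ev_restr ev_add supp)
  next
    fix \<U> s t
    assume s: "s \<in> sections F (\<Union>\<U>)" "t \<in> sections F (\<Union>\<U>)"
      and e: "\<forall>U\<in>\<U>. restr F (\<Union>\<U>) U s = restr F (\<Union>\<U>) U t"
    show "s = t"
    proof (rule eqI)
      fix p
      show "ev s p = ev t p"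
      proof (cases "p \<in> \<Union>\<U>")
        case True
        then obtain U where U: "U \<in> \<U>" "p \<in> U" by blast
        from e U(1) have "ev (restr F (\<Union>\<U>) U s) p = ev (restr F (\<Union>\<U>) U t) p" by simp
        then show ?thesis using U(2) by (simp add: ev_restr)
      qed (use s supp in auto)
    qed
  next
    fix \<U> \<sigma>
    assume op: "\<forall>U\<in>\<U>. openin X U"
      and \<sigma>: "(\<forall>U\<in>\<U>. \<sigma> U \<in> sections F U) \<and>
        (\<forall>U\<in>\<U>. \<forall>V\<in>\<U>. restr F U (U \<inter> V) (\<sigma> U) = restr F V (U \<inter> V) (\<sigma> V))"
    define s where "s = mk (\<lambda>p. if p \<in> \<Union>\<U> then ev (\<sigma> (SOME U. U \<in> \<U> \<and> p \<in> U)) p else 0)"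
    have ev_s: "ev s p = ev (\<sigma> U) p" if U: "U \<in> \<U>" "p \<in> U" for U p
    proof -
      define V where "V = (SOME U. U \<in> \<U> \<and> p \<in> U)"
      have V: "V \<in> \<U>" "p \<in> V" unfolding V_def using someI[of "\<lambda>U. U \<in> \<U> \<and> p \<in> U" U] U by auto
      have "restr F U (U \<inter> V) (\<sigma> U) = restr F V (U \<inter> V) (\<sigma> V)"
        using \<sigma> U V by blast
      then have "ev (restr F U (U \<inter> V) (\<sigma> U)) p = ev (restr F V (U \<inter> V) (\<sigma> V)) p"
        by (rule arg_cong)
      then have "ev (\<sigma> U) p = ev (\<sigma> V) p" using U V by (simp add: ev_restr)
      then show ?thesis using U by (auto simp: s_def ev_mk V_def)
    qed
    have rs: "restr F (\<Union>\<U>) U s = \<sigma> U" if "U \<in> \<U>" for U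
      using that \<sigma> by (intro eqI) (auto simp: ev_restr ev_s supp)
    have "s \<in> sections F (\<Union>\<U>)"
    proof (rule loc)
      show "openin X (\<Union>\<U>)" using op by blast
      show "ev s p = 0" if "p \<notin> \<Union>\<U>" for p using that by (simp add: s_def ev_mk)
      show "\<exists>V. openin X V \<and> p \<in> V \<and> V \<subseteq> \<Union>\<U> \<and> restr F (\<Union>\<U>) V s \<in> sections F V" if "p \<in> \<Union>\<U>" for p
        using that op \<sigma> rs by (metis UnionE Union_upper)
    qed
    then show "\<exists>s\<in>sections F (\<Union>\<U>). \<forall>U\<in>\<U>. restr F (\<Union>\<U>) U s = \<sigma> U"
      using rs by blast
  qed
qed

lemma is_sheaf_zero_sheaf: "is_sheaf X zero_sheaf"
  by (simp add: is_sheaf_def is_presheaf_def zero_sheaf_def)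

lemma sheaf_morphism_from_zero:
  assumes "is_sheaf X G"
  shows "sheaf_morphism X zero_sheaf G zero_morphism"
  using assms sheaf_restr_0[OF assms]
  by (auto simp: sheaf_morphism_def zero_sheaf_def zero_morphism_def is_sheaf_def is_presheaf_def)

lemma sheaf_morphism_to_zero: "sheaf_morphism X F zero_sheaf zero_morphism"
  by (auto simp: sheaf_morphism_def zero_sheaf_def zero_morphism_def)

lemma sections_constant_sheaf:
  "s \<in> sections (constant_sheaf M) U \<longleftrightarrow> (\<forall>p. p \<notin> U \<longrightarrow> s p = 0) \<and>
    (\<forall>p\<in>U. \<exists>V. openin M V \<and> p \<in> V \<and> V \<subseteq> U \<and> (\<forall>q\<in>V. s q = s p))"
  by (simp add: constant_sheaf_def)

lemma locally_constant:
  assumes "s \<in> sections (constant_sheaf M) U" "p \<in> U"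
  shows "\<exists>V. openin M V \<and> p \<in> V \<and> V \<subseteq> U \<and> (\<forall>q\<in>V. s q = s p)"
  using assms by (simp add: sections_constant_sheaf)

lemma restr_constant_sheaf: "restr (constant_sheaf M) U V s = (\<lambda>p. if p \<in> V then s p else 0)"
  by (simp add: constant_sheaf_def)

lemma is_sheaf_constant_sheaf: "is_sheaf M (constant_sheaf M)"
proof (rule is_sheaf_of_functions[where ev = "\<lambda>s. s" and mk = "\<lambda>s. s"])
  fix U :: "'a set" and s t :: "'a \<Rightarrow> complex"
  assume s: "s \<in> sections (constant_sheaf M) U" "t \<in> sections (constant_sheaf M) U"
  have "\<exists>V. openin M V \<and> p \<in> V \<and> V \<subseteq> U \<and> (\<forall>q\<in>V. s q + t q = s p + t p)" if p: "p \<in> U" for p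
  proof -
    obtain V where V: "openin M V" "p \<in> V" "V \<subseteq> U" "\<forall>q\<in>V. s q = s p"
      using locally_constant[OF s(1) p] by (elim exE conjE) (rule that)
    obtain V' where V': "openin M V'" "p \<in> V'" "V' \<subseteq> U" "\<forall>q\<in>V'. t q = t p"
      using locally_constant[OF s(2) p] by (elim exE conjE) (rule that)
    show ?thesis
    proof (intro exI[of _ "V \<inter> V'"] conjI ballI)
      show "s q + t q = s p + t p" if "q \<in> V \<inter> V'" for q
        using that V(4) V'(4) by (intro arg_cong2[where f = "(+)"]) blast+
    qed (use V(1-3) V'(1-3) in auto)
  qed
  then show "s + t \<in> sections (constant_sheaf M) U"
    using s by (simp add: sections_constant_sheaf)
next
  fix U V and s :: "'a \<Rightarrow> complex"
  assume UV: "openin M V" "V \<subseteq> U" and s: "s \<in> sections (constant_sheaf M) U"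
  have "\<exists>V'. openin M V' \<and> p \<in> V' \<and> V' \<subseteq> V \<and> (\<forall>q\<in>V'. (if q \<in> V then s q else 0) = s p)" if p: "p \<in> V" for p
  proof -
    have "p \<in> U" using p UV by blast
    from locally_constant[OF s this]
    obtain V' where V': "openin M V'" "p \<in> V'" "V' \<subseteq> U" "\<forall>q\<in>V'. s q = s p"
      by (elim exE conjE) (rule that)
    show ?thesis
    proof (intro exI[of _ "V \<inter> V'"] conjI ballI)
      show "(if q \<in> V then s q else 0) = s p" if "q \<in> V \<inter> V'" for q
        using that bspec[OF V'(4), of q] by simp
    qed (use V'(1-3) UV p in auto)
  qed
  then show "restr (constant_sheaf M) U V s \<in> sections (constant_sheaf M) V"
    by (simp add: sections_constant_sheaf restr_constant_sheaf)
next
  fix U and s :: "'a \<Rightarrow> complex"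
  assume 0: "\<And>p. p \<notin> U \<Longrightarrow> s p = 0"
    and l: "\<And>p. p \<in> U \<Longrightarrow> \<exists>V. openin M V \<and> p \<in> V \<and> V \<subseteq> U \<and>
      restr (constant_sheaf M) U V s \<in> sections (constant_sheaf M) V"
  have "\<exists>V. openin M V \<and> p \<in> V \<and> V \<subseteq> U \<and> (\<forall>q\<in>V. s q = s p)" if p: "p \<in> U" for p
  proof -
    obtain V where V: "p \<in> V" "V \<subseteq> U" "restr (constant_sheaf M) U V s \<in> sections (constant_sheaf M) V"
      using l[OF p] by blast
    from locally_constant[OF V(3,1)]
    obtain V' where V': "openin M V'" "p \<in> V'" "V' \<subseteq> V"
        "\<forall>q\<in>V'. restr (constant_sheaf M) U V s q = restr (constant_sheaf M) U V s p"
      by (elim exE conjE) (rule that)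
    have const: "s q = s p" if "q \<in> V'" for q
    proof -
      have "q \<in> V" using that V'(3) by blast
      then show ?thesis using bspec[OF V'(4) that] V(1) by (simp add: restr_constant_sheaf)
    qed
    show ?thesis
      by (intro exI[of _ V'] conjI ballI const V'(1,2) subset_trans[OF V'(3) V(2)])
  qed
  then show "s \<in> sections (constant_sheaf M) U"
    using 0 by (simp add: sections_constant_sheaf)
next
  fix U and s :: "'a \<Rightarrow> complex"
  assume "s \<in> sections (constant_sheaf M) U"
  then show "- s \<in> sections (constant_sheaf M) U"
    by (simp add: sections_constant_sheaf)
qed (auto simp: sections_constant_sheaf restr_constant_sheaf)

section \<open>Charts and forms on a complex manifold\<close>

abbreviation chart_image :: "'a chart \<Rightarrow> 'a set \<Rightarrow> (nat \<Rightarrow> complex) set" where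
  "chart_image c U \<equiv> coord c ` (U \<inter> cdom c)"

abbreviation local_expr :: "'a chart \<Rightarrow> 'a form \<Rightarrow> (nat \<Rightarrow> complex) \<Rightarrow> (nat \<Rightarrow> complex) list \<Rightarrow> complex" where
  "local_expr c \<omega> \<equiv> \<lambda>z. \<omega> c (chart_inv c z)"

abbreviation transition :: "'a chart \<Rightarrow> 'a chart \<Rightarrow> (nat \<Rightarrow> complex) \<Rightarrow> nat \<Rightarrow> complex" where
  "transition c c' \<equiv> \<lambda>z. coord c' (chart_inv c z)"

lemma transition_deriv_jacobian: "transition_deriv n c c' p = jacobian n (transition c c') (coord c p)"
  by (auto simp: transition_deriv_def jacobian_def dir_deriv_def fun_eq_iff)

lemma jacobian_cong:
  "copen n W \<Longrightarrow> (\<And>z. z \<in> W \<Longrightarrow> \<phi> z = \<psi> z) \<Longrightarrow> z \<in> W \<Longrightarrow> jacobian n \<phi> z v = jacobian n \<psi> z v"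
  unfolding jacobian_def by (intro ext if_cong refl dir_deriv_cong[of n W]) auto

lemma ext_deriv_local_d:
  "ext_deriv n \<A> U \<omega> c p vs =
    (if c \<in> \<A> \<and> p \<in> U \<inter> cdom c then local_d n (local_expr c \<omega>) (coord c p) vs else 0)"
  by (auto simp: ext_deriv_def local_d_def dir_deriv_def remove_nth_def)

lemma restr_Omega: "restr (Omega_an n \<A> k) U V \<omega> c p vs = (if p \<in> V then \<omega> c p vs else 0)"
  by (simp add: Omega_an_def)

lemma sections_Omega: "sections (Omega_an n \<A> k) = holo_forms n \<A> k"
  by (simp add: Omega_an_def)

context
  fixes n :: nat and M :: "'a topology" and \<A> :: "'a chart set"
  assumes M: "complex_manifold n M \<A>"
begin

lemma chart: "c \<in> \<A> \<Longrightarrow> is_chart n M c"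
  using M by (simp add: complex_manifold_def)

lemma cdom_open: "c \<in> \<A> \<Longrightarrow> openin M (cdom c)"
  using chart by (simp add: is_chart_def)

lemma chart_inj: "c \<in> \<A> \<Longrightarrow> inj_on (coord c) (cdom c)"
  using chart[of c] cdom_open[of c, THEN openin_subset] homeomorphic_imp_injective_map
  by (fastforce simp: is_chart_def topspace_subtopology Int_absorb1)

lemma chart_inv_coord: "c \<in> \<A> \<Longrightarrow> p \<in> cdom c \<Longrightarrow> chart_inv c (coord c p) = p"
  using chart_inj by (simp add: inv_into_f_f)

lemma ex_chart:
  assumes "openin M U" "p \<in> U" obtains c where "c \<in> \<A>" "p \<in> cdom c"
proof -
  have "p \<in> (\<Union>c\<in>\<A>. cdom c)"
    using M openin_subset[OF assms(1)] assms(2) by (auto simp: complex_manifold_def)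
  then show ?thesis using that by blast
qed

lemma chart_image_open:
  assumes c: "c \<in> \<A>" and U: "openin M U"
  shows "copen n (chart_image c U)"
proof -
  have h: "homeomorphic_map (subtopology M (cdom c)) (top_of_set (coord c ` cdom c)) (coord c)"
    and o: "copen n (coord c ` cdom c)"
    using chart[OF c] by (auto simp: is_chart_def)
  have "openin (subtopology M (cdom c)) (U \<inter> cdom c)"
    using U by (auto simp: openin_subtopology)
  then have "openin (top_of_set (coord c ` cdom c)) (chart_image c U)"
    using homeomorphic_imp_open_map[OF h] by (simp add: open_map_def)
  then show ?thesis using o openin_trans by blast
qed

lemma chart_preimage_open:
  assumes c: "c \<in> \<A>" and W: "copen n W"
  shows "openin M {q \<in> cdom c. coord c q \<in> W}"
proof -
  have h: "homeomorphic_map (subtopology M (cdom c)) (top_of_set (coord c ` cdom c)) (coord c)"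
    and o: "copen n (coord c ` cdom c)"
    using chart[OF c] by (auto simp: is_chart_def)
  have s: "cdom c \<subseteq> topspace M" using cdom_open[OF c] openin_subset by blast
  have "openin (top_of_set (coord c ` cdom c)) (coord c ` cdom c \<inter> W)"
    using W o by (auto simp: openin_open)
  then have "openin (subtopology M (cdom c)) {q \<in> topspace (subtopology M (cdom c)). coord c q \<in> coord c ` cdom c \<inter> W}"
    using homeomorphic_imp_continuous_map[OF h] openin_continuous_map_preimage by blast
  moreover have "{q \<in> topspace (subtopology M (cdom c)). coord c q \<in> coord c ` cdom c \<inter> W} = {q \<in> cdom c. coord c q \<in> W}"
    using s by auto
  ultimately show ?thesis using cdom_open[OF c] openin_trans_full by metis
qed

text \<open>
Local arguments take place on these open sets, which a chart identifies with a polydisc.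
\<close>

lemma chart_polydisc:
  assumes c: "c \<in> \<A>" and U: "openin M U" and p: "p \<in> U" "p \<in> cdom c"
  obtains r V where "r > 0" "openin M V" "p \<in> V" "V \<subseteq> U" "V \<subseteq> cdom c"
    "chart_image c V = polydisc n (coord c p) r" "coord c p \<in> cspace n"
proof -
  have "coord c p \<in> chart_image c U" using p by blast
  with ex_polydisc_subset[OF chart_image_open[OF c U]]
  obtain r where r: "r > 0" "polydisc n (coord c p) r \<subseteq> chart_image c U" by blast
  define V where "V = {q \<in> cdom c. coord c q \<in> polydisc n (coord c p) r}"
  have a: "coord c p \<in> cspace n"
    using copen_subset[OF chart_image_open[OF c U]] p by blast
  show ?thesis
  proof (rule that[OF r(1), of V])
    show "openin M V" unfolding V_def by (rule chart_preimage_open[OF c copen_polydisc])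
    show "p \<in> V" using p center_in_polydisc[OF a r(1)] by (simp add: V_def)
    show "V \<subseteq> U"
    proof
      fix q assume "q \<in> V"
      then have q: "q \<in> cdom c" "coord c q \<in> chart_image c U" using r(2) by (auto simp: V_def)
      then obtain q' where "q' \<in> U" "q' \<in> cdom c" "coord c q = coord c q'" by auto
      with q chart_inj[OF c] show "q \<in> U" by (metis inj_onD)
    qed
    show "chart_image c V = polydisc n (coord c p) r"
      using r(2) by (auto simp: V_def)
  qed (use a in \<open>auto simp: V_def\<close>)
qed

lemma transition_holo_map:
  assumes c: "c \<in> \<A>" "c' \<in> \<A>"
  shows "holo_map n (transition c c') (chart_image c (U \<inter> cdom c')) (chart_image c' (U \<inter> cdom c))"
proof -
  have "holo n (\<lambda>z. transition c c' z i) (coord c ` (cdom c \<inter> cdom c'))" if "i < n" for i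
    using M c that by (simp add: complex_manifold_def)
  then have "holo n (\<lambda>z. transition c c' z i) (chart_image c (U \<inter> cdom c'))" if "i < n" for i
    by (rule holo_subset) (use that in auto)
  then show ?thesis using chart_inv_coord[OF c(1)] by (auto simp: holo_map_def)
qed

lemma transition_deriv_refl:
  assumes c: "c \<in> \<A>" and p: "p \<in> cdom c" and v: "v \<in> cspace n"
  shows "transition_deriv n c c p v = v"
proof -
  have "transition_deriv n c c p v = jacobian n (\<lambda>z. z) (coord c p) v"
    unfolding transition_deriv_jacobian
    by (rule jacobian_cong[OF chart_image_open[OF c cdom_open[OF c]]]) (use p chart_inv_coord[OF c] in auto)
  also have "\<dots> = v"
    using v by (auto simp: jacobian_def dir_deriv_coord cspace_def)
  finally show ?thesis .
qed

text \<open>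
The chain rule for the coordinate changes: the cocycle condition under which a form given in one chart
extends to the others.
\<close>

lemma transition_deriv_compose:
  assumes c: "c \<in> \<A>" "c' \<in> \<A>" "c'' \<in> \<A>" and p: "p \<in> cdom c" "p \<in> cdom c'" "p \<in> cdom c''"
  shows "transition_deriv n c c'' p v = transition_deriv n c' c'' p (transition_deriv n c c' p v)"
proof -
  let ?W = "chart_image c (cdom c'' \<inter> cdom c')" and ?W' = "chart_image c' (cdom c'' \<inter> cdom c)"
  have W: "copen n ?W" by (intro chart_image_open c openin_Int cdom_open)
  have "copen n ?W'" by (intro chart_image_open c openin_Int cdom_open)
  moreover have "?W' = chart_image c' (cdom c \<inter> cdom c'')" by (simp add: Int_commute)
  ultimately have W': "copen n ?W'" "holo_map n (transition c' c'') ?W' (chart_image c'' (cdom c \<inter> cdom c'))"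
    using transition_holo_map[OF c(2,3), of "cdom c"] by simp_all
  have p': "coord c p \<in> ?W" using p by blast
  have "jacobian n (transition c c'') (coord c p) v = jacobian n (\<lambda>z. transition c' c'' (transition c c' z)) (coord c p) v"
    by (rule jacobian_cong[OF W _ p']) (auto simp: chart_inv_coord c)
  also have "\<dots> = jacobian n (transition c' c'') (transition c c' (coord c p)) (jacobian n (transition c c') (coord c p) v)"
    by (rule jacobian_compose[OF W W'(1) transition_holo_map[OF c(1,2)] W'(2) p'])
  finally show ?thesis
    by (simp add: transition_deriv_jacobian chart_inv_coord c p)
qed

lemma transition_deriv_in_cspace: "transition_deriv n c c' p v \<in> cspace n"
  by (simp add: transition_deriv_jacobian)

lemma map_transition_tuples: "vs \<in> tuples n k \<Longrightarrow> map (transition_deriv n c c' p) vs \<in> tuples n k"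
  by (auto simp: tuples_def transition_deriv_in_cspace)

lemma form_off:
  assumes "\<omega> \<in> holo_forms n \<A> k U" "\<not> (c \<in> \<A> \<and> p \<in> U \<inter> cdom c)"
  shows "\<omega> c p vs = 0"
proof -
  have "\<omega> c p = (\<lambda>vs. 0)"
    using assms unfolding holo_forms_def mem_Collect_eq by blast
  then show ?thesis by simp
qed

lemma form_alt: "\<omega> \<in> holo_forms n \<A> k U \<Longrightarrow> c \<in> \<A> \<Longrightarrow> p \<in> U \<Longrightarrow> p \<in> cdom c \<Longrightarrow> \<omega> c p \<in> alternating_forms n k"
  by (simp add: holo_forms_def)

lemma form_off_tuples: "\<omega> \<in> holo_forms n \<A> k U \<Longrightarrow> vs \<notin> tuples n k \<Longrightarrow> \<omega> c p vs = 0"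
  using form_off[of \<omega> k U c p vs] form_alt[of \<omega> k U c p] alt_outside by blast

lemma form_compat:
  assumes "\<omega> \<in> holo_forms n \<A> k U" "c \<in> \<A>" "c' \<in> \<A>" "p \<in> U" "p \<in> cdom c" "p \<in> cdom c'"
    "vs \<in> tuples n k"
  shows "\<omega> c p vs = \<omega> c' p (map (transition_deriv n c c' p) vs)"
proof -
  have "\<forall>c\<in>\<A>. \<forall>c'\<in>\<A>. \<forall>p\<in>U \<inter> cdom c \<inter> cdom c'. \<forall>vs\<in>tuples n k.
      \<omega> c p vs = \<omega> c' p (map (transition_deriv n c c' p) vs)"
    using assms(1) unfolding holo_forms_def mem_Collect_eq by (elim conjE)
  then show ?thesis using assms(2-) by blast
qed

lemma local_form_local_expr:
  assumes "\<omega> \<in> holo_forms n \<A> k U" "c \<in> \<A>"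
  shows "local_form n k (chart_image c U) (local_expr c \<omega>)"
  using assms chart_inv_coord[OF assms(2)] by (auto simp: local_form_def holo_forms_def)

text \<open>
Holomorphy only has to be checked near each point, and any family \<open>\<eta>\<close> of forms on \<open>\<complex>\<^sup>n\<close> that represents
\<open>\<omega>\<close> there may be used.
\<close>

lemma holo_formsI:
  assumes U: "openin M U"
    and off: "\<And>c p vs. \<not> (c \<in> \<A> \<and> p \<in> U \<inter> cdom c) \<Longrightarrow> \<omega> c p vs = 0"
    and lf: "\<And>c p. c \<in> \<A> \<Longrightarrow> p \<in> U \<Longrightarrow> p \<in> cdom c \<Longrightarrow>
      \<exists>V \<eta>. openin M V \<and> p \<in> V \<and> local_form n k (chart_image c V) \<eta> \<and>
        (\<forall>q\<in>V \<inter> cdom c. \<omega> c q = \<eta> (coord c q))"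
    and compat: "\<And>c c' p vs. c \<in> \<A> \<Longrightarrow> c' \<in> \<A> \<Longrightarrow> p \<in> U \<Longrightarrow> p \<in> cdom c \<Longrightarrow> p \<in> cdom c' \<Longrightarrow>
      vs \<in> tuples n k \<Longrightarrow> \<omega> c p vs = \<omega> c' p (map (transition_deriv n c c' p) vs)"
  shows "\<omega> \<in> holo_forms n \<A> k U"
  unfolding holo_forms_def
proof (intro CollectI conjI allI ballI impI)
  show "\<omega> c p = (\<lambda>vs. 0)" if "\<not> (c \<in> \<A> \<and> p \<in> U \<inter> cdom c)" for c p
    using off[OF that] by auto
  show "\<omega> c p \<in> alternating_forms n k" if c: "c \<in> \<A>" and p: "p \<in> U \<inter> cdom c" for c p
  proof -
    obtain V \<eta> where V: "p \<in> V" "local_form n k (chart_image c V) \<eta>" "\<forall>q\<in>V \<inter> cdom c. \<omega> c q = \<eta> (coord c q)"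
      using lf[OF c, of p] p by blast
    then have "\<omega> c p = \<eta> (coord c p)" "coord c p \<in> chart_image c V" using p by auto
    then show ?thesis using local_form_alt[OF V(2)] by simp
  qed
  show "holo n (\<lambda>z. \<omega> c (chart_inv c z) vs) (chart_image c U)" if c: "c \<in> \<A>" for c vs
  proof (rule holo_local)
    fix z assume "z \<in> chart_image c U"
    then obtain p where p: "p \<in> U" "p \<in> cdom c" "z = coord c p" by auto
    obtain V \<eta> where V: "openin M V" "p \<in> V" "local_form n k (chart_image c V) \<eta>"
      and e: "\<forall>q\<in>V \<inter> cdom c. \<omega> c q = \<eta> (coord c q)"
      using lf[OF c p(1,2)] by blast
    have o: "copen n (chart_image c V)" by (rule chart_image_open[OF c V(1)])
    have "holo n (\<lambda>z. \<omega> c (chart_inv c z) vs) (chart_image c V)"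
      by (rule holo_cong[OF o _ local_form_holo[OF o V(3), of vs]])
        (use e in \<open>auto simp: chart_inv_coord c\<close>)
    then show "\<exists>V. copen n V \<and> z \<in> V \<and> holo n (\<lambda>z. \<omega> c (chart_inv c z) vs) V"
      using o p V(2) by blast
  qed
  show "\<omega> c p vs = \<omega> c' p (map (transition_deriv n c c' p) vs)"
    if "c \<in> \<A>" "c' \<in> \<A>" "p \<in> U \<inter> cdom c \<inter> cdom c'" "vs \<in> tuples n k" for c c' p vs
    by (rule compat) (use that in auto)
qed

text \<open>
The transformation rule determines a form on the domain of one chart by its expression in that chart.
\<close>

lemma holo_forms_eqI:
  assumes \<omega>: "\<omega> \<in> holo_forms n \<A> k V" "\<eta> \<in> holo_forms n \<A> k V" and c: "c \<in> \<A>" "V \<subseteq> cdom c"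
    and eq: "\<And>p vs. p \<in> V \<Longrightarrow> vs \<in> tuples n k \<Longrightarrow> \<omega> c p vs = \<eta> c p vs"
  shows "\<omega> = \<eta>"
proof (intro ext)
  fix c' p vs
  show "\<omega> c' p vs = \<eta> c' p vs"
  proof (cases "c' \<in> \<A> \<and> p \<in> V \<inter> cdom c' \<and> vs \<in> tuples n k")
    case True
    then have p: "c' \<in> \<A>" "p \<in> V" "p \<in> cdom c'" "p \<in> cdom c" "vs \<in> tuples n k" using c by auto
    show ?thesis
      using form_compat[OF \<omega>(1) p(1) c(1) p(2,3,4,5)] form_compat[OF \<omega>(2) p(1) c(1) p(2,3,4,5)]
        eq[OF p(2) map_transition_tuples[OF p(5)]] by simp
  next
    case False
    then show ?thesis using form_off[OF \<omega>(1)] form_off[OF \<omega>(2)] form_off_tuples[OF \<omega>(1)] form_off_tuples[OF \<omega>(2)]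
      by (metis)
  qed
qed

lemma restr_form:
  assumes "openin M U" "openin M V" "V \<subseteq> U" "\<omega> \<in> holo_forms n \<A> k U"
  shows "restr (Omega_an n \<A> k) U V \<omega> \<in> holo_forms n \<A> k V"
proof (rule holo_formsI[OF assms(2)])
  fix c p assume c: "c \<in> \<A>" and p: "p \<in> V" "p \<in> cdom c"
  show "\<exists>V' \<eta>. openin M V' \<and> p \<in> V' \<and> local_form n k (chart_image c V') \<eta> \<and>
        (\<forall>q\<in>V' \<inter> cdom c. restr (Omega_an n \<A> k) U V \<omega> c q = \<eta> (coord c q))"
    using assms p local_form_subset[OF local_form_local_expr[OF assms(4) c], of "chart_image c V"]
    by (intro exI[of _ V] exI[of _ "local_expr c \<omega>"])
      (auto simp: fun_eq_iff restr_Omega chart_inv_coord[OF c])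
next
  fix c c' p vs
  assume h: "c \<in> \<A>" "c' \<in> \<A>" "p \<in> V" "p \<in> cdom c" "p \<in> cdom c'" "vs \<in> tuples n k"
  then have "p \<in> U" using assms(3) by blast
  then show "restr (Omega_an n \<A> k) U V \<omega> c p vs = restr (Omega_an n \<A> k) U V \<omega> c' p (map (transition_deriv n c c' p) vs)"
    unfolding restr_Omega using form_compat[OF assms(4) h(1,2) _ h(4-6)] h(3) by (simp only: if_True)
qed (use form_off[OF assms(4)] assms(3) in \<open>auto simp: restr_Omega\<close>)

lemma local_form_lincomb:
  assumes W: "copen n W" and \<omega>: "local_form n k W \<omega>" and \<eta>: "local_form n k W \<eta>"
  shows "local_form n k W (\<lambda>z vs. a * \<omega> z vs + b * \<eta> z vs)"
  unfolding local_form_def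
proof (intro conjI ballI)
  fix z assume z: "z \<in> W"
  note alt = local_form_alt[OF \<omega> z] local_form_alt[OF \<eta> z]
  show "(\<lambda>vs. a * \<omega> z vs + b * \<eta> z vs) \<in> alternating_forms n k"
    by (rule alternating_formsI)
      (simp_all add: alt_outside[OF alt(1)] alt_outside[OF alt(2)] alt_adjacent[OF alt(1)] alt_adjacent[OF alt(2)]
        alt_lin[OF alt(1)] alt_lin[OF alt(2)] ring_distribs mult_ac)
qed (intro holo_add holo_mult holo_const local_form_holo[OF W \<omega>] local_form_holo[OF W \<eta>])

lemma holo_forms_lincomb:
  assumes U: "openin M U" and \<omega>: "\<omega> \<in> holo_forms n \<A> k U" and \<eta>: "\<eta> \<in> holo_forms n \<A> k U"
  shows "(\<lambda>c p vs. a * \<omega> c p vs + b * \<eta> c p vs) \<in> holo_forms n \<A> k U"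
proof (rule holo_formsI[OF U])
  fix c p assume c: "c \<in> \<A>" and p: "p \<in> U" "p \<in> cdom c"
  show "\<exists>V \<zeta>. openin M V \<and> p \<in> V \<and> local_form n k (chart_image c V) \<zeta> \<and>
        (\<forall>q\<in>V \<inter> cdom c. (\<lambda>vs. a * \<omega> c q vs + b * \<eta> c q vs) = \<zeta> (coord c q))"
    using local_form_lincomb[OF chart_image_open[OF c U] local_form_local_expr[OF \<omega> c] local_form_local_expr[OF \<eta> c], of a b] U p
    by (intro exI conjI) (auto simp: chart_inv_coord[OF c])
next
  fix c c' p vs
  assume "c \<in> \<A>" "c' \<in> \<A>" "p \<in> U" "p \<in> cdom c" "p \<in> cdom c'" "vs \<in> tuples n k"
  from form_compat[OF \<omega> this] form_compat[OF \<eta> this]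
  show "a * \<omega> c p vs + b * \<eta> c p vs =
    a * \<omega> c' p (map (transition_deriv n c c' p) vs) + b * \<eta> c' p (map (transition_deriv n c c' p) vs)" by (simp only:)
qed (use form_off[OF \<omega>] form_off[OF \<eta>] in auto)

lemma is_sheaf_Omega: "is_sheaf M (Omega_an n \<A> k)"
proof (rule is_sheaf_of_functions[where ev = "\<lambda>\<omega> p c. \<omega> c p" and mk = "\<lambda>f c p. f p c"])
  fix U and s t :: "'a form" assume U: "openin M U"
  have "(\<lambda>c p vs. 0) \<in> holo_forms n \<A> k U"
    by (rule holo_formsI[OF U])
      (auto intro!: exI[of _ U] exI[of _ "\<lambda>z vs. 0"] simp: U local_form_def alternating_forms_def holo_const)
  then show "0 \<in> sections (Omega_an n \<A> k) U"
    by (simp add: sections_Omega zero_fun_def)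
  assume s: "s \<in> sections (Omega_an n \<A> k) U"
  then show "- s \<in> sections (Omega_an n \<A> k) U"
    using holo_forms_lincomb[OF U, of s k s "- 1" 0] by (simp add: sections_Omega fun_Compl_def)
  assume "t \<in> sections (Omega_an n \<A> k) U"
  with s show "s + t \<in> sections (Omega_an n \<A> k) U"
    using holo_forms_lincomb[OF U, of s k t 1 1] by (simp add: sections_Omega plus_fun_def)
next
  fix U V and s :: "'a form" assume "openin M U" "openin M V" "V \<subseteq> U" "s \<in> sections (Omega_an n \<A> k) U"
  then show "restr (Omega_an n \<A> k) U V s \<in> sections (Omega_an n \<A> k) V"
    using restr_form by (simp add: sections_Omega)
next
  fix U and s :: "'a form"
  assume U: "openin M U" and 0: "\<And>p. p \<notin> U \<Longrightarrow> (\<lambda>c. s c p) = 0"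
    and l: "\<And>p. p \<in> U \<Longrightarrow> \<exists>V. openin M V \<and> p \<in> V \<and> V \<subseteq> U \<and>
      restr (Omega_an n \<A> k) U V s \<in> sections (Omega_an n \<A> k) V"
  have l': "\<exists>V \<eta>. openin M V \<and> p \<in> V \<and> V \<subseteq> U \<and> \<eta> \<in> holo_forms n \<A> k V \<and> (\<forall>q\<in>V. \<forall>c. s c q = \<eta> c q)"
    if p: "p \<in> U" for p
  proof -
    obtain V where V: "openin M V" "p \<in> V" "V \<subseteq> U" "restr (Omega_an n \<A> k) U V s \<in> holo_forms n \<A> k V"
      using l[OF p] by (auto simp: sections_Omega)
    then show ?thesis
      by (intro exI[of _ V] exI[of _ "restr (Omega_an n \<A> k) U V s"]) (auto simp: fun_eq_iff restr_Omega)
  qed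
  have "s \<in> holo_forms n \<A> k U"
  proof (rule holo_formsI[OF U])
    fix c p vs assume n: "\<not> (c \<in> \<A> \<and> p \<in> U \<inter> cdom c)"
    show "s c p vs = 0"
    proof (cases "p \<in> U")
      case True
      then obtain V \<eta> where V: "V \<subseteq> U" "\<eta> \<in> holo_forms n \<A> k V" "s c p = \<eta> c p"
        using l'[of p] by blast
      then show ?thesis using n form_off[OF V(2), of c p vs] by auto
    next
      case False
      from fun_cong[OF 0[OF this], of c] show ?thesis by simp
    qed
  next
    fix c p assume c: "c \<in> \<A>" and p: "p \<in> U" "p \<in> cdom c"
    obtain V \<eta> where V: "openin M V" "p \<in> V" "\<eta> \<in> holo_forms n \<A> k V" "\<forall>q\<in>V. \<forall>c. s c q = \<eta> c q"
      using l'[OF p(1)] by blast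
    have "s c q = local_expr c \<eta> (coord c q)" if "q \<in> V \<inter> cdom c" for q
      using V(4) that by (simp add: chart_inv_coord[OF c] del: split_paired_All)
    then show "\<exists>V \<eta>. openin M V \<and> p \<in> V \<and> local_form n k (chart_image c V) \<eta> \<and> (\<forall>q\<in>V \<inter> cdom c. s c q = \<eta> (coord c q))"
      using local_form_local_expr[OF V(3) c] V(1,2) by blast
  next
    fix c c' p vs
    assume a: "c \<in> \<A>" "c' \<in> \<A>" "p \<in> U" "p \<in> cdom c" "p \<in> cdom c'" "vs \<in> tuples n k"
    obtain V \<eta> where V: "p \<in> V" "\<eta> \<in> holo_forms n \<A> k V" "\<forall>q\<in>V. \<forall>c. s c q = \<eta> c q"
      using l'[OF a(3)] by blast
    then show "s c p vs = s c' p (map (transition_deriv n c c' p) vs)"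
      using form_compat[OF V(2) a(1,2) V(1) a(4,5,6)] by metis
  qed
  then show "s \<in> sections (Omega_an n \<A> k) U" by (simp add: sections_Omega)
qed (auto simp: fun_eq_iff restr_Omega sections_Omega form_off)

section \<open>The exterior derivative on a complex manifold\<close>

text \<open>
In the coordinates of \<open>c\<close>, the form is the pullback of its expression in the coordinates of \<open>c'\<close> along
the coordinate change, and \<open>d\<close> commutes with pullback.
\<close>

lemma ext_deriv_form:
  assumes U: "openin M U" and \<omega>: "\<omega> \<in> holo_forms n \<A> k U"
  shows "ext_deriv n \<A> U \<omega> \<in> holo_forms n \<A> (Suc k) U"
proof (rule holo_formsI[OF U])
  fix c p assume c: "c \<in> \<A>" and p: "p \<in> U" "p \<in> cdom c"
  have "ext_deriv n \<A> U \<omega> c q = local_d n (local_expr c \<omega>) (coord c q)" if "q \<in> U \<inter> cdom c" for q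
    using c that by (intro ext) (simp add: ext_deriv_local_d)
  then show "\<exists>V \<eta>. openin M V \<and> p \<in> V \<and> local_form n (Suc k) (chart_image c V) \<eta> \<and>
      (\<forall>q\<in>V \<inter> cdom c. ext_deriv n \<A> U \<omega> c q = \<eta> (coord c q))"
    using local_form_local_d[OF chart_image_open[OF c U] local_form_local_expr[OF \<omega> c]] U p by blast
next
  fix c c' p vs
  assume c: "c \<in> \<A>" "c' \<in> \<A>" and p: "p \<in> U" "p \<in> cdom c" "p \<in> cdom c'" and vs: "vs \<in> tuples n (Suc k)"
  let ?W = "chart_image c (U \<inter> cdom c')" and ?W' = "chart_image c' (U \<inter> cdom c)"
  have W: "copen n ?W" "copen n ?W'"
    by (intro chart_image_open c openin_Int U cdom_open)+
  have p': "coord c p \<in> ?W" using p by blast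
  have lf: "local_form n k ?W' (local_expr c' \<omega>)"
    by (rule local_form_subset[OF local_form_local_expr[OF \<omega> c(2)]]) auto
  have "local_d n (local_expr c \<omega>) (coord c p) vs =
      local_d n (pullback n k (transition c c') (local_expr c' \<omega>)) (coord c p) vs"
  proof (rule local_d_cong[OF W(1) _ p'])
    fix z us assume "z \<in> ?W"
    then obtain q where q: "q \<in> U" "q \<in> cdom c" "q \<in> cdom c'" "z = coord c q" by auto
    show "local_expr c \<omega> z us = pullback n k (transition c c') (local_expr c' \<omega>) z us"
    proof (cases "us \<in> tuples n k")
      case True
      have "\<omega> c q us = \<omega> c' q (map (transition_deriv n c c' q) us)"
        by (rule form_compat[OF \<omega> c q(1-3) True])
      then show ?thesis
        using True by (simp only: pullback_def if_True q(4) chart_inv_coord[OF c(1) q(2)]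
            chart_inv_coord[OF c(2) q(3)] transition_deriv_jacobian)
    qed (simp add: pullback_def form_off_tuples[OF \<omega>])
  qed
  also have "\<dots> = local_d n (local_expr c' \<omega>) (transition c c' (coord c p)) (map (jacobian n (transition c c') (coord c p)) vs)"
    by (rule local_d_pullback[OF W transition_holo_map[OF c] lf p' vs])
  finally show "ext_deriv n \<A> U \<omega> c p vs = ext_deriv n \<A> U \<omega> c' p (map (transition_deriv n c c' p) vs)"
    using c p by (simp add: ext_deriv_local_d transition_deriv_jacobian chart_inv_coord)
qed (auto simp: ext_deriv_local_d)

lemma ext_deriv_restr:
  assumes U: "openin M U" "openin M V" "V \<subseteq> U" and \<omega>: "\<omega> \<in> holo_forms n \<A> k U"
  shows "ext_deriv n \<A> V (restr (Omega_an n \<A> k) U V \<omega>) =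
    restr (Omega_an n \<A> l) U V (ext_deriv n \<A> U \<omega>)"
proof (intro ext)
  fix c p vs
  show "ext_deriv n \<A> V (restr (Omega_an n \<A> k) U V \<omega>) c p vs =
    restr (Omega_an n \<A> l) U V (ext_deriv n \<A> U \<omega>) c p vs"
  proof (cases "c \<in> \<A> \<and> p \<in> V \<inter> cdom c")
    case True
    then have c: "c \<in> \<A>" and p: "coord c p \<in> chart_image c V" "p \<in> V" "p \<in> U" "p \<in> cdom c"
      using U(3) by auto
    have "local_d n (local_expr c (restr (Omega_an n \<A> k) U V \<omega>)) (coord c p) vs = local_d n (local_expr c \<omega>) (coord c p) vs"
      by (rule local_d_cong[OF chart_image_open[OF c U(2)] _ p(1)]) (auto simp: restr_Omega chart_inv_coord[OF c])
    then show ?thesis using c p by (simp add: ext_deriv_local_d restr_Omega)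
  qed (auto simp: ext_deriv_local_d restr_Omega)
qed

lemma ext_deriv_add:
  assumes U: "openin M U" and \<omega>: "\<omega> \<in> holo_forms n \<A> k U" and \<eta>: "\<eta> \<in> holo_forms n \<A> k U"
  shows "ext_deriv n \<A> U (\<omega> + \<eta>) = ext_deriv n \<A> U \<omega> + ext_deriv n \<A> U \<eta>"
proof (intro ext)
  fix c p vs
  show "ext_deriv n \<A> U (\<omega> + \<eta>) c p vs = (ext_deriv n \<A> U \<omega> + ext_deriv n \<A> U \<eta>) c p vs"
  proof (cases "c \<in> \<A> \<and> p \<in> U \<inter> cdom c")
    case True
    then have c: "c \<in> \<A>" and p: "coord c p \<in> chart_image c U" by auto
    note W = chart_image_open[OF c U]
    note h = local_form_holo[OF W local_form_local_expr[OF \<omega> c]] local_form_holo[OF W local_form_local_expr[OF \<eta> c]]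
    show ?thesis
      using True by (simp add: ext_deriv_local_d local_d_def dir_deriv_add[OF h p] ring_distribs sum.distrib)
  qed (auto simp: ext_deriv_local_d)
qed

lemma sheaf_morphism_ext_deriv:
  "sheaf_morphism M (Omega_an n \<A> k) (Omega_an n \<A> (Suc k)) (ext_deriv n \<A>)"
  unfolding sheaf_morphism_def sections_Omega
  by (intro conjI allI impI ballI; (elim conjE)?) (simp_all add: ext_deriv_form ext_deriv_add ext_deriv_restr)

lemma ext_deriv_ext_deriv:
  assumes U: "openin M U" and \<omega>: "\<omega> \<in> holo_forms n \<A> k U"
  shows "ext_deriv n \<A> U (ext_deriv n \<A> U \<omega>) = 0"
proof (intro ext)
  fix c p vs
  show "ext_deriv n \<A> U (ext_deriv n \<A> U \<omega>) c p vs = 0 c p vs"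
  proof (cases "c \<in> \<A> \<and> p \<in> U \<inter> cdom c")
    case True
    then have c: "c \<in> \<A>" and p: "coord c p \<in> chart_image c U" by auto
    note W = chart_image_open[OF c U]
    have "local_d n (local_expr c (ext_deriv n \<A> U \<omega>)) (coord c p) vs = local_d n (local_d n (local_expr c \<omega>)) (coord c p) vs"
      by (rule local_d_cong[OF W _ p]) (use c in \<open>auto simp: ext_deriv_local_d chart_inv_coord\<close>)
    then show ?thesis
      using True local_d_local_d[OF W local_form_local_expr[OF \<omega> c] p] by (simp add: ext_deriv_local_d)
  qed (auto simp: ext_deriv_local_d)
qed

lemma ext_deriv_top:
  assumes U: "openin M U" and \<omega>: "\<omega> \<in> holo_forms n \<A> n U"
  shows "ext_deriv n \<A> U \<omega> = 0"
proof (intro ext)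
  fix c p vs
  have f: "ext_deriv n \<A> U \<omega> \<in> holo_forms n \<A> (Suc n) U" by (rule ext_deriv_form[OF U \<omega>])
  show "ext_deriv n \<A> U \<omega> c p vs = 0 c p vs"
    using form_off[OF f, of c p vs] alternating_forms_above_dim[OF form_alt[OF f, of c p], of vs]
    by (cases "c \<in> \<A> \<and> p \<in> U \<inter> cdom c") auto
qed

lemma local_d_eq_0:
  assumes U: "openin M U" and \<omega>: "ext_deriv n \<A> U \<omega> = 0" and c: "c \<in> \<A>" and z: "z \<in> chart_image c U"
  shows "local_d n (local_expr c \<omega>) z vs = 0"
proof -
  obtain q where q: "q \<in> U \<inter> cdom c" "z = coord c q" using z by auto
  then have "local_d n (local_expr c \<omega>) z vs = ext_deriv n \<A> U \<omega> c q vs" using c by (simp add: ext_deriv_local_d)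
  then show ?thesis using \<omega> by simp
qed

section \<open>Exactness\<close>

text \<open>
The homotopy operator in one chart around \<open>p\<close> gives a primitive there.  Its pullbacks along the
coordinate changes define a form \<open>\<eta>\<close> in all charts, and \<open>d\<eta>\<close> needs to be compared with \<open>\<omega>\<close> in the
first chart only.
\<close>

lemma closed_forms_locally_exact:
  assumes U: "openin M U" and \<omega>: "\<omega> \<in> holo_forms n \<A> (Suc k) U" and closed: "ext_deriv n \<A> U \<omega> = 0" and p: "p \<in> U"
  shows "\<exists>V. openin M V \<and> p \<in> V \<and> V \<subseteq> U \<and>
    restr (Omega_an n \<A> (Suc k)) U V \<omega> \<in> ext_deriv n \<A> V ` sections (Omega_an n \<A> k) V"
proof -
  obtain c where c: "c \<in> \<A>" "p \<in> cdom c" using ex_chart[OF U p] .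
  obtain r V where r: "r > 0" and V: "openin M V" "p \<in> V" "V \<subseteq> U" "V \<subseteq> cdom c"
    and P: "chart_image c V = polydisc n (coord c p) r" and a: "coord c p \<in> cspace n"
    using chart_polydisc[OF c(1) U p c(2)] .
  have PU: "polydisc n (coord c p) r \<subseteq> chart_image c U"
    unfolding P[symmetric] using V(3) by blast
  define \<eta>0 where "\<eta>0 = homotopy_op k (coord c p) (local_expr c \<omega>)"
  note cV = chart_image_open[OF c(1) V(1)]
  have lf: "local_form n (Suc k) (polydisc n (coord c p) r) (local_expr c \<omega>)"
    by (rule local_form_subset[OF local_form_local_expr[OF \<omega> c(1)] PU])
  have lf0: "local_form n k (chart_image c V) \<eta>0"
    unfolding P \<eta>0_def by (rule local_form_homotopy_op[OF a lf])
  have d0: "local_d n \<eta>0 z vs = local_expr c \<omega> z vs" if "z \<in> chart_image c V" "vs \<in> tuples n (Suc k)" for z vs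
    unfolding \<eta>0_def
  proof (rule local_d_homotopy_op[OF a lf _ _ that(2)])
    show "z \<in> polydisc n (coord c p) r" using that(1) by (simp only: P)
    show "local_d n (local_expr c \<omega>) y us = 0" if "y \<in> polydisc n (coord c p) r" for y us
      using that PU by (intro local_d_eq_0[OF U closed c(1)]) blast
  qed
  define \<eta> where "\<eta> c' q vs = (if c' \<in> \<A> \<and> q \<in> V \<inter> cdom c' \<and> vs \<in> tuples n k
      then \<eta>0 (coord c q) (map (transition_deriv n c' c q) vs) else 0)" for c' q vs
  have \<eta>: "\<eta> \<in> holo_forms n \<A> k V"
  proof (rule holo_formsI[OF V(1)])
    fix c' q assume c': "c' \<in> \<A>" and q: "q \<in> V" "q \<in> cdom c'"
    have W: "copen n (chart_image c' (V \<inter> cdom c))" "copen n (chart_image c (V \<inter> cdom c'))"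
      by (intro chart_image_open c c' openin_Int V cdom_open)+
    have "local_form n k (chart_image c (V \<inter> cdom c')) \<eta>0"
      by (rule local_form_subset[OF lf0]) auto
    from local_form_pullback[OF W transition_holo_map[OF c' c(1)] this]
    have "local_form n k (chart_image c' (V \<inter> cdom c)) (pullback n k (transition c' c) \<eta>0)" .
    moreover have "\<eta> c' q' = pullback n k (transition c' c) \<eta>0 (coord c' q')" if "q' \<in> V \<inter> cdom c'" for q'
      using that c' by (intro ext) (simp add: \<eta>_def pullback_def chart_inv_coord transition_deriv_jacobian)
    moreover have "V \<inter> cdom c = V" using V(4) by blast
    ultimately show "\<exists>V' \<zeta>. openin M V' \<and> q \<in> V' \<and> local_form n k (chart_image c' V') \<zeta> \<and>
        (\<forall>q\<in>V' \<inter> cdom c'. \<eta> c' q = \<zeta> (coord c' q))"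
      using V(1) q by metis
  next
    fix c1 c2 q vs
    assume h: "c1 \<in> \<A>" "c2 \<in> \<A>" "q \<in> V" "q \<in> cdom c1" "q \<in> cdom c2" "vs \<in> tuples n k"
    have "map (transition_deriv n c1 c q) vs = map (transition_deriv n c2 c q) (map (transition_deriv n c1 c2 q) vs)"
      using h V(4) transition_deriv_compose[OF h(1,2) c(1) h(4,5)] by auto
    then have "\<eta>0 (coord c q) (map (transition_deriv n c1 c q) vs) =
        \<eta>0 (coord c q) (map (transition_deriv n c2 c q) (map (transition_deriv n c1 c2 q) vs))"
      by (rule arg_cong)
    moreover have "map (transition_deriv n c1 c2 q) vs \<in> tuples n k"
      by (rule map_transition_tuples[OF h(6)])
    ultimately show "\<eta> c1 q vs = \<eta> c2 q (map (transition_deriv n c1 c2 q) vs)"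
      unfolding \<eta>_def using h by (simp del: map_map)
  qed (auto simp: \<eta>_def)
  have \<eta>c: "local_expr c \<eta> z vs = \<eta>0 z vs" if z: "z \<in> chart_image c V" for z vs
  proof -
    obtain q where q: "q \<in> V" "q \<in> cdom c" "z = coord c q" using z by auto
    show ?thesis
    proof (cases "vs \<in> tuples n k")
      case True
      then have "map (transition_deriv n c c q) vs = vs"
        using transition_deriv_refl[OF c(1) q(2)] by (intro map_idI) (auto simp: tuples_def)
      then show ?thesis using True q c by (simp add: \<eta>_def chart_inv_coord)
    next
      case False
      then show ?thesis using alt_outside[OF local_form_alt[OF lf0 z]] by (simp add: \<eta>_def)
    qed
  qed
  have "ext_deriv n \<A> V \<eta> = restr (Omega_an n \<A> (Suc k)) U V \<omega>"
  proof (rule holo_forms_eqI[OF ext_deriv_form[OF V(1) \<eta>] restr_form[OF U V(1,3) \<omega>] c(1) V(4)])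
    fix q vs assume q: "q \<in> V" and vs: "vs \<in> tuples n (Suc k)"
    have q': "q \<in> cdom c" "coord c q \<in> chart_image c V" using q V(4) by auto
    have "local_d n (local_expr c \<eta>) (coord c q) vs = local_d n \<eta>0 (coord c q) vs"
      by (rule local_d_cong[OF cV \<eta>c q'(2)])
    also have "\<dots> = \<omega> c q vs"
      using d0[OF q'(2) vs] by (simp add: chart_inv_coord[OF c(1) q'(1)])
    finally show "ext_deriv n \<A> V \<eta> c q vs = restr (Omega_an n \<A> (Suc k)) U V \<omega> c q vs"
      using q q' c by (simp add: ext_deriv_local_d restr_Omega)
  qed
  then show ?thesis
    using V \<eta> by (intro exI[of _ V]) (auto simp: sections_Omega intro!: image_eqI[of _ _ \<eta>])
qed

text \<open>
The local expression of a closed function in one chart has vanishing derivative on a polydisc, hence is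
constant; in degree zero the values do not depend on the chart.
\<close>

lemma closed_functions_locally_constant:
  assumes U: "openin M U" and \<omega>: "\<omega> \<in> holo_forms n \<A> 0 U" and closed: "ext_deriv n \<A> U \<omega> = 0" and p: "p \<in> U"
  shows "\<exists>V. openin M V \<and> p \<in> V \<and> V \<subseteq> U \<and>
    restr (Omega_an n \<A> 0) U V \<omega> \<in> constant_inclusion \<A> V ` sections (constant_sheaf M) V"
proof -
  obtain c where c: "c \<in> \<A>" "p \<in> cdom c" using ex_chart[OF U p] .
  obtain r V where r: "r > 0" and V: "openin M V" "p \<in> V" "V \<subseteq> U" "V \<subseteq> cdom c"
    and P: "chart_image c V = polydisc n (coord c p) r" and a: "coord c p \<in> cspace n"
    using chart_polydisc[OF c(1) U p c(2)] .
  have PU: "polydisc n (coord c p) r \<subseteq> chart_image c U"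
    unfolding P[symmetric] using V(3) by blast
  let ?f = "\<lambda>z. local_expr c \<omega> z []"
  have f: "holo n ?f (polydisc n (coord c p) r)"
    using local_form_holo[OF chart_image_open[OF c(1) U] local_form_local_expr[OF \<omega> c(1)], of "[]"]
    by (rule holo_subset[OF _ PU])
  have dir_deriv0: "dir_deriv n ?f w v = 0" if w: "w \<in> polydisc n (coord c p) r" and v: "v \<in> cspace n" for w v
  proof -
    have "w \<in> chart_image c U" using w PU by blast
    from local_d_eq_0[OF U closed c(1) this, of "[v]"] show ?thesis using v by (simp add: local_d_def)
  qed
  have const: "\<omega> c q [] = \<omega> c p []" if "q \<in> V" for q
  proof -
    have q: "q \<in> cdom c" "coord c q \<in> polydisc n (coord c p) r" using that V(4) P by auto
    then have "?f (coord c q) = ?f (coord c p)"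
      by (intro constant_if_dir_deriv_0[OF f a _ dir_deriv0])
    then show ?thesis by (simp only: chart_inv_coord[OF c(1) q(1)] chart_inv_coord[OF c])
  qed
  define s where "s q = (if q \<in> V then \<omega> c p [] else 0)" for q
  have "\<exists>V'. openin M V' \<and> q \<in> V' \<and> V' \<subseteq> V \<and> (\<forall>q'\<in>V'. s q' = s q)" if "q \<in> V" for q
    using V(1) that by (intro exI[of _ V]) (simp add: s_def)
  then have "s \<in> sections (constant_sheaf M) V"
    by (simp add: sections_constant_sheaf s_def)
  moreover have "restr (Omega_an n \<A> 0) U V \<omega> = constant_inclusion \<A> V s"
  proof (intro ext)
    fix c' q vs
    show "restr (Omega_an n \<A> 0) U V \<omega> c' q vs = constant_inclusion \<A> V s c' q vs"
    proof (cases "c' \<in> \<A> \<and> q \<in> V \<inter> cdom c' \<and> vs = []")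
      case True
      then have h: "c' \<in> \<A>" "q \<in> U" "q \<in> V" "q \<in> cdom c'" "q \<in> cdom c" "vs = []" using V by auto
      have "\<omega> c' q [] = \<omega> c q []"
        using form_compat[OF \<omega> h(1) c(1) h(2,4,5), of "[]"] by (simp add: tuples_def)
      then show ?thesis using h const[OF h(3)] by (simp add: restr_Omega constant_inclusion_def s_def)
    next
      case False
      have "vs \<notin> tuples n 0" if "vs \<noteq> []" using that by (simp add: tuples_def)
      then show ?thesis
        using False form_off_tuples[OF \<omega>, of vs c' q] form_off[OF \<omega>, of c' q vs]
        by (auto simp: restr_Omega constant_inclusion_def)
    qed
  qed
  ultimately show ?thesis using V by blast
qed

lemma constant_inclusion_form:
  assumes U: "openin M U" and s: "s \<in> sections (constant_sheaf M) U"
  shows "constant_inclusion \<A> U s \<in> holo_forms n \<A> 0 U"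
proof (rule holo_formsI[OF U])
  fix c p assume c: "c \<in> \<A>" and p: "p \<in> U" "p \<in> cdom c"
  obtain V where V: "openin M V" "p \<in> V" "V \<subseteq> U" and const: "\<forall>q\<in>V. s q = s p"
    using locally_constant[OF s p(1)] by (elim exE conjE) (rule that)
  let ?\<eta> = "\<lambda>z vs. if vs = [] then s p else 0"
  have "?\<eta> z \<in> alternating_forms n 0" for z :: "nat \<Rightarrow> complex"
    by (rule alternating_formsI) (auto simp: tuples_def)
  then have "local_form n 0 (chart_image c V) ?\<eta>"
    by (simp add: local_form_def holo_const)
  moreover have "constant_inclusion \<A> U s c q = ?\<eta> (coord c q)" if "q \<in> V \<inter> cdom c" for q
  proof -
    have "s q = s p" using const that by blast
    then show ?thesis using that V(3) c by (auto simp: constant_inclusion_def fun_eq_iff)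
  qed
  ultimately show "\<exists>V \<eta>. openin M V \<and> p \<in> V \<and> local_form n 0 (chart_image c V) \<eta> \<and>
      (\<forall>q\<in>V \<inter> cdom c. constant_inclusion \<A> U s c q = \<eta> (coord c q))"
    using V by blast
qed (auto simp: constant_inclusion_def)

lemma ext_deriv_constant_inclusion:
  assumes U: "openin M U" and s: "s \<in> sections (constant_sheaf M) U"
  shows "ext_deriv n \<A> U (constant_inclusion \<A> U s) = 0"
proof (intro ext)
  fix c p vs
  show "ext_deriv n \<A> U (constant_inclusion \<A> U s) c p vs = 0 c p vs"
  proof (cases "c \<in> \<A> \<and> p \<in> U \<inter> cdom c")
    case True
    then have c: "c \<in> \<A>" and p: "p \<in> U" "p \<in> cdom c" by auto
    obtain V where V: "openin M V" "p \<in> V" "V \<subseteq> U" and const: "\<forall>q\<in>V. s q = s p"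
      using locally_constant[OF s p(1)] by (elim exE conjE) (rule that)
    have "local_d n (local_expr c (constant_inclusion \<A> U s)) (coord c p) vs =
        local_d n (\<lambda>z vs. if vs = [] then s p else 0) (coord c p) vs"
    proof (rule local_d_cong[OF chart_image_open[OF c V(1)]])
      fix z us assume "z \<in> chart_image c V"
      then obtain q where q: "q \<in> V" "q \<in> cdom c" "z = coord c q" by auto
      have "s q = s p" using const q(1) by blast
      then show "local_expr c (constant_inclusion \<A> U s) z us = (if us = [] then s p else 0)"
        using q V(3) c by (auto simp: constant_inclusion_def chart_inv_coord)
    qed (use V p in auto)
    also have "\<dots> = 0" by (simp add: local_d_def)
    finally show ?thesis using True by (simp add: ext_deriv_local_d)
  qed (auto simp: ext_deriv_local_d)
qed

lemma sheaf_morphism_constant_inclusion: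
  "sheaf_morphism M (constant_sheaf M) (Omega_an n \<A> 0) (constant_inclusion \<A>)"
  unfolding sheaf_morphism_def
proof (intro conjI allI impI ballI)
  fix U s assume "openin M U" "s \<in> sections (constant_sheaf M) U"
  then show "constant_inclusion \<A> U s \<in> sections (Omega_an n \<A> 0) U"
    using constant_inclusion_form by (simp add: sections_Omega)
next
  fix U s t
  show "constant_inclusion \<A> U (s + t) = constant_inclusion \<A> U s + constant_inclusion \<A> U t"
    by (auto simp: constant_inclusion_def fun_eq_iff)
next
  fix U V s assume "openin M U \<and> openin M V \<and> V \<subseteq> U"
  then show "constant_inclusion \<A> V (restr (constant_sheaf M) U V s) =
      restr (Omega_an n \<A> 0) U V (constant_inclusion \<A> U s)"
    by (auto simp: constant_inclusion_def fun_eq_iff restr_constant_sheaf restr_Omega)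
qed

lemma constant_inclusion_injective:
  assumes U: "openin M U" and s: "s \<in> sections (constant_sheaf M) U" and 0: "constant_inclusion \<A> U s = 0"
  shows "s = 0"
proof
  fix p show "s p = 0 p"
  proof (cases "p \<in> U")
    case True
    obtain c where "c \<in> \<A>" "p \<in> cdom c" using ex_chart[OF U True] .
    then have "s p = constant_inclusion \<A> U s c p []" using True by (simp add: constant_inclusion_def)
    then show ?thesis by (simp add: 0)
  next
    case False
    then show ?thesis using s by (simp add: sections_constant_sheaf)
  qed
qed

lemma exact_at_constants:
  "exact_at M zero_sheaf zero_morphism (constant_sheaf M) (constant_inclusion \<A>) (Omega_an n \<A> 0)"
proof (rule exact_atI[OF is_sheaf_zero_sheaf is_sheaf_constant_sheaf is_sheaf_Omega
      sheaf_morphism_from_zero[OF is_sheaf_constant_sheaf] sheaf_morphism_constant_inclusion])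
  show "constant_inclusion \<A> V (zero_morphism V t) = 0" for V and t :: complex
    by (simp add: constant_inclusion_def zero_morphism_def fun_eq_iff)
  fix U s p
  assume h: "openin M U" "s \<in> sections (constant_sheaf M) U" "constant_inclusion \<A> U s = 0" "p \<in> U"
  then have "s = 0" using constant_inclusion_injective by blast
  then show "\<exists>V. openin M V \<and> p \<in> V \<and> V \<subseteq> U \<and>
      restr (constant_sheaf M) U V s \<in> zero_morphism V ` sections zero_sheaf V"
    using h by (intro exI[of _ U]) (simp add: restr_constant_sheaf zero_morphism_def zero_sheaf_def fun_eq_iff)
qed

lemma exact_at_functions:
  "exact_at M (constant_sheaf M) (constant_inclusion \<A>) (Omega_an n \<A> 0)
    (ext_deriv n \<A>) (Omega_an n \<A> 1)"
  by (rule exact_atI[OF is_sheaf_constant_sheaf is_sheaf_Omega is_sheaf_Omega sheaf_morphism_constant_inclusion])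
    (simp_all add: sheaf_morphism_ext_deriv[of 0, simplified] ext_deriv_constant_inclusion
      closed_functions_locally_constant sections_Omega)

lemma exact_at_forms:
  "exact_at M (Omega_an n \<A> k) (ext_deriv n \<A>) (Omega_an n \<A> (Suc k))
    (ext_deriv n \<A>) (Omega_an n \<A> (Suc (Suc k)))"
  by (rule exact_atI[OF is_sheaf_Omega is_sheaf_Omega is_sheaf_Omega sheaf_morphism_ext_deriv sheaf_morphism_ext_deriv])
    (simp_all add: sections_Omega ext_deriv_ext_deriv closed_forms_locally_exact[unfolded sections_Omega])

text \<open>
In dimension zero every function is closed, as all forms of positive degree are zero.
\<close>

lemma exact_at_points:
  assumes "n = 0"
  shows "exact_at M (constant_sheaf M) (constant_inclusion \<A>) (Omega_an n \<A> 0) zero_morphism zero_sheaf"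
proof (rule exact_atI[OF is_sheaf_constant_sheaf is_sheaf_Omega is_sheaf_zero_sheaf
      sheaf_morphism_constant_inclusion sheaf_morphism_to_zero])
  fix U s p assume h: "openin M U" "s \<in> sections (Omega_an n \<A> 0) U" "p \<in> U"
  then have "ext_deriv n \<A> U s = 0" using ext_deriv_top[of U s] assms by (simp add: sections_Omega)
  with h show "\<exists>V. openin M V \<and> p \<in> V \<and> V \<subseteq> U \<and>
      restr (Omega_an n \<A> 0) U V s \<in> constant_inclusion \<A> V ` sections (constant_sheaf M) V"
    by (intro closed_functions_locally_constant) (simp_all add: sections_Omega)
qed (simp add: zero_morphism_def)

lemma exact_at_top:
  assumes "n = Suc k"
  shows "exact_at M (Omega_an n \<A> k) (ext_deriv n \<A>) (Omega_an n \<A> n) zero_morphism zero_sheaf"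
proof -
  have "exact_at M (Omega_an n \<A> k) (ext_deriv n \<A>) (Omega_an n \<A> (Suc k)) zero_morphism zero_sheaf"
  proof (rule exact_atI[OF is_sheaf_Omega is_sheaf_Omega is_sheaf_zero_sheaf
        sheaf_morphism_ext_deriv sheaf_morphism_to_zero])
    fix U s p assume h: "openin M U" "s \<in> sections (Omega_an n \<A> (Suc k)) U" "p \<in> U"
    then have "ext_deriv n \<A> U s = 0" using ext_deriv_top[of U s] assms by (simp add: sections_Omega)
    with h show "\<exists>V. openin M V \<and> p \<in> V \<and> V \<subseteq> U \<and>
        restr (Omega_an n \<A> (Suc k)) U V s \<in> ext_deriv n \<A> V ` sections (Omega_an n \<A> k) V"
      by (intro closed_forms_locally_exact) (simp_all add: sections_Omega)
  qed (simp add: zero_morphism_def)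
  then show ?thesis using assms by simp
qed

end

theorem theorem2p5p1:
  fixes n :: nat and M :: "'a topology" and \<A> :: "'a chart set"
  assumes "complex_manifold n M \<A>"
  shows
    "exact_at M zero_sheaf zero_morphism (constant_sheaf M)
       (constant_inclusion \<A>) (Omega_an n \<A> 0) \<and>
     (n = 0 \<longrightarrow>
       exact_at M (constant_sheaf M) (constant_inclusion \<A>) (Omega_an n \<A> 0)
         zero_morphism zero_sheaf) \<and>
     (n > 0 \<longrightarrow>
       exact_at M (constant_sheaf M) (constant_inclusion \<A>) (Omega_an n \<A> 0)
         (ext_deriv n \<A>) (Omega_an n \<A> 1)) \<and>
     (\<forall>k. 0 < k \<and> k < n \<longrightarrow>
       exact_at M (Omega_an n \<A> (k - 1)) (ext_deriv n \<A>) (Omega_an n \<A> k)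
         (ext_deriv n \<A>) (Omega_an n \<A> (k + 1))) \<and>
     (n > 0 \<longrightarrow>
       exact_at M (Omega_an n \<A> (n - 1)) (ext_deriv n \<A>) (Omega_an n \<A> n)
         zero_morphism zero_sheaf)"
proof (intro conjI allI impI)
  fix k assume "0 < k \<and> k < n"
  then show "exact_at M (Omega_an n \<A> (k - 1)) (ext_deriv n \<A>) (Omega_an n \<A> k)
      (ext_deriv n \<A>) (Omega_an n \<A> (k + 1))"
    using exact_at_forms[OF assms, of "k - 1"] by simp
next
  assume "n > 0"
  then show "exact_at M (Omega_an n \<A> (n - 1)) (ext_deriv n \<A>) (Omega_an n \<A> n) zero_morphism zero_sheaf"
    using exact_at_top[OF assms, of "n - 1"] by simp
qed (use exact_at_constants[OF assms] exact_at_functions[OF assms] exact_at_points[OF assms] in simp_all)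

end
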